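(* Let $n$ be the number of buyers, $\lambda\in(0,1]$, $[a,b]$ the support information with $0\le a<b$, and let $k_l,k_h$ be the thresholds (depending only on $n,\lambda$) defined in the context. Depending on the value of $a/b$, the following mechanism $m^*$ is robustly optimal for the minimax $\lambda$-regret problem over all DSIC mechanisms against i.i.d. distributions, i.e. $\sup_{\mathbf F\in\mathcal F_{\rm iid}}R_\lambda(m^*,\mathbf F)=\inf_{m\in\mathcal M_{\rm all}}\sup_{\mathbf F\in\mathcal F_{\rm iid}}R_\lambda(m,\mathbf F)$. (1) Suppose $a/b\le k_l$, and let $r^*=k_l b$. An optimal mechanism is $\mathrm{SPA}(\Phi^* )$ with $$\Phi^*(v)=\lambda\,\frac{v^{n-1}}{(v-r^* )^{n-1}}\int_{r^*}^{v}\frac{(t-r^* )^{n-1}}{t^n}\,dt$$ for $v\in(r^*,b]$, and $\Phi^*(v)=0$ for $v\le r^*$. (2) Suppose $a/b\ge k_h$, and let $\phi_0=(a-k_h b)/(1-k_h)$. An optimal mechanism is $\mathrm{POOL}(\Psi^* )$ with $$\Psi^*(v)=\frac{n\lambda}{n-1}\left(\frac{v-\phi_0}{v-a}\right)^{n}\int_{a}^{v}\frac{(t-a)^n}{(t-\phi_0)^{n+1}}\,dt.$$ (3) Suppose $k_l\le a/b\le k_h$. Let $(v^*,\alpha)$ be the unique solution to $$\frac{(v^*-a)^{n-1}}{(v^* )^{n-1}}(1-n\alpha)=\lambda\int_a^{v^*}\frac{(t-a)^{n-1}}{t^n}\,dt,$$ $$\frac{(b-a)^n}{b^n}-\frac{(v^*-a)^n}{(v^*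 )^n}\bigl(1-(n-1)\alpha\bigr)=\int_{v^*}^{b}\left[\frac{(t-a)^{n-1}}{t^n}-(1-\lambda)\frac{(t-a)^n}{t^{n+1}}\right]dt.$$ An optimal mechanism is based on a unified threshold distribution $\mathcal D$: draw a sample $r\sim\mathcal D$; if $r\le v^*$ the mechanism is $\mathrm{SPA}(r)$, otherwise the mechanism is $\mathrm{POOL}(r)$, where the CDF of $\mathcal D$ is $$\mathcal D(v)=\begin{cases}\lambda\left(\frac{v}{v-a}\right)^{n-1}\displaystyle\int_a^v\frac{(t-a)^{n-1}}{t^n}\,dt & \text{for } v\in[a,v^*],\\[2mm] -\frac1{n-1}+\frac{n}{n-1}\left(\frac{v}{v-a}\right)^n\left[\left(\frac{b-a}{b}\right)^n-\displaystyle\int_v^b\left[\frac{(t-a)^{n-1}}{t^n}-(1-\lambda)\frac{(t-a)^n}{t^{n+1}}\right]dt\right] & \text{for } v\in[v^*,b].\end{cases}$$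
   Context: Setting. A seller sells one item to $n$ buyers with valuations $\mathbf v=(v_1,\dots,v_n)\in[a,b]^n$. A (direct) mechanism is $m=(\mathbf x,\mathbf p)$ with allocation $\mathbf x:[a,b]^n\to[0,1]^n$ and payment $\mathbf p:[a,b]^n\to\mathbb R^n$. $\mathcal M_{\rm all}$ is the class of all (dominant strategy incentive compatible, DSIC) mechanisms such that for all $i$, $v_i,\hat v_i\in[a,b]$, $\mathbf v_{-i}\in[a,b]^{n-1}$: (IR) $v_ix_i(v_i,\mathbf v_{-i})-p_i(v_i,\mathbf v_{-i})\ge0$; (IC) $v_ix_i(v_i,\mathbf v_{-i})-p_i(v_i,\mathbf v_{-i})\ge v_ix_i(\hat v_i,\mathbf v_{-i})-p_i(\hat v_i,\mathbf v_{-i})$; (AC) $\sum_i x_i(\mathbf v)\le1$. $\mathcal F_{\rm iid}$ is the class of product distributions $\mathbf F(\mathbf v)=\prod_iF(v_i)$ with $F$ a distribution with support on $[a,b]$. The $\lambda$-regret is $R_\lambda(m,\mathbf F)=\mathbb E_{\mathbf v\sim\mathbf F}[\lambda\max(\mathbf v)-\sum_ip_i(\mathbf v)]$. Mechanisms. Let $v^{(1)}$ and $v^{(2)}$ be the highest and second-highest entries of $\mathbf v$, and let $k$ be the number of buyers with value equal to $v^{(1)}$. $\mathrm{SPA}(r)$ (second-price auction with reserve $r$): $x_i=\mathbf 1(v_i=v^{(1)})/k$ if $v^{(1)}\ge r$, and $0$ if $v^{(1)}<r$; $p_i=v^{(2)}\mathbf 1(v_i=v^{(1)})/k$ if $v^{(2)}\ge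 r$; $p_i=r\,\mathbf 1(v_i=v^{(1)})/k$ if $v^{(1)}\ge r>v^{(2)}$; $p_i=0$ if $v^{(1)}<r$. $\mathrm{POOL}(\tau)$ (pooling auction with threshold $\tau$): $x_i=\mathbf 1(v_i=v^{(1)})/k$ if $v^{(1)}\ge\tau$, and $x_i=1/n$ if $v^{(1)}<\tau$; $p_i=v^{(2)}\mathbf 1(v_i=v^{(1)})/k$ if $v^{(2)}\ge\tau$; $p_i=\frac{(n-1)\tau+a}{n}\cdot\frac{\mathbf 1(v_i=v^{(1)})}{k}$ if $v^{(1)}\ge\tau>v^{(2)}$; $p_i=a/n$ if $v^{(1)}<\tau$. $\mathrm{SPA}(\Phi)$ (resp. $\mathrm{POOL}(\Psi)$) is the mechanism with random reserve $r$ drawn from $\Phi$ (resp. random threshold $\tau$ drawn from $\Psi$); distributions are identified with their CDFs. Thresholds. $k_l\in(0,1)$ is the unique solution of $\lambda\int_{k_l}^1\frac{(t-k_l)^{n-1}}{t^n}dt=(1-k_l)^{n-1}$. If $n=1$, $k_h=1$; if $n\ge2$, $k_h\in(0,1)$ is the unique solution of $\int_{k_h}^1\left[\frac{(t-k_h)^{n-1}}{t^n}-(1-\lambda)\frac{(t-k_h)^n}{t^{n+1}}\right]dt=(1-k_h)^n$.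
   Formalization: In case (3), uniqueness of (v*,α) is claimed only for a/b<k_h: at a/b=k_h, n≥2, v*=a and every α solves, so only v* is unique and each solution is optimal. For n=1 (v*=b) the first branch defines D at b; the second divides by zero; the leftover mass α lies above v*. *)

theory Defs
  imports "HOL-Probability.Probability"
begin

type_synonym valuation = "nat \<Rightarrow> real"

(* Allocation rule and payment rule. Buyers are 0, ..., n - 1; only valuations in
   [a,b]^n = PiE {..<n} (%_. {a..b}) and buyers i < n matter. *)
type_synonym mechanism = "(valuation \<Rightarrow> nat \<Rightarrow> real) \<times> (valuation \<Rightarrow> nat \<Rightarrow> real)"

abbreviation val_profiles :: "nat \<Rightarrow> real \<Rightarrow> real \<Rightarrow> valuation set" where
  "val_profiles n a b \<equiv> Pi\<^sub>E {..<n} (\<lambda>_. {a..b})"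

abbreviation val_algebra :: "nat \<Rightarrow> real \<Rightarrow> real \<Rightarrow> valuation measure" where
  "val_algebra n a b \<equiv> Pi\<^sub>M {..<n} (\<lambda>_. restrict_space borel {a..b})"

(* Measurability is the standing assumption under which expected payments make sense;
   without it the integrals below would take arbitrary values. *)
definition M_all :: "nat \<Rightarrow> real \<Rightarrow> real \<Rightarrow> mechanism set" where
  "M_all n a b = {(x, p).
     (\<forall>i<n. (\<lambda>v. x v i) \<in> borel_measurable (val_algebra n a b)) \<and>
     (\<forall>i<n. (\<lambda>v. p v i) \<in> borel_measurable (val_algebra n a b)) \<and>
     (\<forall>v\<in>val_profiles n a b. \<forall>i<n. 0 \<le> x v i \<and> x v i \<le> 1) \<and>
     (\<forall>v\<in>val_profiles n a b. \<forall>i<n. v i * x v i - p v i \<ge> 0) \<and>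
     (\<forall>v\<in>val_profiles n a b. \<forall>i<n. \<forall>w\<in>{a..b}.
        v i * x v i - p v i \<ge> v i * x (v(i := w)) i - p (v(i := w)) i) \<and>
     (\<forall>v\<in>val_profiles n a b. (\<Sum>i<n. x v i) \<le> 1)}"

definition F_iid :: "nat \<Rightarrow> real \<Rightarrow> real \<Rightarrow> valuation measure set" where
  "F_iid n a b = {Pi\<^sub>M {..<n} (\<lambda>_. F) | F.
     prob_space F \<and> sets F = sets (restrict_space borel {a..b})}"

definition highest :: "nat \<Rightarrow> valuation \<Rightarrow> real" where
  "highest n v = Max (v ` {..<n})"

definition num_highest :: "nat \<Rightarrow> valuation \<Rightarrow> nat" where
  "num_highest n v = card {i. i < n \<and> v i = highest n v}"

(* Entries are counted with multiplicity. Not meaningful for n = 1. *)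
definition second_highest :: "nat \<Rightarrow> valuation \<Rightarrow> real" where
  "second_highest n v =
     (if num_highest n v \<ge> 2 then highest n v
      else Max (v ` {i. i < n \<and> v i \<noteq> highest n v}))"

(* An expectation in the extended reals: payments of a mechanism in M_all may be unbounded
   below, so the regret can be infinite (its integrand is bounded below by -b, so the
   difference is never of the form infinity - infinity). The coercion ennreal
   truncates negative numbers to 0, giving positive and negative part. *)
definition regret :: "real \<Rightarrow> nat \<Rightarrow> mechanism \<Rightarrow> valuation measure \<Rightarrow> ereal" where
  "regret lam n m P =
     enn2ereal (\<integral>\<^sup>+ v. ennreal (lam * highest n v - (\<Sum>i<n. snd m v i)) \<partial>P)
   - enn2ereal (\<integral>\<^sup>+ v. ennreal (- (lam * highest n v - (\<Sum>i<n. snd m v i))) \<partial>P)"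

definition robustly_optimal :: "real \<Rightarrow> nat \<Rightarrow> real \<Rightarrow> real \<Rightarrow> mechanism \<Rightarrow> bool" where
  "robustly_optimal lam n a b m \<longleftrightarrow>
     m \<in> M_all n a b \<and>
     (SUP P\<in>F_iid n a b. regret lam n m P)
       = (INF m'\<in>M_all n a b. SUP P\<in>F_iid n a b. regret lam n m' P)"

definition win_share :: "nat \<Rightarrow> valuation \<Rightarrow> nat \<Rightarrow> real" where
  "win_share n v i = (if v i = highest n v then 1 / real (num_highest n v) else 0)"

(* For n = 1 there is no second-highest value; the guard 2 \<le> n treats it as lying below
   every reserve, so that SPA is a posted price r. *)
definition SPA :: "nat \<Rightarrow> real \<Rightarrow> mechanism" where
  "SPA n r =
     (\<lambda>v i. if highest n v \<ge> r then win_share n v i else 0,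
      \<lambda>v i. if 2 \<le> n \<and> second_highest n v \<ge> r then second_highest n v * win_share n v i
            else if highest n v \<ge> r then r * win_share n v i
            else 0)"

definition POOL :: "nat \<Rightarrow> real \<Rightarrow> real \<Rightarrow> mechanism" where
  "POOL n a \<tau> =
     (\<lambda>v i. if highest n v \<ge> \<tau> then win_share n v i else 1 / real n,
      \<lambda>v i. if 2 \<le> n \<and> second_highest n v \<ge> \<tau> then second_highest n v * win_share n v i
            else if highest n v \<ge> \<tau> then ((real n - 1) * \<tau> + a) / real n * win_share n v i
            else a / real n)"

(* The mechanism that draws r from D and then runs fam r. *)
definition random_mechanism :: "real measure \<Rightarrow> (real \<Rightarrow> mechanism) \<Rightarrow> mechanism" where
  "random_mechanism D fam =
     (\<lambda>v i. \<integral>r. fst (fam r) v i \<partial>D, \<lambda>v i. \<integral>r. snd (fam r) v i \<partial>D)"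

definition has_cdf_on :: "real measure \<Rightarrow> (real \<Rightarrow> real) \<Rightarrow> real set \<Rightarrow> bool" where
  "has_cdf_on D G S \<longleftrightarrow> real_distribution D \<and> (\<forall>v\<in>S. cdf D v = G v)"

definition k_low :: "real \<Rightarrow> nat \<Rightarrow> real" where
  "k_low lam n = (THE k. 0 < k \<and> k < 1 \<and>
     lam * integral {k..1} (\<lambda>t. (t - k) ^ (n - 1) / t ^ n) = (1 - k) ^ (n - 1))"

definition k_high :: "real \<Rightarrow> nat \<Rightarrow> real" where
  "k_high lam n = (if n = 1 then 1 else (THE k. 0 < k \<and> k < 1 \<and>
     integral {k..1} (\<lambda>t. (t - k) ^ (n - 1) / t ^ n - (1 - lam) * ((t - k) ^ n / t ^ (n + 1)))
       = (1 - k) ^ n))"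

definition Phi_star :: "real \<Rightarrow> nat \<Rightarrow> real \<Rightarrow> real \<Rightarrow> real" where
  "Phi_star lam n r v =
     (if v \<le> r then 0
      else lam * (v ^ (n - 1) / (v - r) ^ (n - 1))
             * integral {r..v} (\<lambda>t. (t - r) ^ (n - 1) / t ^ n))"

(* At v = a the quotient is 0 by convention, which is also the limit of the formula. *)
definition Psi_star :: "real \<Rightarrow> nat \<Rightarrow> real \<Rightarrow> real \<Rightarrow> real \<Rightarrow> real" where
  "Psi_star lam n a \<phi> v =
     real n * lam / (real n - 1) * ((v - \<phi>) / (v - a)) ^ n
       * integral {a..v} (\<lambda>t. (t - a) ^ n / (t - \<phi>) ^ (n + 1))"

(* If a / b = k_high lam n, then vs = a and the equations hold for every \<alpha> (n \<ge> 2);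
   the distribution D_star below does not depend on \<alpha>. *)
definition intermediate_solution ::
  "real \<Rightarrow> nat \<Rightarrow> real \<Rightarrow> real \<Rightarrow> real \<Rightarrow> real \<Rightarrow> bool" where
  "intermediate_solution lam n a b vs \<alpha> \<longleftrightarrow>
     a \<le> vs \<and> vs \<le> b \<and>
     (vs - a) ^ (n - 1) / vs ^ (n - 1) * (1 - real n * \<alpha>)
       = lam * integral {a..vs} (\<lambda>t. (t - a) ^ (n - 1) / t ^ n) \<and>
     (b - a) ^ n / b ^ n - (vs - a) ^ n / vs ^ n * (1 - (real n - 1) * \<alpha>)
       = integral {vs..b}
           (\<lambda>t. (t - a) ^ (n - 1) / t ^ n - (1 - lam) * ((t - a) ^ n / t ^ (n + 1)))"

(* On [a,b]. For n = 1 one has vs = b, so the second branch, which divides by n - 1, is never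
   used. Then the value at b is 1 - \<alpha>, and a distribution with this cdf on [a,b] puts the
   remaining mass \<alpha> above vs, i.e. on the pooling auction (the posted price a).
   At v = a, v / (v - a) is 0 by convention; the value 0 is also the limit. *)
definition D_star :: "real \<Rightarrow> nat \<Rightarrow> real \<Rightarrow> real \<Rightarrow> real \<Rightarrow> real \<Rightarrow> real" where
  "D_star lam n a b vs v =
     (if v \<le> vs
      then lam * (v / (v - a)) ^ (n - 1) * integral {a..v} (\<lambda>t. (t - a) ^ (n - 1) / t ^ n)
      else - 1 / (real n - 1) + real n / (real n - 1) * (v / (v - a)) ^ n
             * (((b - a) / b) ^ n
                - integral {v..b}
                    (\<lambda>t. (t - a) ^ (n - 1) / t ^ n - (1 - lam) * ((t - a) ^ n / t ^ (n + 1)))))"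

end

theory Submission
  imports Defs
begin

text \<open>
  The optimal mechanism \<open>m\<^sup>*\<close> forms a saddle point with a value distribution \<open>F\<^sup>*\<close> whose
  virtual value is a constant \<open>\<phi> \<ge> 0\<close> below an atom at \<open>b\<close>, that is
  \<open>F\<^sup>*(t) = (t - c) / (t - \<phi>)\<close> for \<open>c \<le> t < b\<close>.

  Against \<open>m\<^sup>*\<close>, both the highest value and the payments are integrals over \<open>t\<close>
  of indicators that the highest or the second-highest value exceeds \<open>t\<close>. Hence the expected
  regret is an integral over levels \<open>t\<close> of an expression in \<open>z = F(t)\<close>, and it can be maximised
  separately at each level. The first-order condition at \<open>z = F\<^sup>*(t)\<close> is a linear differential equation for the cdf of the random threshold; the formulas for
  \<open>\<Phi>\<^sup>*\<close>, \<open>\<Psi>\<^sup>*\<close> and \<open>\<D>\<close> are its solutions, and the thresholds make the total mass equal to one.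

  Against \<open>F\<^sup>*\<close>, the envelope inequality bounds the revenue of any mechanism by the expected virtual
  value of the winner, and \<open>m\<^sup>*\<close> attains this bound.
\<close>

section \<open>Truncated logarithms\<close>

text \<open>All three regimes are members of one family: SPA below a switch point \<open>vs\<close>,
  POOL above it, with \<open>vs = b\<close> and \<open>vs = a\<close> as extremes. The constant
  virtual value \<phi> of the adversary decides between them. If \<phi> = 0, withholding the item
  costs nothing against it, so a reserve is a best response; if \<phi> > 0, the item must always be
  sold, and pooling does this while a threshold is still randomised. As a/b grows, the adversary has
  (c, \<phi>) = (k_l b, 0), then (a, 0), then (a, \<phi>_0). That the bound is attained is read off
  from an explicit antiderivative of the revenue density, whose end values give
  \<open>top_revenue\<close>. Two obstacles shape the details. A competing mechanism may have
  payments unbounded below and an allocation rule that is merely monotone in the own bid, so the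
  regret is an extended real and the envelope inequality is proved by a discrete telescoping
  argument. For n = 1 the intermediate threshold distribution may have less than full mass on
  [a, b]; the rest lies above b, where it acts as the posted price a.\<close>

text \<open>
  \<open>ltail m u\<close> is the integral of \<open>s\<^sup>m / (1 - s)\<close> over \<open>[0, u]\<close>. The substitution \<open>s = (t - c) / (t - \<phi>)\<close>
  reduces every integral in the statement to it.
\<close>

definition ltail :: "nat \<Rightarrow> real \<Rightarrow> real" where
  "ltail m u = - ln (1 - u) - (\<Sum>k=1..m. u ^ k / real k)"

text \<open>In the coordinate u = (t - c) / (t - \<phi>) the first-order condition reads, up to
  constant factors, y' = 1 / (1 - u) - m y / u. This is its solution vanishing at u = 0; m = n - 1
  belongs to the SPA branch and m = n to the POOL branch.\<close>

definition lratio :: "nat \<Rightarrow> real \<Rightarrow> real" where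
  "lratio m u = ltail m u / u ^ m"

lemma ltail_zero [simp]: "ltail m 0 = 0"
  unfolding ltail_def by (subst sum.neutral) auto

lemma lratio_zero [simp]: "lratio m 0 = 0"
  by (simp add: lratio_def)

lemma ltail_Suc: "ltail (Suc m) u = ltail m u - u ^ Suc m / real (Suc m)"
  by (simp add: ltail_def)

lemma ltail_pred: "1 \<le> n \<Longrightarrow> ltail n u = ltail (n - 1) u - u ^ n / real n"
  using ltail_Suc[of "n - 1" u] by simp

lemma ltail_deriv:
  assumes "u < 1"
  shows "(ltail m has_real_derivative u ^ m / (1 - u)) (at u)"
proof (induction m)
  case 0
  have "((\<lambda>u. - ln (1 - u)) has_real_derivative 1 / (1 - u)) (at u)"
    using assms by (auto intro!: derivative_eq_intros)
  moreover have "ltail 0 = (\<lambda>u. - ln (1 - u))"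
    by (simp add: ltail_def fun_eq_iff)
  ultimately show ?case by simp
next
  case (Suc m)
  have "((\<lambda>u. ltail m u - u ^ Suc m / real (Suc m)) has_real_derivative
      u ^ m / (1 - u) - real (Suc m) * u ^ m / real (Suc m)) (at u)"
  proof (rule DERIV_diff[OF Suc.IH])
    show "((\<lambda>u. u ^ Suc m / real (Suc m)) has_real_derivative
        real (Suc m) * u ^ m / real (Suc m)) (at u)"
      using DERIV_cdivide[OF DERIV_pow[of "Suc m" u UNIV], of "real (Suc m)"] by simp
  qed
  moreover have "u ^ m / (1 - u) - real (Suc m) * u ^ m / real (Suc m) = u ^ Suc m / (1 - u)"
    using assms by (simp del: of_nat_Suc) (simp add: field_simps)
  moreover have "ltail (Suc m) = (\<lambda>u. ltail m u - u ^ Suc m / real (Suc m))"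
    by (simp add: fun_eq_iff ltail_Suc)
  ultimately show ?case by simp
qed

lemma ltail_continuous: "S \<subseteq> {..<1} \<Longrightarrow> continuous_on S (ltail m)"
  by (meson DERIV_isCont continuous_at_imp_continuous_on lessThan_iff ltail_deriv subsetD)

lemma ltail_mono:
  assumes "0 \<le> x" "x \<le> y" "y < 1"
  shows "ltail m x \<le> ltail m y"
proof (rule DERIV_nonneg_imp_nondecreasing[OF assms(2)])
  fix u assume "x \<le> u" "u \<le> y"
  then show "\<exists>d. (ltail m has_real_derivative d) (at u) \<and> 0 \<le> d"
    using assms ltail_deriv[of u m] by (intro exI[of _ "u ^ m / (1 - u)"]) auto
qed

lemma ltail_nonneg: "0 \<le> u \<Longrightarrow> u < 1 \<Longrightarrow> 0 \<le> ltail m u"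
  using ltail_mono[of 0 u m] by simp

text \<open>Replacing 1 / (1 - s) by 1 / (1 - u) under the integral gives the right-hand side. The
  factor 1 / (m + 1) beats the factor m in the equation for \<open>lratio m\<close>; this makes
  \<open>lratio\<close> increasing and all threshold densities nonnegative.\<close>

lemma ltail_le:
  assumes "0 \<le> u" "u < 1"
  shows "ltail m u \<le> u ^ Suc m / (real (Suc m) * (1 - u))"
proof -
  let ?f = "\<lambda>u. u ^ Suc m / (real (Suc m) * (1 - u)) - ltail m u"
  have "?f 0 \<le> ?f u"
  proof (rule DERIV_nonneg_imp_nondecreasing[OF assms(1)])
    fix x assume x: "0 \<le> x" "x \<le> u"
    then have x1: "x < 1" using assms by simp
    have "(?f has_real_derivative
        ((real (Suc m) * x ^ m) * (real (Suc m) * (1 - x)) - x ^ Suc m * (real (Suc m) * (-1)))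
          / ((real (Suc m) * (1 - x)) * (real (Suc m) * (1 - x))) - x ^ m / (1 - x)) (at x)"
      using x1 by (intro DERIV_diff DERIV_divide ltail_deriv)
        (auto intro!: derivative_eq_intros DERIV_pow[THEN DERIV_cong] simp del: of_nat_Suc power_Suc)
    moreover have "((real (Suc m) * x ^ m) * (real (Suc m) * (1 - x)) - x ^ Suc m * (real (Suc m) * (-1)))
          / ((real (Suc m) * (1 - x)) * (real (Suc m) * (1 - x))) - x ^ m / (1 - x)
        = x ^ Suc m / (real (Suc m) * (1 - x) ^ 2)"
    proof -
      have "((M * X) * (M * D) - (x * X) * (M * (-1))) / ((M * D) * (M * D)) - X / D
          = x * X / (M * D ^ 2)" if "M > 0" "D > 0" for M D X :: real
        using that by (simp add: field_simps power2_eq_square)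
      from this[of "real (Suc m)" "1 - x" "x ^ m"] show ?thesis
        using x1 by simp
    qed
    ultimately show "\<exists>d. (?f has_real_derivative d) (at x) \<and> 0 \<le> d"
      using x x1 by auto
  qed
  then show ?thesis by simp
qed

lemma lratio_nonneg: "0 \<le> u \<Longrightarrow> u < 1 \<Longrightarrow> 0 \<le> lratio m u"
  by (simp add: lratio_def ltail_nonneg)

lemma lratio_le:
  assumes "0 \<le> u" "u < 1"
  shows "lratio m u \<le> u / (real (Suc m) * (1 - u))"
proof (cases "u = 0")
  case False
  then have "u ^ m > 0" using assms by simp
  then have "lratio m u \<le> u ^ Suc m / (real (Suc m) * (1 - u)) / u ^ m"
    unfolding lratio_def using ltail_le[OF assms, of m] by (intro divide_right_mono) auto
  also have "\<dots> = u / (real (Suc m) * (1 - u))"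
    using False by (simp add: power_Suc2 del: power_Suc of_nat_Suc)
  finally show ?thesis .
qed simp

lemma lratio_deriv:
  assumes "0 < u" "u < 1"
  shows "(lratio m has_real_derivative 1 / (1 - u) - real m * lratio m u / u) (at u)"
proof -
  have "((\<lambda>u. ltail m u / u ^ m) has_real_derivative
      ((u ^ m / (1 - u)) * u ^ m - ltail m u * (real m * u ^ (m - 1))) / (u ^ m * u ^ m)) (at u)"
    using assms by (intro DERIV_divide ltail_deriv) (auto intro!: derivative_eq_intros)
  moreover have "((u ^ m / (1 - u)) * u ^ m - ltail m u * (real m * u ^ (m - 1))) / (u ^ m * u ^ m)
     = 1 / (1 - u) - real m * lratio m u / u"
    using assms by (cases m) (simp_all add: lratio_def field_simps)
  moreover have "lratio m = (\<lambda>u. ltail m u / u ^ m)" by (simp add: fun_eq_iff lratio_def)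
  ultimately show ?thesis by simp
qed

lemma lratio_deriv_pos:
  assumes "0 < u" "u < 1"
  shows "0 < 1 / (1 - u) - real m * lratio m u / u"
proof -
  have "real m * lratio m u / u \<le> real m * (u / (real (Suc m) * (1 - u))) / u"
    using assms lratio_le[of u m] by (intro divide_right_mono mult_left_mono) auto
  also have "\<dots> = (real m / real (Suc m)) * (1 / (1 - u))"
    using assms by (simp del: of_nat_Suc)
  also have "\<dots> < 1 * (1 / (1 - u))"
    using assms by (intro mult_strict_right_mono) auto
  finally show ?thesis by simp
qed

text \<open>Away from 0 differentiability suffices. At 0 the quotient is 0 / 0 for m > 0 and takes
  the value 0 by convention, which \<open>lratio_le\<close> confirms as the limit.\<close>

lemma lratio_continuous: "continuous_on {0..<1} (lratio m)"
proof (unfold continuous_on_def)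
  show "\<forall>x\<in>{0..<1}. (lratio m \<longlongrightarrow> lratio m x) (at x within {0..<1})"
  proof
    fix x :: real assume x: "x \<in> {0..<1}"
    show "(lratio m \<longlongrightarrow> lratio m x) (at x within {0..<1})"
    proof (cases "x = 0")
      case False
      then have "isCont (lratio m) x"
        using x lratio_deriv[of x m] DERIV_isCont by auto
      then show ?thesis
        unfolding isCont_def by (rule tendsto_within_subset) simp
    next
      case True
      have "((\<lambda>u. u / (real (Suc m) * (1 - u))) \<longlongrightarrow> 0 / (real (Suc m) * (1 - 0))) (at 0 within {0..<1})"
        by (intro tendsto_intros) auto
      then have "((\<lambda>u. u / (real (Suc m) * (1 - u))) \<longlongrightarrow> 0) (at 0 within {0..<1})"
        by simp
      moreover have "\<forall>\<^sub>F u in at 0 within {0..<1}. 0 \<le> lratio m u"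
          "\<forall>\<^sub>F u in at 0 within {0..<1}. lratio m u \<le> u / (real (Suc m) * (1 - u))"
        using lratio_nonneg lratio_le by (auto simp: eventually_at_filter simp del: of_nat_Suc)
      ultimately show ?thesis
        using True by (auto intro: tendsto_sandwich[OF _ _ tendsto_const])
    qed
  qed
qed

lemma lratio_strict_mono:
  assumes "0 \<le> x" "x < y" "y < 1"
  shows "lratio m x < lratio m y"
proof (rule DERIV_pos_imp_increasing_open[OF assms(2)])
  fix u assume "x < u" "u < y"
  then show "\<exists>d. (lratio m has_real_derivative d) (at u) \<and> 0 < d"
    using assms lratio_deriv[of u m] lratio_deriv_pos[of u m] by auto
next
  show "continuous_on {x..y} (lratio m)"
    using assms by (intro continuous_on_subset[OF lratio_continuous]) auto
qed

lemma lratio_mono: "0 \<le> x \<Longrightarrow> x \<le> y \<Longrightarrow> y < 1 \<Longrightarrow> lratio m x \<le> lratio m y"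
  using lratio_strict_mono[of x y m] by (cases "x = y") auto

lemma lratio_eq_iff: "0 \<le> x \<Longrightarrow> x < 1 \<Longrightarrow> 0 \<le> y \<Longrightarrow> y < 1 \<Longrightarrow> lratio m x = lratio m y \<longleftrightarrow> x = y"
  by (metis lratio_strict_mono linorder_neqE_linordered_idom less_irrefl)

lemma lratio_surj:
  assumes "0 < X"
  shows "\<exists>u. 0 < u \<and> u < 1 \<and> lratio m u = X"
proof -
  \<comment> \<open>Chosen so that - ln (1 - y) = m + X: the subtracted sum has m terms of size at
    most 1, so at least X remains.\<close>
  define y where "y = 1 - exp (- (real m + X))"
  have y: "0 < y" "y < 1" using assms by (auto simp: y_def)
  have "(\<Sum>k=1..m. y ^ k / real k) \<le> (\<Sum>k=1..m. 1)"
  proof (rule sum_mono)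
    fix k assume "k \<in> {1..m}"
    moreover have "y ^ k \<le> 1" using y by (simp add: power_le_one)
    ultimately show "y ^ k / real k \<le> 1" by (simp add: field_simps)
  qed
  then have "X \<le> ltail m y"
    by (simp add: ltail_def y_def)
  also have "\<dots> \<le> lratio m y"
    unfolding lratio_def
  proof (subst le_divide_eq, simp add: y)
    have "ltail m y * y ^ m \<le> ltail m y * 1"
      using y by (intro mult_left_mono) (auto simp: power_le_one ltail_nonneg)
    then show "ltail m y * y ^ m \<le> ltail m y" by simp
  qed
  finally have "X \<le> lratio m y" .
  moreover have "continuous_on {0..y} (lratio m)"
    using y by (intro continuous_on_subset[OF lratio_continuous]) auto
  ultimately obtain u where u: "0 \<le> u" "u \<le> y" "lratio m u = X"
    using IVT'[of "lratio m" 0 X y] assms y by auto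
  then show ?thesis using assms y by (intro exI[of _ u]) (cases "u = 0", auto)
qed

lemma ltail_has_integral:
  fixes c \<phi> :: real
  assumes "\<phi> < c" "c \<le> x" "x \<le> y"
  shows "((\<lambda>t. (t - c) ^ m / (t - \<phi>) ^ (m + 1)) has_integral
           ltail m ((y - c) / (y - \<phi>)) - ltail m ((x - c) / (x - \<phi>))) {x..y}"
proof (rule fundamental_theorem_of_calculus[OF assms(3)])
  fix t assume t: "t \<in> {x..y}"
  have t\<phi>: "t - \<phi> > 0" using t assms by auto
  have lt1: "(t - c) / (t - \<phi>) < 1" using t\<phi> assms by (simp add: field_simps)
  have "((\<lambda>t. (t - c) / (t - \<phi>)) has_real_derivative (c - \<phi>) / (t - \<phi>)\<^sup>2) (at t)"
    using t\<phi> by (auto intro!: derivative_eq_intros simp: field_simps power2_eq_square)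
  from DERIV_chain2[OF ltail_deriv[OF lt1] this, of m]
  have "((\<lambda>t. ltail m ((t - c) / (t - \<phi>))) has_real_derivative
     ((t - c) / (t - \<phi>)) ^ m / (1 - (t - c) / (t - \<phi>)) * ((c - \<phi>) / (t - \<phi>)\<^sup>2)) (at t)" .
  moreover have "1 - (t - c) / (t - \<phi>) = (c - \<phi>) / (t - \<phi>)"
    using t\<phi> by (simp add: field_simps)
  moreover have "((t - c) / (t - \<phi>)) ^ m / ((c - \<phi>) / (t - \<phi>)) * ((c - \<phi>) / (t - \<phi>)\<^sup>2)
      = (t - c) ^ m / (t - \<phi>) ^ (m + 1)"
  proof -
    have "(A / B ^ m) / (C / B) * (C / B\<^sup>2) = A / B ^ (m + 1)" if "B > 0" "C > 0" for A B C :: real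
      using that by (simp add: power2_eq_square)
    from this[of "t - \<phi>" "c - \<phi>" "(t - c) ^ m"] show ?thesis
      using t\<phi> assms by (simp add: power_divide)
  qed
  ultimately have "((\<lambda>t. ltail m ((t - c) / (t - \<phi>))) has_real_derivative
     (t - c) ^ m / (t - \<phi>) ^ (m + 1)) (at t)" by simp
  then show "((\<lambda>t. ltail m ((t - c) / (t - \<phi>))) has_vector_derivative
     (t - c) ^ m / (t - \<phi>) ^ (m + 1)) (at t within {x..y})"
    by (simp add: has_real_derivative_iff_has_vector_derivative has_vector_derivative_at_within)
qed

section \<open>Distributions with a density on an open interval\<close>

abbreviation Ioo_lborel :: "real \<Rightarrow> real \<Rightarrow> real measure" where
  "Ioo_lborel a b \<equiv> restrict_space lborel {a<..<b}"

lemma finite_measure_Ioo_lborel: "finite_measure (Ioo_lborel a b)"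
  by (rule finite_measureI) (cases "a \<le> b"; simp add: emeasure_restrict_space space_restrict_space)

lemma borel_measurable_Ioo_lborel:
  "f \<in> borel_measurable borel \<Longrightarrow> f \<in> borel_measurable (Ioo_lborel a b)"
  by (simp add: measurable_restrict_space1)

lemma integrable_Ioo_lborel_bounded:
  fixes f :: "real \<Rightarrow> real"
  assumes "f \<in> borel_measurable (Ioo_lborel a b)" "\<And>t. a < t \<Longrightarrow> t < b \<Longrightarrow> \<bar>f t\<bar> \<le> B"
  shows "integrable (Ioo_lborel a b) f"
  using assms by (intro finite_measure.integrable_const_bound[OF finite_measure_Ioo_lborel])
    (auto simp: space_restrict_space intro!: AE_I2)

lemma integrable_mult_bounded:
  fixes g h :: "'a \<Rightarrow> real"
  assumes "integrable M g" "h \<in> borel_measurable M" "\<And>t. t \<in> space M \<Longrightarrow> \<bar>h t\<bar> \<le> B"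
  shows "integrable M (\<lambda>t. h t * g t)"
proof (rule Bochner_Integration.integrable_bound)
  show "integrable M (\<lambda>t. B * g t)" using assms by simp
  show "(\<lambda>t. h t * g t) \<in> borel_measurable M" using assms by simp
  show "AE t in M. norm (h t * g t) \<le> norm (B * g t)"
  proof (rule AE_I2)
    fix t assume "t \<in> space M"
    then have "\<bar>h t\<bar> \<le> \<bar>B\<bar>" using assms(3)[of t] by linarith
    then show "norm (h t * g t) \<le> norm (B * g t)"
      by (simp add: abs_mult mult_right_mono)
  qed
qed

lemma has_integral_Ioo:
  fixes G g :: "real \<Rightarrow> real"
  assumes "a \<le> b" "continuous_on {a..b} G" "finite S"
    and "\<And>t. t \<in> {a<..<b} - S \<Longrightarrow> (G has_real_derivative g t) (at t)"
  shows "(g has_integral (G b - G a)) {a<..<b}"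
proof -
  have "(g has_integral (G b - G a)) {a..b}"
    using fundamental_theorem_of_calculus_interior_strong[OF assms(3,1) _ assms(2)] assms(4)
    by (simp add: has_real_derivative_iff_has_vector_derivative)
  then show ?thesis
    by (simp add: has_integral_Icc_iff_Ioo)
qed

lemma integral_Ioo_lborel_FTC:
  fixes G g :: "real \<Rightarrow> real"
  assumes "a \<le> b" "continuous_on {a..b} G" "finite S"
    and "\<And>t. t \<in> {a<..<b} - S \<Longrightarrow> (G has_real_derivative g t) (at t)"
    and "integrable (Ioo_lborel a b) g"
  shows "(\<integral>t. g t \<partial>Ioo_lborel a b) = G b - G a"
proof -
  have "set_integrable lborel {a<..<b} g"
    using assms(5) by (simp add: integrable_restrict_space set_integrable_def)
  then have "(\<integral>t. g t \<partial>Ioo_lborel a b) = integral {a<..<b} g"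
    by (simp add: integral_restrict_space set_lebesgue_integral_def
        flip: set_borel_integral_eq_integral(2))
  then show ?thesis
    using has_integral_Ioo[OF assms(1-4)] by (simp add: integral_unique)
qed

lemma nn_integral_FTC_Ioo:
  fixes G g :: "real \<Rightarrow> real"
  assumes "a \<le> b" "continuous_on {a..b} G" "finite S"
    and "\<And>t. t \<in> {a<..<b} - S \<Longrightarrow> (G has_real_derivative g t) (at t)"
    and g0: "\<And>t. t \<in> {a<..<b} \<Longrightarrow> 0 \<le> g t"
    and [measurable]: "g \<in> borel_measurable borel"
  shows "(\<integral>\<^sup>+t. ennreal (g t) * indicator {a<..<b} t \<partial>lborel) = ennreal (G b - G a)"
proof -
  let ?g = "\<lambda>t. if t \<in> {a<..<b} then g t else 0"
  have "(?g has_integral (G b - G a)) UNIV"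
    using has_integral_Ioo[OF assms(1-4)] has_integral_restrict_UNIV[of "{a<..<b}" g] by simp
  then have "integral\<^sup>N lborel ?g = ennreal (G b - G a)"
    by (intro nn_integral_has_integral_lborel) (auto simp: g0)
  also have "integral\<^sup>N lborel ?g = (\<integral>\<^sup>+t. ennreal (g t) * indicator {a<..<b} t \<partial>lborel)"
    by (intro nn_integral_cong) (auto simp: indicator_def)
  finally show ?thesis by simp
qed

lemma integrable_Ioo_lborel_FTC:
  fixes G g :: "real \<Rightarrow> real"
  assumes "a \<le> b" "continuous_on {a..b} G" "finite S"
    and "\<And>t. t \<in> {a<..<b} - S \<Longrightarrow> (G has_real_derivative g t) (at t)"
    and g0: "\<And>t. t \<in> {a<..<b} \<Longrightarrow> 0 \<le> g t"
    and [measurable]: "g \<in> borel_measurable borel"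
  shows "integrable (Ioo_lborel a b) g"
proof (rule integrableI_nonneg)
  show "g \<in> borel_measurable (Ioo_lborel a b)"
    by (rule borel_measurable_Ioo_lborel) simp
  show "AE t in Ioo_lborel a b. 0 \<le> g t"
    using g0 by (intro AE_I2) (auto simp: space_restrict_space)
  have "(\<integral>\<^sup>+t. ennreal (g t) \<partial>Ioo_lborel a b) = ennreal (G b - G a)"
    using nn_integral_FTC_Ioo[OF assms] by (simp add: nn_integral_restrict_space)
  then show "(\<integral>\<^sup>+t. ennreal (g t) \<partial>Ioo_lborel a b) < \<infinity>"
    by simp
qed

lemma density_eq_of_cdf_deriv:
  fixes G g :: "real \<Rightarrow> real"
  assumes "real_distribution D" and ab: "a < b"
    and G: "continuous_on {a..b} G" "\<And>t. t \<in> {a..<b} \<Longrightarrow> cdf D t = G t"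
    and S: "finite S" "\<And>t. t \<in> {a<..<b} - S \<Longrightarrow> (G has_real_derivative g t) (at t)"
    and g0: "\<And>t. t \<in> {a<..<b} \<Longrightarrow> 0 \<le> g t"
    and g[measurable]: "g \<in> borel_measurable borel"
  shows "density D (indicator {a<..<b}) = density lborel (\<lambda>t. ennreal (g t) * indicator {a<..<b} t)"
    (is "?L = ?R")
proof (rule cdf_unique')
  interpret D: real_distribution D by fact
  have totR: "emeasure ?R UNIV = ennreal (G b - G a)"
    using nn_integral_FTC_Ioo[OF _ G(1) S g0 g] ab by (simp add: emeasure_density)
  show R: "finite_borel_measure ?R"
    by (intro finite_borel_measure.intro finite_borel_measure_axioms.intro finite_measureI)
      (simp_all add: totR)
  have "emeasure ?L UNIV \<le> emeasure D UNIV"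
    using nn_integral_mono[of D "indicator {a<..<b}" "\<lambda>_. 1"]
    by (subst emeasure_density) (auto simp: indicator_def[abs_def])
  then show L: "finite_borel_measure ?L"
    using D.emeasure_space_1
    by (intro finite_borel_measure.intro finite_borel_measure_axioms.intro finite_measureI)
      (auto simp: top_unique)
  interpret R: finite_borel_measure ?R by fact
  interpret L: finite_borel_measure ?L by fact
  have mid: "cdf ?L x = cdf ?R x" if x: "a \<le> x" "x < b" for x
  proof -
    have eq: "{a<..<b} \<inter> {..x} = {a<..x}" using x by auto
    have "emeasure ?L {..x} = (\<integral>\<^sup>+t. indicator {a<..x} t \<partial>D)"
      by (subst emeasure_density, simp, simp, rule nn_integral_cong)
        (use x in \<open>auto simp: indicator_def\<close>)
    also have "\<dots> = ennreal (G x - G a)"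
      using x ab by (simp add: D.emeasure_Ioc G(2))
    finally have l: "emeasure ?L {..x} = ennreal (G x - G a)" .
    have "emeasure ?R {..x} = (\<integral>\<^sup>+t. ennreal (g t) * indicator {a<..<x} t \<partial>lborel)"
      by (subst emeasure_density, simp, simp, rule nn_integral_cong_AE)
        (use x AE_lborel_singleton[of x] in \<open>auto elim!: eventually_mono simp: indicator_def\<close>)
    also have "\<dots> = ennreal (G x - G a)"
      using x S(2) g0 by (intro nn_integral_FTC_Ioo[OF _ continuous_on_subset[OF G(1)] S(1)]) auto
    finally show ?thesis
      using l by (simp add: cdf_def measure_def)
  qed
  show "cdf ?L = cdf ?R"
  proof
    fix x
    consider "x < a" | "a \<le> x" "x < b" | "b \<le> x" by linarith
    then show "cdf ?L x = cdf ?R x"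
    proof cases
      case 1
      then have "emeasure ?L {..x} = 0" "emeasure ?R {..x} = 0"
        by (subst emeasure_density; auto simp: indicator_def intro!: nn_integral_zero')+
      then show ?thesis by (simp add: cdf_def measure_def)
    next
      case 2 then show ?thesis using mid by simp
    next
      case 3
      have "emeasure ?L {..x} = emeasure ?L {..<b}" "emeasure ?R {..x} = emeasure ?R {..<b}"
        using 3 by (simp_all add: emeasure_density) (auto simp: indicator_def intro!: nn_integral_cong)
      then have *: "cdf ?L x = measure ?L {..<b}" "cdf ?R x = measure ?R {..<b}"
        by (simp_all add: cdf_def measure_def)
      \<comment> \<open>The value of \<open>cdf D\<close> at b is unknown, so the total masses are
        compared as left limits at b.\<close>
      have "(cdf ?R \<longlongrightarrow> measure ?L {..<b}) (at_left b)"
      proof (rule Lim_transform_eventually[OF L.cdf_at_left])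
        show "\<forall>\<^sub>F x in at_left b. cdf ?L x = cdf ?R x"
          using eventually_at_left_field[of _ b] ab mid by (auto intro!: exI[of _ a])
      qed
      with R.cdf_at_left[of b] show ?thesis
        unfolding * using tendsto_unique[of "at_left b"] by auto
    qed
  qed
qed

lemma integral_cdf_deriv:
  fixes G g h :: "real \<Rightarrow> real"
  assumes "real_distribution D" and ab: "a < b"
    and G: "continuous_on {a..b} G" "\<And>t. t \<in> {a..<b} \<Longrightarrow> cdf D t = G t"
    and S: "finite S" "\<And>t. t \<in> {a<..<b} - S \<Longrightarrow> (G has_real_derivative g t) (at t)"
    and g0: "\<And>t. t \<in> {a<..<b} \<Longrightarrow> 0 \<le> g t"
    and g[measurable]: "g \<in> borel_measurable borel"
    and h[measurable]: "h \<in> borel_measurable borel"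
  shows "(\<integral>r. indicator {a<..<b} r * h r \<partial>D) = (\<integral>t. h t * g t \<partial>Ioo_lborel a b)"
proof -
  interpret D: real_distribution D by fact
  have hD: "h \<in> borel_measurable D" by simp
  have "(\<integral>r. indicator {a<..<b} r * h r \<partial>D) = integral\<^sup>L (density D (\<lambda>x. ennreal (indicator {a<..<b} x))) h"
    using hD by (subst integral_density) auto
  also have "(\<lambda>x. ennreal (indicator {a<..<b} x)) = indicator {a<..<b}"
    by (auto simp: fun_eq_iff indicator_def)
  also have "density D (indicator {a<..<b}) = density lborel (\<lambda>t. ennreal (g t) * indicator {a<..<b} t)"
    by (rule density_eq_of_cdf_deriv[OF assms(1-8)])
  also have "\<dots> = density lborel (\<lambda>t. ennreal (g t * indicator {a<..<b} t))"
    by (intro density_cong) (auto simp: indicator_def)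
  also have "integral\<^sup>L \<dots> h = (\<integral>t. (g t * indicator {a<..<b} t) *\<^sub>R h t \<partial>lborel)"
    by (subst integral_density) (auto simp: indicator_def g0)
  also have "\<dots> = (\<integral>t. h t * g t \<partial>Ioo_lborel a b)"
    by (subst integral_restrict_space) (auto simp: ac_simps)
  finally show ?thesis .
qed

text \<open>Fubini on the region t < Y: if a quantity grows at the signed rate h in Y, its
  expectation sees the law of Y only through tail probabilities. Applied to the highest value, the
  runner-up, the random threshold and a single worst-case value.\<close>

lemma (in prob_space)
  fixes Y :: "'a \<Rightarrow> real" and h :: "real \<Rightarrow> real"
  assumes Y[measurable]: "Y \<in> borel_measurable M" and h: "integrable (Ioo_lborel a b) h"
  shows integrable_layers: "integrable M (\<lambda>\<omega>. \<integral>t. (if t < Y \<omega> then h t else 0) \<partial>Ioo_lborel a b)"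
    and expectation_layers: "(\<integral>\<omega>. (\<integral>t. (if t < Y \<omega> then h t else 0) \<partial>Ioo_lborel a b) \<partial>M)
       = (\<integral>t. h t * prob {\<omega>\<in>space M. t < Y \<omega>} \<partial>Ioo_lborel a b)"
proof -
  interpret L: finite_measure "Ioo_lborel a b" by (rule finite_measure_Ioo_lborel)
  interpret pair_sigma_finite M "Ioo_lborel a b" ..
  have [measurable]: "h \<in> borel_measurable (Ioo_lborel a b)" using h by simp
  have [measurable]: "(\<lambda>t. t) \<in> borel_measurable (Ioo_lborel a b)"
    by (rule borel_measurable_Ioo_lborel) simp
  let ?f = "\<lambda>\<omega> t. if t < Y \<omega> then h t else 0"
  have meas: "case_prod ?f \<in> borel_measurable (M \<Otimes>\<^sub>M Ioo_lborel a b)"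
    by measurable
  have int: "integrable (M \<Otimes>\<^sub>M Ioo_lborel a b) (case_prod ?f)"
  proof (rule Fubini_integrable[OF meas])
    have inner: "integrable (Ioo_lborel a b) (?f \<omega>)" if "\<omega> \<in> space M" for \<omega>
      by (rule Bochner_Integration.integrable_bound[OF h]) auto
    then show "AE x in M. integrable (Ioo_lborel a b) (\<lambda>y. case (x, y) of (x, y) \<Rightarrow> ?f x y)"
      by (intro AE_I2) simp
    show "integrable M (\<lambda>x. \<integral>y. norm (case (x, y) of (x, y) \<Rightarrow> ?f x y) \<partial>Ioo_lborel a b)"
    proof (rule integrable_const_bound[where B="\<integral>y. \<bar>h y\<bar> \<partial>Ioo_lborel a b"])
      show "AE x in M. norm (\<integral>y. norm (case (x, y) of (x, y) \<Rightarrow> ?f x y) \<partial>Ioo_lborel a b)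
          \<le> (\<integral>y. \<bar>h y\<bar> \<partial>Ioo_lborel a b)"
      proof (rule AE_I2)
        fix x assume x: "x \<in> space M"
        have "norm (\<integral>y. \<bar>?f x y\<bar> \<partial>Ioo_lborel a b) = (\<integral>y. \<bar>?f x y\<bar> \<partial>Ioo_lborel a b)"
          by (simp add: integral_nonneg_AE)
        also have "\<dots> \<le> (\<integral>y. \<bar>h y\<bar> \<partial>Ioo_lborel a b)"
          using inner[OF x] h by (intro integral_mono integrable_abs) auto
        finally show "norm (\<integral>y. norm (case (x, y) of (x, y) \<Rightarrow> ?f x y) \<partial>Ioo_lborel a b)
          \<le> (\<integral>y. \<bar>h y\<bar> \<partial>Ioo_lborel a b)" by simp
      qed
    qed measurable
  qed
  show "integrable M (\<lambda>\<omega>. \<integral>t. ?f \<omega> t \<partial>Ioo_lborel a b)"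
    using integrable_fst'[OF int] by simp
  have "(\<integral>\<omega>. (\<integral>t. ?f \<omega> t \<partial>Ioo_lborel a b) \<partial>M) = (\<integral>t. (\<integral>\<omega>. ?f \<omega> t \<partial>M) \<partial>Ioo_lborel a b)"
    using Fubini_integral[OF int] by simp
  also have "\<dots> = (\<integral>t. h t * prob {\<omega>\<in>space M. t < Y \<omega>} \<partial>Ioo_lborel a b)"
  proof (rule Bochner_Integration.integral_cong[OF refl])
    fix t
    have "(\<integral>\<omega>. ?f \<omega> t \<partial>M) = (\<integral>\<omega>. h t * indicator {\<omega>\<in>space M. t < Y \<omega>} \<omega> \<partial>M)"
      by (intro Bochner_Integration.integral_cong) auto
    then show "(\<integral>\<omega>. ?f \<omega> t \<partial>M) = h t * prob {\<omega>\<in>space M. t < Y \<omega>}"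
      by simp
  qed
  finally show "(\<integral>\<omega>. (\<integral>t. ?f \<omega> t \<partial>Ioo_lborel a b) \<partial>M)
       = (\<integral>t. h t * prob {\<omega>\<in>space M. t < Y \<omega>} \<partial>Ioo_lborel a b)" .
qed

lemma integral_lower_layer:
  assumes "a \<le> y" "y \<le> b"
  shows "(\<integral>t. (if t < y then 1 else 0) \<partial>Ioo_lborel a b) = (y - a :: real)"
proof -
  have "(\<integral>t. (if t < y then 1 else 0) \<partial>Ioo_lborel a b) = (\<integral>t. indicator {a<..<y} t \<partial>lborel :: real)"
    using assms by (subst integral_restrict_space, simp)
      (intro Bochner_Integration.integral_cong; auto simp: indicator_def)
  then show ?thesis using assms by simp
qed

text \<open>The jump to 1 at e carries the mass that \<open>G\<close> leaves over: with e = b it is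
  the atom of the worst-case distribution, with e = b + 1 the part of a threshold distribution
  outside [a, b].\<close>

lemma
  fixes G :: "real \<Rightarrow> real"
  assumes ce: "c < e" and cont: "continuous_on {c..} G"
    and mono: "\<And>s t. c \<le> s \<Longrightarrow> s \<le> t \<Longrightarrow> t < e \<Longrightarrow> G s \<le> G t"
    and bounds: "\<And>t. c \<le> t \<Longrightarrow> t < e \<Longrightarrow> 0 \<le> G t \<and> G t \<le> 1"
  defines "H \<equiv> \<lambda>t. if t < c then 0 else if t < e then G t else 1"
  shows real_distribution_cutoff: "real_distribution (interval_measure H)"
    and cdf_cutoff: "cdf (interval_measure H) = H"
proof -
  have H_mono: "H s \<le> H t" if "s \<le> t" for s t
    using that mono[of s t] bounds[of s] bounds[of t] by (auto simp: H_def)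
  have H_right: "continuous (at_right t) H" for t
  proof -
    consider "t < c" | "c \<le> t" "t < e" | "e \<le> t" by linarith
    then show ?thesis
    proof cases
      case 1
      have "(H \<longlongrightarrow> 0) (at_right t)"
        by (rule Lim_transform_eventually[OF tendsto_const])
          (use 1 in \<open>auto simp: H_def eventually_at_right_field intro!: exI[of _ c]\<close>)
      then show ?thesis using 1 by (simp add: continuous_within H_def)
    next
      case 2
      have "(G \<longlongrightarrow> G t) (at t within {c..})"
        using cont 2 by (auto simp: continuous_on_def)
      then have "(G \<longlongrightarrow> G t) (at_right t)"
        by (rule tendsto_within_subset) (use 2 in auto)
      then have "(H \<longlongrightarrow> G t) (at_right t)"
        by (rule Lim_transform_eventually)
          (use 2 in \<open>auto simp: H_def eventually_at_right_field intro!: exI[of _ e]\<close>)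
      then show ?thesis using 2 by (simp add: continuous_within H_def)
    next
      case 3
      have "(H \<longlongrightarrow> 1) (at_right t)"
        by (rule Lim_transform_eventually[OF tendsto_const])
          (use 3 ce in \<open>auto simp: H_def eventually_at_right_field intro!: exI[of _ "t + 1"]\<close>)
      then show ?thesis using 3 ce by (simp add: continuous_within H_def)
    qed
  qed
  have H_bot: "(H \<longlongrightarrow> 0) at_bot"
    by (rule Lim_transform_eventually[OF tendsto_const])
      (auto simp: H_def eventually_at_bot_dense intro!: exI[of _ c])
  have H_top: "(H \<longlongrightarrow> 1) at_top"
    by (rule Lim_transform_eventually[OF tendsto_const])
      (use ce in \<open>auto simp: H_def eventually_at_top_linorder intro!: exI[of _ e]\<close>)
  show "cdf (interval_measure H) = H"
    by (intro cdf_interval_measure H_mono H_right H_bot H_top)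
  show "real_distribution (interval_measure H)"
    by (intro real_distribution_interval_measure H_mono H_right H_bot H_top)
qed

section \<open>The auctions for a fixed reserve\<close>

text \<open>The entry \<open>a\<close> only matters for a single buyer, who then faces no bid above a reserve \<open>r > a\<close>.\<close>

definition runner_up :: "nat \<Rightarrow> real \<Rightarrow> valuation \<Rightarrow> real" where
  "runner_up n a v = Max (insert a ((\<lambda>(i, j). min (v i) (v j)) ` {(i, j). i < j \<and> j < n}))"

definition best_other :: "nat \<Rightarrow> real \<Rightarrow> valuation \<Rightarrow> nat \<Rightarrow> real" where
  "best_other n a v i = Max (insert a (v ` ({..<n} - {i})))"

section \<open>Order statistics of a bid profile\<close>

lemma finite_pairs: "finite {(i, j). i < j \<and> j < (n::nat)}"
  by (rule finite_subset[of _ "{..<n} \<times> {..<n}"]) auto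

lemma highest_ge: "i < n \<Longrightarrow> v i \<le> highest n v"
  by (simp add: highest_def)

lemma highest_attained:
  assumes "1 \<le> n"
  shows "\<exists>i<n. v i = highest n v"
proof -
  have "{..<n} \<noteq> {}" using assms by (auto simp: lessThan_empty_iff)
  then have "Max (v ` {..<n}) \<in> v ` {..<n}" by (intro Max_in) auto
  then show ?thesis by (auto simp: highest_def)
qed

lemma less_highest_iff: "1 \<le> n \<Longrightarrow> t < highest n v \<longleftrightarrow> (\<exists>i<n. t < v i)"
  by (metis highest_attained highest_ge less_le_trans)

lemma runner_up_ge: "a \<le> runner_up n a v"
  unfolding runner_up_def using finite_pairs by simp

lemma less_runner_up_iff:
  "a \<le> t \<Longrightarrow> t < runner_up n a v \<longleftrightarrow> (\<exists>i j. i < j \<and> j < n \<and> t < v i \<and> t < v j)"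
  unfolding runner_up_def using finite_pairs by (subst Max_gr_iff) auto

lemma runner_up_le_highest:
  assumes "1 \<le> n" "\<And>i. i < n \<Longrightarrow> a \<le> v i"
  shows "runner_up n a v \<le> highest n v"
proof -
  have "a \<le> highest n v" using assms highest_ge[of 0 n v] by force
  moreover have "min (v i) (v j) \<le> highest n v" if "j < n" for i j
    using highest_ge[OF that, of v] by linarith
  ultimately show ?thesis
    unfolding runner_up_def using finite_pairs by auto
qed

lemma runner_up_one: "runner_up (Suc 0) a v = a"
proof -
  have "{(i, j). i < j \<and> j < Suc 0} = {}" by auto
  then show ?thesis unfolding runner_up_def by (simp only: image_empty Max_singleton)
qed

lemma best_other_ge: "a \<le> best_other n a v i" "j < n \<Longrightarrow> j \<noteq> i \<Longrightarrow> v j \<le> best_other n a v i"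
  unfolding best_other_def by auto

lemma best_other_attained:
  "best_other n a v i = a \<or> (\<exists>j<n. j \<noteq> i \<and> v j = best_other n a v i)"
  using Max_in[of "insert a (v ` ({..<n} - {i}))"] unfolding best_other_def by auto

lemma best_other_upd [simp]: "best_other n a (v(i := y)) i = best_other n a v i"
  unfolding best_other_def by (intro arg_cong[where f=Max] arg_cong[where f="insert a"]) auto

lemma highest_eq_max:
  assumes "i < n" "a \<le> v i"
  shows "highest n v = max (v i) (best_other n a v i)"
proof (rule antisym)
  obtain j where "j < n" "v j = highest n v" using highest_attained[of n v] assms by auto
  then show "highest n v \<le> max (v i) (best_other n a v i)"
    using best_other_ge(2)[of j n i v a] by (cases "j = i") (auto simp: le_max_iff_disj)
  show "max (v i) (best_other n a v i) \<le> highest n v"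
    using best_other_attained[of n a v i] highest_ge[of _ n v] assms by (auto simp: max_def) (metis order.trans)
qed

text \<open>Every pair of buyers contains a rival of i, so each pairwise minimum is at most the best
  rival bid; since i bids at least that much, the pair of i and the best rival attains it.\<close>

lemma runner_up_eq_best_other:
  assumes i: "i < n" and a: "\<And>i. i < n \<Longrightarrow> a \<le> v i" and ge: "best_other n a v i \<le> v i"
  shows "runner_up n a v = best_other n a v i"
proof (rule antisym)
  have "min (v k) (v j) \<le> best_other n a v i" if "k < j" "j < n" for k j
  proof (cases "j = i")
    case True
    then have "v k \<le> best_other n a v i" using that best_other_ge(2)[of k n i v a] by auto
    then show ?thesis by linarith
  next
    case False
    then have "v j \<le> best_other n a v i" using that best_other_ge(2)[of j n i v a] by auto
    then show ?thesis by linarith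
  qed
  then show "runner_up n a v \<le> best_other n a v i"
    unfolding runner_up_def using finite_pairs best_other_ge(1) by auto
  show "best_other n a v i \<le> runner_up n a v"
  proof (rule ccontr)
    assume neg: "\<not> ?thesis"
    define t where "t = runner_up n a v"
    have "best_other n a v i \<noteq> a" using neg runner_up_ge[of a n v] by auto
    then obtain j where j: "j < n" "j \<noteq> i" "v j = best_other n a v i"
      using best_other_attained[of n a v i] by auto
    then have "t < v j" "t < v i" using neg ge by (auto simp: t_def)
    then have "t < runner_up n a v"
      using less_runner_up_iff[of a t n v] runner_up_ge[of a n v] i j
      unfolding t_def by (metis linorder_neqE_nat)
    then show False by (simp add: t_def)
  qed
qed

lemma num_highest_ge_1:
  assumes "1 \<le> n"
  shows "1 \<le> num_highest n v"
proof -
  obtain i where "i \<in> {i. i < n \<and> v i = highest n v}" using highest_attained[OF assms] by blast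
  then have "0 < card {i. i < n \<and> v i = highest n v}" by (subst card_gt_0_iff) auto
  then show ?thesis by (simp add: num_highest_def)
qed

text \<open>\<open>second_highest\<close> is defined by cases on ties. The maximum of pairwise
  minima is the same number, but is visibly measurable and exceeds t exactly when two bids
  do.\<close>

lemma second_highest_eq_runner_up:
  assumes n: "2 \<le> n" and a: "\<And>i. i < n \<Longrightarrow> a \<le> v i"
  shows "second_highest n v = runner_up n a v"
proof -
  obtain i where i: "i < n" "v i = highest n v" using highest_attained[of n v] n by auto
  let ?N = "{i. i < n \<and> v i = highest n v}"
  have w_le: "best_other n a v i \<le> v i"
    using highest_eq_max[of i n a v] i a[of i] by linarith
  have R: "runner_up n a v = best_other n a v i"
    using runner_up_eq_best_other[OF i(1) a w_le] by simp
  show ?thesis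
  proof (cases "num_highest n v \<ge> 2")
    case True
    have "\<exists>j\<in>?N. j \<noteq> i"
    proof (rule ccontr)
      assume "\<not> ?thesis"
      then have "?N \<subseteq> {i}" by auto
      then have "card ?N \<le> 1" using card_mono[of "{i}" ?N] by simp
      then show False using True by (simp add: num_highest_def)
    qed
    then obtain j where j: "j < n" "v j = highest n v" "j \<noteq> i" by auto
    then have "highest n v \<le> best_other n a v i" using best_other_ge(2)[of j n i v a] by simp
    then show ?thesis using True R w_le i by (simp add: second_highest_def)
  next
    case False
    then have "card ?N = 1" using num_highest_ge_1[of n v] n by (simp add: num_highest_def)
    then obtain k where k: "?N = {k}" by (rule card_1_singletonE)
    have "i \<in> ?N" using i by blast
    then have N: "?N = {i}" unfolding k by blast
    have S: "{j. j < n \<and> v j \<noteq> highest n v} = {..<n} - {i}"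
    proof -
      have "{j. j < n \<and> v j \<noteq> highest n v} = {..<n} - ?N" by auto
      then show ?thesis unfolding N .
    qed
    obtain j where j: "j < n" "j \<noteq> i"
      using n that[of 0] that[of 1] by (cases "i = 0") auto
    have "a \<le> Max (v ` ({..<n} - {i}))"
      using j a[of j] by (intro order.trans[OF _ Max_ge, of _ "v j"]) auto
    then have "best_other n a v i = Max (v ` ({..<n} - {i}))"
      unfolding best_other_def using j by (subst Max_insert) (auto intro: max_absorb2)
    then show ?thesis using False R S by (simp add: second_highest_def)
  qed
qed

section \<open>Threshold prices and incentive compatibility\<close>

lemma win_share_nonneg: "0 \<le> win_share n v i"
  by (simp add: win_share_def)

lemma win_share_le_1: "win_share n v i \<le> 1"
  by (simp add: win_share_def divide_simps)

lemma sum_win_share: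
  assumes "1 \<le> n"
  shows "(\<Sum>i<n. win_share n v i) = 1"
proof -
  have "(\<Sum>i<n. win_share n v i) = (\<Sum>i\<in>{i. i < n \<and> v i = highest n v}. 1 / real (num_highest n v))"
    unfolding win_share_def by (subst sum.inter_filter[symmetric]) (auto intro!: sum.cong)
  also have "\<dots> = 1"
    using num_highest_ge_1[OF assms, of v] by (simp flip: num_highest_def)
  finally show ?thesis .
qed

lemma win_share_eq_0: "v i < highest n v \<Longrightarrow> win_share n v i = 0"
  by (simp add: win_share_def)

lemma win_share_eq_1:
  assumes "i < n" "\<And>i. i < n \<Longrightarrow> a \<le> v i" "best_other n a v i < v i"
  shows "win_share n v i = 1"
proof -
  have h: "highest n v = v i" using highest_eq_max[of i n a v] assms by auto
  have "{j. j < n \<and> v j = highest n v} = {i}"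
    using assms best_other_ge(2)[of _ n i v a] h by fastforce
  then show ?thesis using h by (simp add: win_share_def num_highest_def)
qed

text \<open>Threshold-price form: the price T per unit of allocation depends on the rivals' bids
  only, and the allocation is 0 below T and 1 above it. At a tie X may be a fraction, which is
  harmless because the utility at \<open>v i = T\<close> is 0. Incentive compatibility follows from
  this form alone.\<close>

lemma SPA_threshold:
  assumes i: "i < n" and av: "\<forall>i<n. a \<le> v i" and r: "a < r"
  defines "T \<equiv> max r (best_other n a v i)" and "X \<equiv> fst (SPA n r) v i"
  shows "snd (SPA n r) v i = X * T" "0 \<le> X" "X \<le> 1" "T < v i \<Longrightarrow> X = 1" "v i < T \<Longrightarrow> X = 0"
proof -
  have a: "\<And>i. i < n \<Longrightarrow> a \<le> v i" using av by blast
  let ?w = "best_other n a v i"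
  have h: "highest n v = max (v i) ?w" using highest_eq_max[of i n a v] i a by auto
  have second: "2 \<le> n \<and> r \<le> second_highest n v \<longleftrightarrow> r \<le> runner_up n a v"
    using second_highest_eq_runner_up[of n a v] a r i runner_up_one[of a v]
    by (cases "n = 1") auto
  have second': "second_highest n v = runner_up n a v" if "r \<le> runner_up n a v"
    using that second second_highest_eq_runner_up[of n a v] a by blast
  have R: "runner_up n a v = ?w" if "?w \<le> v i"
    using runner_up_eq_best_other[of i n a v] i a that by auto
  have W1: "win_share n v i = 1" if "?w < v i"
    using win_share_eq_1[of i n a v] i a that by auto
  have W0: "win_share n v i = 0" if "v i < ?w"
    using win_share_eq_0[of v i n] h that by auto
  consider "v i < ?w" | "v i = ?w" | "?w < v i" by linarith
  then show "snd (SPA n r) v i = X * T"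
    by cases (auto simp: SPA_def X_def T_def second second' R W1 W0 h max_def)
  show "0 \<le> X" "X \<le> 1"
    by (auto simp: X_def SPA_def win_share_nonneg win_share_le_1)
  show "T < v i \<Longrightarrow> X = 1"
    by (auto simp: X_def SPA_def T_def W1 h)
  show "v i < T \<Longrightarrow> X = 0"
    by (auto simp: X_def SPA_def T_def W0 h max_def split: if_splits)
qed

text \<open>Once a rival bids at least r, the threshold is met whatever buyer i bids, and buyer i
  faces a plain second-price auction.\<close>

lemma POOL_threshold:
  assumes i: "i < n" and av: "\<forall>i<n. a \<le> v i" and r: "a < r"
    and w: "r \<le> best_other n a v i"
  defines "T \<equiv> best_other n a v i" and "X \<equiv> fst (POOL n a r) v i"
  shows "snd (POOL n a r) v i = X * T" "0 \<le> X" "X \<le> 1" "T < v i \<Longrightarrow> X = 1" "v i < T \<Longrightarrow> X = 0"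
proof -
  have a: "\<And>i. i < n \<Longrightarrow> a \<le> v i" using av by blast
  have h: "highest n v = max (v i) T" using highest_eq_max[of i n a v] i a by (auto simp: T_def)
  then have hr: "r \<le> highest n v" using w by (simp add: T_def)
  then have X: "X = win_share n v i" by (simp add: X_def POOL_def)
  have "best_other n a v i \<noteq> a" using w r by auto
  then have "n \<noteq> 1" using best_other_attained[of n a v i] i by auto
  then have n2: "2 \<le> n" using i by simp
  then have S: "second_highest n v = runner_up n a v"
    using second_highest_eq_runner_up[of n a v] a by blast
  have R: "runner_up n a v = T" if "T \<le> v i"
    using runner_up_eq_best_other[of i n a v] i a that by (auto simp: T_def)
  have W0: "win_share n v i = 0" if "v i < T"
    using win_share_eq_0[of v i n] h that by auto
  consider "v i < T" | "T \<le> v i" by linarith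
  then show "snd (POOL n a r) v i = X * T"
  proof cases
    case 1
    then show ?thesis using w h by (auto simp: POOL_def X W0 T_def max_def)
  next
    case 2
    then show ?thesis using w h n2 by (simp add: POOL_def X S R T_def)
  qed
  show "0 \<le> X" "X \<le> 1" by (auto simp: X win_share_nonneg win_share_le_1)
  show "T < v i \<Longrightarrow> X = 1"
    using win_share_eq_1[of i n a v] i a by (auto simp: X T_def)
  show "v i < T \<Longrightarrow> X = 0" by (simp add: X W0)
qed

text \<open>With all rivals below r, buyer i faces a menu of two items: the share 1/n for a/n, or
  the whole item for ((n - 1) r + a) / n. The second price is the one at which a buyer of value r is
  indifferent.\<close>

lemma POOL_pooled:
  assumes i: "i < n" and av: "\<forall>i<n. a \<le> v i" and r: "a < r"
    and w: "best_other n a v i < r"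
  shows "fst (POOL n a r) v i = (if r \<le> v i then 1 else 1 / real n)"
    and "snd (POOL n a r) v i = (if r \<le> v i then ((real n - 1) * r + a) / real n else a / real n)"
proof -
  have a: "\<And>i. i < n \<Longrightarrow> a \<le> v i" using av by blast
  have h: "highest n v = max (v i) (best_other n a v i)" using highest_eq_max[of i n a v] i a by auto
  have S: "\<not> (2 \<le> n \<and> r \<le> second_highest n v)"
  proof
    assume *: "2 \<le> n \<and> r \<le> second_highest n v"
    then have "best_other n a v i < runner_up n a v"
      using second_highest_eq_runner_up[of n a v] a w by auto
    then obtain k j where "k < j" "j < n" "best_other n a v i < v k" "best_other n a v i < v j"
      using less_runner_up_iff[of a "best_other n a v i" n v] best_other_ge(1)[of a n v i] by blast
    then show False
      using best_other_ge(2)[of k n i v a] best_other_ge(2)[of j n i v a] by (cases "k = i") auto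
  qed
  have W1: "win_share n v i = 1" if "r \<le> v i"
    using win_share_eq_1[of i n a v] i a that w by auto
  have hr: "r \<le> highest n v \<longleftrightarrow> r \<le> v i" using h w by auto
  show "fst (POOL n a r) v i = (if r \<le> v i then 1 else 1 / real n)"
    using W1 by (auto simp: POOL_def hr)
  show "snd (POOL n a r) v i = (if r \<le> v i then ((real n - 1) * r + a) / real n else a / real n)"
    using S W1 by (auto simp: POOL_def hr)
qed

text \<open>With \<open>vs = b\<close> this is SPA and with \<open>vs = a\<close> it is POOL, up to
  thresholds that have probability 0 in those regimes. Feasibility, revenue and optimality are
  therefore proved once for all regimes.\<close>

definition hybrid :: "nat \<Rightarrow> real \<Rightarrow> real \<Rightarrow> real \<Rightarrow> mechanism" where
  "hybrid n a vs r = (if r \<le> vs then SPA n r else POOL n a r)"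

lemma threshold_price_IC:
  fixes X X' T u u' :: real
  assumes "0 \<le> X" "X \<le> 1" "T < u \<Longrightarrow> X = 1" "u < T \<Longrightarrow> X = 0" "0 \<le> X'" "X' \<le> 1"
  shows "0 \<le> u * X - X * T" "u * X' - X' * T \<le> u * X - X * T" "0 \<le> T \<Longrightarrow> 0 \<le> X * T"
proof -
  \<comment> \<open>Whatever the allocation at a tie, truthful bidding yields max 0 (u - T).\<close>
  have e: "u * X - X * T = max 0 (u - T)"
    using assms by (cases u T rule: linorder_cases) auto
  have "X' * (u - T) \<le> max 0 (u - T)"
  proof (cases "u \<le> T")
    case True then show ?thesis using assms by (simp add: mult_nonneg_nonpos)
  next
    case False
    then have "X' * (u - T) \<le> 1 * (u - T)" using assms by (intro mult_right_mono) auto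
    then show ?thesis by simp
  qed
  then show "u * X' - X' * T \<le> u * X - X * T" unfolding e by (simp add: algebra_simps)
  show "0 \<le> u * X - X * T" unfolding e by simp
  show "0 \<le> T \<Longrightarrow> 0 \<le> X * T" using assms by simp
qed

lemma pooled_price_IC:
  fixes r a u u' :: real and n :: nat
  assumes n: "1 \<le> n" and "a < r" "0 \<le> a" "a \<le> u"
  defines "X y \<equiv> (if r \<le> y then 1 else 1 / real n)"
    and "P y \<equiv> (if r \<le> y then ((real n - 1) * r + a) / real n else a / real n)"
  shows "0 \<le> u * X u - P u" "u * X u' - P u' \<le> u * X u - P u" "0 \<le> P u"
proof -
  have n0: "real n > 0" "real n \<ge> 1" using n by auto
  have lo: "u * (1 / real n) - a / real n = (u - a) / real n" by (simp add: diff_divide_distrib)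
  \<comment> \<open>Moving from the share 1/n to the whole item gains (n - 1)/n times u - r, so the
    sign of u - r decides which menu item is best.\<close>
  have hi: "u - ((real n - 1) * r + a) / real n = (u - a) / real n + (real n - 1) / real n * (u - r)"
    using n0 by (simp add: field_simps)
  have q: "0 \<le> (real n - 1) / real n" using n0 by simp
  have p: "0 \<le> (u - a) / real n" using assms n0 by simp
  show "0 \<le> u * X u - P u"
  proof (cases "r \<le> u")
    case True
    then have "0 \<le> (real n - 1) / real n * (u - r)" using q by (intro mult_nonneg_nonneg) auto
    then have "0 \<le> u - ((real n - 1) * r + a) / real n" unfolding hi using p by linarith
    then show ?thesis using True unfolding X_def P_def by simp
  next
    case False
    then show ?thesis using p lo unfolding X_def P_def by simp
  qed
  show "u * X u' - P u' \<le> u * X u - P u"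
  proof (cases "r \<le> u")
    case True
    then have "0 \<le> (real n - 1) / real n * (u - r)" using q by (intro mult_nonneg_nonneg) auto
    then show ?thesis using True hi lo unfolding X_def P_def by simp
  next
    case False
    then have "(real n - 1) / real n * (u - r) \<le> 0" using q by (intro mult_nonneg_nonpos) auto
    then show ?thesis using False hi lo unfolding X_def P_def by simp
  qed
  show "0 \<le> P u" unfolding P_def using assms n0 by auto
qed

lemma hybrid_IC:
  assumes i: "i < n" and av: "\<forall>i<n. a \<le> v i" and r: "a < r" and a0: "0 \<le> a" and y: "a \<le> y"
  shows "0 \<le> v i * fst (hybrid n a vs r) v i - snd (hybrid n a vs r) v i"
    and "v i * fst (hybrid n a vs r) (v(i := y)) i - snd (hybrid n a vs r) (v(i := y)) i
           \<le> v i * fst (hybrid n a vs r) v i - snd (hybrid n a vs r) v i"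
    and "0 \<le> fst (hybrid n a vs r) v i" "fst (hybrid n a vs r) v i \<le> 1"
    and "0 \<le> snd (hybrid n a vs r) v i"
proof -
  have a: "\<And>i. i < n \<Longrightarrow> a \<le> v i" using av by blast
  let ?w = "best_other n a v i" and ?v = "v(i := y)"
  have av: "\<forall>j<n. a \<le> v j" "\<forall>j<n. a \<le> ?v j" using a y by simp_all
  have w0: "0 \<le> ?w" using best_other_ge(1)[of a n v i] a0 by simp
  have n: "1 \<le> n" using i by simp
  note S = SPA_threshold[of i n a v r, OF i av(1) r] SPA_threshold[of i n a ?v r, OF i av(2) r]
  note P = POOL_threshold[of i n a v r, OF i av(1) r] POOL_threshold[of i n a ?v r, OF i av(2) r]
  note Q = POOL_pooled[of i n a v r, OF i av(1) r] POOL_pooled[of i n a ?v r, OF i av(2) r]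
  note I = pooled_price_IC[OF n r a0 a[OF i]]
  have ir: "0 \<le> v i * fst (hybrid n a vs r) v i - snd (hybrid n a vs r) v i \<and>
    v i * fst (hybrid n a vs r) ?v i - snd (hybrid n a vs r) ?v i
           \<le> v i * fst (hybrid n a vs r) v i - snd (hybrid n a vs r) v i \<and>
    0 \<le> fst (hybrid n a vs r) v i \<and> fst (hybrid n a vs r) v i \<le> 1 \<and>
    0 \<le> snd (hybrid n a vs r) v i"
  proof (cases "r \<le> vs")
    case True
    then have hyb: "hybrid n a vs r = SPA n r" by (simp add: hybrid_def)
    have T: "0 \<le> max r ?w" using w0 by simp
    have s2: "snd (SPA n r) ?v i = fst (SPA n r) ?v i * max r ?w" using S(6) by simp
    have s1: "snd (SPA n r) v i = fst (SPA n r) v i * max r ?w" using S(1) by simp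
    show ?thesis
      using threshold_price_IC[of "fst (SPA n r) v i" "max r ?w" "v i" "fst (SPA n r) ?v i",
          OF S(2) S(3) S(4) S(5) S(7) S(8)] T S(2,3)
      unfolding hyb s1 s2 by auto
  next
    case False
    then have hyb: "hybrid n a vs r = POOL n a r" by (simp add: hybrid_def)
    show ?thesis
    proof (cases "r \<le> ?w")
      case True
      then have T: "r \<le> best_other n a ?v i" by simp
      have s2: "snd (POOL n a r) ?v i = fst (POOL n a r) ?v i * ?w" using P(6)[OF T] by simp
      have s1: "snd (POOL n a r) v i = fst (POOL n a r) v i * ?w" using P(1)[OF True] by simp
      show ?thesis
        using threshold_price_IC[of "fst (POOL n a r) v i" ?w "v i" "fst (POOL n a r) ?v i",
            OF P(2)[OF True] P(3)[OF True] P(4)[OF True] P(5)[OF True] P(7)[OF T] P(8)[OF T]]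
          w0 P(2,3)[OF True]
        unfolding hyb s1 s2 by auto
    next
      case False
      then have w: "?w < r" "best_other n a ?v i < r" by auto
      show ?thesis
        unfolding hyb Q(1,2)[OF w(1)] Q(3,4)[OF w(2)]
        using I(1,3) I(2)[of y] n by simp
    qed
  qed
  then show "0 \<le> v i * fst (hybrid n a vs r) v i - snd (hybrid n a vs r) v i"
    "v i * fst (hybrid n a vs r) (v(i := y)) i - snd (hybrid n a vs r) (v(i := y)) i
           \<le> v i * fst (hybrid n a vs r) v i - snd (hybrid n a vs r) v i"
    "0 \<le> fst (hybrid n a vs r) v i" "fst (hybrid n a vs r) v i \<le> 1"
    "0 \<le> snd (hybrid n a vs r) v i" by auto
qed

lemma hybrid_AC:
  assumes "1 \<le> n"
  shows "(\<Sum>i<n. fst (hybrid n a vs r) v i) \<le> 1"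
  using sum_win_share[OF assms, of v] assms
  by (cases "r \<le> vs"; cases "r \<le> highest n v") (simp_all add: hybrid_def SPA_def POOL_def)

lemma hybrid_revenue:
  assumes n: "1 \<le> n" and av: "\<forall>i<n. a \<le> v i" and r: "a < r"
  shows "(\<Sum>i<n. snd (hybrid n a vs r) v i)
    = (if r \<le> runner_up n a v then runner_up n a v
       else if r \<le> vs then (if r \<le> highest n v then r else 0)
       else if r \<le> highest n v then ((real n - 1) * r + a) / real n else a)"
proof -
  have a: "\<And>i. i < n \<Longrightarrow> a \<le> v i" using av by blast
  have second: "2 \<le> n \<and> r \<le> second_highest n v \<longleftrightarrow> r \<le> runner_up n a v"
    using second_highest_eq_runner_up[of n a v] a r n runner_up_one[of a v]
    by (cases "n = 1") auto
  have second': "second_highest n v = runner_up n a v" if "r \<le> runner_up n a v"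
    using that second second_highest_eq_runner_up[of n a v] a by blast
  have "(\<Sum>i<n. c * win_share n v i) = c" for c
    using sum_win_share[OF n, of v] by (simp flip: sum_distrib_left)
  note sum_c = this
  show ?thesis
  proof (cases "r \<le> runner_up n a v")
    case True
    then have "2 \<le> n \<and> r \<le> runner_up n a v" "second_highest n v = runner_up n a v"
      using second second' by auto
    then show ?thesis
      by (simp add: hybrid_def SPA_def POOL_def sum_c)
  next
    case False
    then have "\<not> (2 \<le> n \<and> r \<le> second_highest n v)" using second by simp
    then have "snd (hybrid n a vs r) v i
       = (if r \<le> vs then (if r \<le> highest n v then r * win_share n v i else 0)
          else if r \<le> highest n v then ((real n - 1) * r + a) / real n * win_share n v i
          else a / real n)" for i
      unfolding hybrid_def SPA_def POOL_def by (cases "r \<le> vs") (simp_all only: if_True if_False snd_conv)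
    then show ?thesis
      using n False by (simp add: sum_c del: times_divide_eq_left)
  qed
qed

section \<open>Random reserves\<close>

lemma measurable_coord:
  assumes "i < n"
  shows "(\<lambda>v. v i) \<in> borel_measurable (val_algebra n a b)"
proof -
  have "(\<lambda>v. v i) \<in> val_algebra n a b \<rightarrow>\<^sub>M restrict_space borel {a..b}"
    using assms by (intro measurable_component_singleton) auto
  then show ?thesis by (rule measurable_compose) (simp add: measurable_restrict_space1)
qed

lemma measurable_highest [measurable]: "highest n \<in> borel_measurable (val_algebra n a b)"
  unfolding highest_def[abs_def] by (intro borel_measurable_Max measurable_coord) auto

lemma measurable_runner_up [measurable]: "runner_up n c \<in> borel_measurable (val_algebra n a b)"
proof -
  let ?P = "{(i, j). i < j \<and> j < n}"
  have "(\<lambda>v. max c (Max ((\<lambda>p. min (v (fst p)) (v (snd p))) ` ?P))) \<in> borel_measurable (val_algebra n a b)"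
    if "?P \<noteq> {}"
    by (intro borel_measurable_max borel_measurable_Max borel_measurable_min finite_pairs
        measurable_coord borel_measurable_const) auto
  moreover have "runner_up n c = (\<lambda>v. if ?P = {} then c
      else max c (Max ((\<lambda>p. min (v (fst p)) (v (snd p))) ` ?P)))"
  proof (cases "?P = {}")
    case False
    then show ?thesis
      using finite_pairs[of n] by (auto simp: runner_up_def fun_eq_iff split_beta Max_insert)
  next
    case True
    then show ?thesis
      unfolding runner_up_def by (simp only: image_empty Max_singleton if_True refl)
  qed
  ultimately show ?thesis by (cases "?P = {}") auto
qed

lemma measurable_win_share [measurable]:
  assumes [measurable]: "i < n"
  shows "(\<lambda>v. win_share n v i) \<in> borel_measurable (val_algebra n a b)"
proof -
  note measurable_coord [measurable]
  have "real (num_highest n v) = (\<Sum>j<n. if v j = highest n v then 1 else 0)" for v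
  proof -
    have "{i. i < n \<and> v i = highest n v} = {..<n} \<inter> {j. v j = highest n v}" by auto
    then show ?thesis
      by (simp add: num_highest_def sum.If_cases)
  qed
  moreover have "(\<lambda>v. if v i = highest n v then 1 / (\<Sum>j<n. if v j = highest n v then 1 else 0) else (0::real))
      \<in> borel_measurable (val_algebra n a b)"
    using assms by (intro measurable_If borel_measurable_divide borel_measurable_sum) measurable
  ultimately show ?thesis
    unfolding win_share_def by (simp cong: if_cong)
qed

lemma space_val_algebra: "space (val_algebra n a b) = val_profiles n a b"
  by (simp add: space_PiM)

lemma val_profilesD:
  assumes "v \<in> val_profiles n a b" "i < n"
  shows "a \<le> v i" "v i \<le> b"
  using PiE_mem[OF assms(1), of i] assms(2) by auto

lemma val_profiles_upd:
  assumes "v \<in> val_profiles n a b" "i < n" "y \<in> {a..b}"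
  shows "v(i := y) \<in> val_profiles n a b"
  using PiE_fun_upd[where f=v and x=i, OF assms(3,1)] insert_absorb[of i "{..<n}"] assms(2)
  by (simp only: lessThan_iff)

lemma measurable_hybrid_alloc:
  assumes [measurable]: "i < n"
  shows "(\<lambda>(v, r). fst (hybrid n a vs r) v i) \<in> borel_measurable (val_algebra n a b \<Otimes>\<^sub>M borel)"
proof -
  have "(\<lambda>(v, r). if r \<le> vs then (if r \<le> highest n v then win_share n v i else 0)
      else (if r \<le> highest n v then win_share n v i else 1 / real n))
      \<in> borel_measurable (val_algebra n a b \<Otimes>\<^sub>M borel)"
    using assms by measurable
  also have "(\<lambda>(v, r). if r \<le> vs then (if r \<le> highest n v then win_share n v i else 0)
      else (if r \<le> highest n v then win_share n v i else 1 / real n))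
      = (\<lambda>(v, r). fst (hybrid n a vs r) v i)"
    by (auto simp: fun_eq_iff hybrid_def SPA_def POOL_def)
  finally show ?thesis .
qed

lemma measurable_hybrid_payment:
  assumes [measurable]: "i < n"
  shows "(\<lambda>(v, r). snd (hybrid n a vs r) v i) \<in> borel_measurable (val_algebra n a b \<Otimes>\<^sub>M borel)"
proof -
  let ?f = "\<lambda>(v, r). if r \<le> vs
      then (if 2 \<le> n \<and> r \<le> runner_up n a v then runner_up n a v * win_share n v i
            else if r \<le> highest n v then r * win_share n v i else 0)
      else (if 2 \<le> n \<and> r \<le> runner_up n a v then runner_up n a v * win_share n v i
            else if r \<le> highest n v then ((real n - 1) * r + a) / real n * win_share n v i
            else a / real n)"
  have "?f \<in> borel_measurable (val_algebra n a b \<Otimes>\<^sub>M borel)"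
    using assms by measurable
  moreover have "?f z = (case z of (v, r) \<Rightarrow> snd (hybrid n a vs r) v i)"
    if "z \<in> space (val_algebra n a b \<Otimes>\<^sub>M borel)" for z
  proof -
    obtain v r where z: "z = (v, r)" by force
    have v: "v \<in> val_profiles n a b"
      using that by (simp add: z space_pair_measure space_val_algebra)
    show ?thesis
      using second_highest_eq_runner_up[of n a v] val_profilesD(1)[OF v]
      by (cases "2 \<le> n") (simp_all add: z hybrid_def SPA_def POOL_def)
  qed
  ultimately show ?thesis by (simp cong: measurable_cong)
qed

text \<open>\<open>cdf D a = 0\<close> makes a < r almost sure. At r = a and n = 1 the convention
  that \<open>runner_up\<close> is a would count as a bid meeting the reserve.\<close>

locale hybrid_auction = real_distribution D for D :: "real measure" +
  fixes n :: nat and a b vs :: real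
  assumes n1: "1 \<le> n" and a0: "0 \<le> a" and cdf_a: "cdf D a = 0"
begin

lemma AE_above: "AE r in D. a < r"
proof -
  have "emeasure D {..a} = 0" using cdf_a by (simp add: cdf_def2 emeasure_eq_measure)
  then have "{..a} \<in> null_sets D" by (auto simp: null_sets_def)
  then show ?thesis by (rule AE_I') auto
qed

lemma measurable_D [measurable]:
  assumes "i < n" "v \<in> val_profiles n a b"
  shows "(\<lambda>r. fst (hybrid n a vs r) v i) \<in> borel_measurable D"
    and "(\<lambda>r. snd (hybrid n a vs r) v i) \<in> borel_measurable D"
proof -
  have v: "(\<lambda>r. (v, r)) \<in> borel \<rightarrow>\<^sub>M val_algebra n a b \<Otimes>\<^sub>M borel"
    using assms by (intro measurable_Pair1') (simp add: space_PiM)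
  have "(\<lambda>r. fst (hybrid n a vs r) v i) \<in> borel_measurable borel"
    "(\<lambda>r. snd (hybrid n a vs r) v i) \<in> borel_measurable borel"
    using measurable_compose[OF v measurable_hybrid_alloc[OF assms(1), of a vs]]
      measurable_compose[OF v measurable_hybrid_payment[OF assms(1), of a vs]] by simp_all
  then show "(\<lambda>r. fst (hybrid n a vs r) v i) \<in> borel_measurable D"
    "(\<lambda>r. snd (hybrid n a vs r) v i) \<in> borel_measurable D"
    by simp_all
qed

lemma hybrid_bounds:
  assumes i: "i < n" and v: "v \<in> val_profiles n a b" and r: "a < r"
  shows "\<bar>fst (hybrid n a vs r) v i\<bar> \<le> 1" "\<bar>snd (hybrid n a vs r) v i\<bar> \<le> b"
proof -
  have va: "\<forall>j<n. a \<le> v j" using val_profilesD[OF v] by simp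
  note I = hybrid_IC[of i n a v r a vs, OF i va r a0 order.refl]
  show "\<bar>fst (hybrid n a vs r) v i\<bar> \<le> 1" using I(3,4) by simp
  have "v i * fst (hybrid n a vs r) v i \<le> v i * 1"
    using I(4) val_profilesD(1)[OF v i] a0 by (intro mult_left_mono) auto
  then show "\<bar>snd (hybrid n a vs r) v i\<bar> \<le> b"
    using I(1,5) val_profilesD(2)[OF v i] by simp
qed

lemma integrable_hybrid:
  assumes i: "i < n" and v: "v \<in> val_profiles n a b"
  shows "integrable D (\<lambda>r. fst (hybrid n a vs r) v i)" "integrable D (\<lambda>r. snd (hybrid n a vs r) v i)"
proof -
  show "integrable D (\<lambda>r. fst (hybrid n a vs r) v i)"
    using AE_above by (intro integrable_const_bound[where B=1] measurable_D[OF i v])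
      (auto elim!: eventually_mono dest: hybrid_bounds[OF i v])
  show "integrable D (\<lambda>r. snd (hybrid n a vs r) v i)"
    using AE_above by (intro integrable_const_bound[where B=b] measurable_D[OF i v])
      (auto elim!: eventually_mono dest: hybrid_bounds[OF i v])
qed

text \<open>Individual rationality, incentive compatibility and the supply constraint are linear
  inequalities in (x, p) that hold for almost every r, so they pass to the average over D.\<close>

lemma random_hybrid_in_M_all: "random_mechanism D (hybrid n a vs) \<in> M_all n a b"
proof -
  define x where "x = (\<lambda>v i. \<integral>r. fst (hybrid n a vs r) v i \<partial>D)"
  define p where "p = (\<lambda>v i. \<integral>r. snd (hybrid n a vs r) v i \<partial>D)"
  have xp: "random_mechanism D (hybrid n a vs) = (x, p)"
    by (simp add: random_mechanism_def x_def p_def)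
  have sets_eq: "sets (val_algebra n a b \<Otimes>\<^sub>M D) = sets (val_algebra n a b \<Otimes>\<^sub>M borel)"
    by (intro sets_pair_measure_cong) auto
  have mx: "(\<lambda>v. x v i) \<in> borel_measurable (val_algebra n a b)" if "i < n" for i
    unfolding x_def using measurable_hybrid_alloc[OF that, of a vs b]
    by (intro borel_measurable_lebesgue_integral) (simp add: sets_eq cong: measurable_cong_sets)
  have mp: "(\<lambda>v. p v i) \<in> borel_measurable (val_algebra n a b)" if "i < n" for i
    unfolding p_def using measurable_hybrid_payment[OF that, of a vs b]
    by (intro borel_measurable_lebesgue_integral) (simp add: sets_eq cong: measurable_cong_sets)
  have B: "0 \<le> x v i \<and> x v i \<le> 1 \<and> 0 \<le> v i * x v i - p v i"
    and C: "w \<in> {a..b} \<Longrightarrow> v i * x (v(i := w)) i - p (v(i := w)) i \<le> v i * x v i - p v i"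
    if i: "i < n" and v: "v \<in> val_profiles n a b" for v i w
  proof -
    have va: "\<forall>j<n. a \<le> v j" using val_profilesD[OF v] by simp
    note I = hybrid_IC[of i n a v _ a vs, OF i va _ a0 order.refl]
    note int = integrable_hybrid[OF i v]
    have "0 \<le> x v i"
      unfolding x_def using AE_above by (intro integral_nonneg_AE) (auto elim!: eventually_mono dest: I(3))
    moreover have "x v i \<le> (\<integral>r. 1 \<partial>D)"
      unfolding x_def using AE_above int by (intro integral_mono_AE) (auto elim!: eventually_mono dest: I(4))
    moreover have U: "v i * x v i - p v i = (\<integral>r. v i * fst (hybrid n a vs r) v i - snd (hybrid n a vs r) v i \<partial>D)"
      unfolding x_def p_def using int by simp
    moreover have "0 \<le> v i * x v i - p v i"
      unfolding U using AE_above by (intro integral_nonneg_AE) (auto elim!: eventually_mono dest: I(1))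
    ultimately show "0 \<le> x v i \<and> x v i \<le> 1 \<and> 0 \<le> v i * x v i - p v i"
      using prob_space by simp
    assume w: "w \<in> {a..b}"
    then have v': "v(i := w) \<in> val_profiles n a b" by (rule val_profiles_upd[OF v i])
    note int' = integrable_hybrid[OF i v']
    have U': "v i * x (v(i := w)) i - p (v(i := w)) i
        = (\<integral>r. v i * fst (hybrid n a vs r) (v(i := w)) i - snd (hybrid n a vs r) (v(i := w)) i \<partial>D)"
      unfolding x_def p_def using int' by simp
    have wa: "a \<le> w" using w by simp
    note J = hybrid_IC[of i n a v _ w vs, OF i va _ a0 wa]
    show "v i * x (v(i := w)) i - p (v(i := w)) i \<le> v i * x v i - p v i"
      unfolding U U' using AE_above int int'
      by (intro integral_mono_AE) (auto elim!: eventually_mono dest: J(2))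
  qed
  have "(\<Sum>i<n. x v i) \<le> 1" if v: "v \<in> val_profiles n a b" for v
  proof -
    have "(\<Sum>i<n. x v i) = (\<integral>r. (\<Sum>i<n. fst (hybrid n a vs r) v i) \<partial>D)"
      unfolding x_def using integrable_hybrid(1)[OF _ v] by (subst Bochner_Integration.integral_sum) auto
    also have "\<dots> \<le> (\<integral>r. 1 \<partial>D)"
      using integrable_hybrid(1)[OF _ v] hybrid_AC[OF n1] by (intro integral_mono) auto
    finally show ?thesis using prob_space by simp
  qed
  then show ?thesis
    unfolding xp M_all_def using mx mp B C by auto
qed

end

text \<open>
  Expected payment as a function of the two highest values: \<open>rate_first\<close> and \<open>rate_second\<close> are its
  derivatives in the highest and in the second-highest value when the threshold has density \<open>g\<close>.
\<close>

locale hybrid_density = hybrid_auction D n a b vs for D n a b vs +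
  fixes g :: "real \<Rightarrow> real" and S :: "real set"
  assumes ab: "a < b" and vs: "a \<le> vs" "vs \<le> b"
    and cdf_cont: "continuous_on {a..b} (cdf D)" and finS: "finite S"
    and cdf_deriv: "\<And>t. t \<in> {a<..<b} - S \<Longrightarrow> (cdf D has_real_derivative g t) (at t)"
    and g_nonneg: "\<And>t. t \<in> {a<..<b} \<Longrightarrow> 0 \<le> g t"
    and g_borel [measurable]: "g \<in> borel_measurable borel"
begin

definition rate_first :: "real \<Rightarrow> real" where
  "rate_first t = (if t \<le> vs then t else (real n - 1) / real n * (t - a)) * g t"

definition rate_second :: "real \<Rightarrow> real" where
  "rate_second t = cdf D t + (if t \<le> vs then 0 else (t - a) / real n) * g t"

lemma cdf_borel [measurable]: "cdf D \<in> borel_measurable borel"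
  by (intro borel_measurable_mono monoI cdf_nondecreasing)

lemma integrable_g: "integrable (Ioo_lborel a b) g"
  using ab by (intro integrable_Ioo_lborel_FTC[OF _ cdf_cont finS cdf_deriv g_nonneg g_borel]) auto

lemma integrable_rate:
  shows "integrable (Ioo_lborel a b) rate_first" "integrable (Ioo_lborel a b) rate_second"
    "integrable (Ioo_lborel a b) (cdf D)"
proof -
  have m: "(\<lambda>t. if t \<le> vs then t else (real n - 1) / real n * (t - a)) \<in> borel_measurable (Ioo_lborel a b)"
    "(\<lambda>t. if t \<le> vs then 0 else (t - a) / real n) \<in> borel_measurable (Ioo_lborel a b)"
    "cdf D \<in> borel_measurable (Ioo_lborel a b)"
    by (intro borel_measurable_Ioo_lborel; measurable)+
  have q: "0 \<le> (real n - 1) / real n" "(real n - 1) / real n \<le> 1" "1 \<le> real n" using n1 by auto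
  show "integrable (Ioo_lborel a b) rate_first"
    unfolding rate_first_def[abs_def]
  proof (rule integrable_mult_bounded[OF integrable_g m(1), where B=b])
    fix t assume t: "t \<in> space (Ioo_lborel a b)"
    then have "(real n - 1) / real n * (t - a) \<le> 1 * (t - a)" "0 \<le> (real n - 1) / real n * (t - a)"
      using q by (intro mult_right_mono mult_nonneg_nonneg; auto simp: space_restrict_space)+
    then show "\<bar>if t \<le> vs then t else (real n - 1) / real n * (t - a)\<bar> \<le> b"
      using t a0 by (auto simp: space_restrict_space)
  qed
  show c: "integrable (Ioo_lborel a b) (cdf D)"
    by (rule integrable_Ioo_lborel_bounded[OF m(3), where B=1]) (simp add: cdf_nonneg cdf_bounded_prob)
  have "integrable (Ioo_lborel a b) (\<lambda>t. (if t \<le> vs then 0 else (t - a) / real n) * g t)"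
  proof (rule integrable_mult_bounded[OF integrable_g m(2), where B=b])
    fix t assume t: "t \<in> space (Ioo_lborel a b)"
    then have "(t - a) / real n \<le> (t - a) / 1"
      using q by (intro divide_left_mono) (auto simp: space_restrict_space)
    then show "\<bar>if t \<le> vs then 0 else (t - a) / real n\<bar> \<le> b"
      using t a0 by (auto simp: space_restrict_space)
  qed
  then show "integrable (Ioo_lborel a b) rate_second"
    unfolding rate_second_def[abs_def] using c by simp
qed

text \<open>Continuity of the cdf on [a, b] excludes an atom at b. Mass beyond b stays
  possible.\<close>

lemma AE_inside: "AE r in D. a < r \<and> r \<noteq> b"
proof -
  have "(cdf D \<longlongrightarrow> cdf D b) (at_left b)"
    using cdf_cont ab unfolding continuous_on_def
    by (metis (no_types, opaque_lifting) at_within_Icc_at_left atLeastAtMost_iff less_imp_le order.refl)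
  then have "cdf D b = measure D {..<b}"
    using tendsto_unique[OF _ cdf_at_left[of b]] by force
  moreover have "measure D {..b} = measure D {..<b} + measure D {b}"
    by (subst finite_measure_Union[symmetric]) (auto intro!: arg_cong[where f="measure D"])
  ultimately have "measure D {b} = 0" by (simp add: cdf_def2)
  then have "{b} \<in> null_sets D" by (auto simp: null_sets_def emeasure_eq_measure)
  then have "AE r in D. r \<noteq> b" by (rule AE_I') auto
  then show ?thesis using AE_above by eventually_elim simp
qed

lemma integral_below:
  assumes y: "y \<le> b" and [measurable]: "k \<in> borel_measurable borel"
  shows "(\<integral>r. (if r \<le> y then k r else 0) \<partial>D)
       = (\<integral>t. (if t < y then k t * g t else 0) \<partial>Ioo_lborel a b)"
    and "(\<And>r. a < r \<Longrightarrow> r \<le> b \<Longrightarrow> \<bar>k r\<bar> \<le> B) \<Longrightarrow> integrable D (\<lambda>r. if r \<le> y then k r else 0)"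

proof -
  have "(\<integral>r. (if r \<le> y then k r else 0) \<partial>D)
      = (\<integral>r. indicator {a<..<b} r * (if r \<le> y then k r else 0) \<partial>D)"
  proof (rule integral_cong_AE)
    show "AE r in D. (if r \<le> y then k r else 0) = indicator {a<..<b} r * (if r \<le> y then k r else 0)"
      using AE_inside by eventually_elim (use y in \<open>auto simp: indicator_def\<close>)
  qed auto
  also have "\<dots> = (\<integral>t. (if t \<le> y then k t else 0) * g t \<partial>Ioo_lborel a b)"
    using ab g_nonneg by (intro integral_cdf_deriv[OF real_distribution_axioms ab cdf_cont refl finS cdf_deriv]) auto
  also have "\<dots> = (\<integral>t. (if t < y then k t * g t else 0) \<partial>Ioo_lborel a b)"
  proof (rule integral_cong_AE)
    show "(\<lambda>t. (if t \<le> y then k t else 0) * g t) \<in> borel_measurable (Ioo_lborel a b)"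
      "(\<lambda>t. if t < y then k t * g t else 0) \<in> borel_measurable (Ioo_lborel a b)"
      by (intro borel_measurable_Ioo_lborel; measurable)+
    have "AE t in Ioo_lborel a b. t \<noteq> y"
      using AE_lborel_singleton[of y] by (subst AE_restrict_space_iff) auto
    then show "AE t in Ioo_lborel a b. (if t \<le> y then k t else 0) * g t = (if t < y then k t * g t else 0)"
      by eventually_elim auto
  qed
  finally show "(\<integral>r. (if r \<le> y then k r else 0) \<partial>D)
       = (\<integral>t. (if t < y then k t * g t else 0) \<partial>Ioo_lborel a b)" .
  show "(\<And>r. a < r \<Longrightarrow> r \<le> b \<Longrightarrow> \<bar>k r\<bar> \<le> B) \<Longrightarrow> integrable D (\<lambda>r. if r \<le> y then k r else 0)"
  proof (intro integrable_const_bound[where B="\<bar>B\<bar>"])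
    assume k: "\<And>r. a < r \<Longrightarrow> r \<le> b \<Longrightarrow> \<bar>k r\<bar> \<le> B"
    show "AE r in D. norm (if r \<le> y then k r else 0) \<le> \<bar>B\<bar>"
      using AE_above
    proof eventually_elim
      case (elim r)
      then show ?case using k[of r] y by (cases "r \<le> y") auto
    qed
  qed simp
qed

text \<open>Integration by parts in layer form. This is the part of the payment that grows with the
  runner-up once the runner-up has passed the threshold.\<close>

lemma integral_excess:
  assumes y: "a \<le> y" "y \<le> b"
  shows "(\<integral>r. max 0 (y - r) \<partial>D) = (\<integral>t. (if t < y then cdf D t else 0) \<partial>Ioo_lborel a b)"
    and "integrable D (\<lambda>r. max 0 (y - r))"
proof -
  let ?L = "Ioo_lborel a b"
  let ?h = "\<lambda>t. if t < y then 1 else 0 :: real"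
  have mh: "?h \<in> borel_measurable ?L"
    by (rule borel_measurable_Ioo_lborel) measurable
  have h: "integrable ?L ?h"
    by (rule integrable_Ioo_lborel_bounded[OF mh, where B=1]) auto
  have hc: "integrable ?L (\<lambda>t. ?h t * cdf D t)"
    using integrable_mult_bounded[OF integrable_rate(3) mh, of 1] by auto
  have layer: "max 0 (y - r) = (y - a) - (\<integral>t. (if t < r then ?h t else 0) \<partial>?L)" if "a < r" for r
  proof -
    have "(\<integral>t. (if t < r then ?h t else 0) \<partial>?L) = (\<integral>t. (if t < min r y then 1 else 0) \<partial>?L)"
      by (intro Bochner_Integration.integral_cong) auto
    also have "\<dots> = min r y - a"
      using that y by (intro integral_lower_layer) auto
    finally show ?thesis by (simp add: min_def max_def)
  qed
  have id: "(\<lambda>r. r) \<in> borel_measurable D" by simp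
  note E = integrable_layers[OF id h] expectation_layers[OF id h]
  show "integrable D (\<lambda>r. max 0 (y - r))"
    using AE_above y a0 by (intro integrable_const_bound[where B="b"])
      (auto elim!: eventually_mono)
  have "(\<integral>r. max 0 (y - r) \<partial>D) = (\<integral>r. (y - a) - (\<integral>t. (if t < r then ?h t else 0) \<partial>?L) \<partial>D)"
    using AE_above E(1) by (intro integral_cong_AE borel_measurable_diff)
      (auto elim!: eventually_mono simp: layer)
  also have "\<dots> = (y - a) - (\<integral>t. ?h t * prob {r\<in>space D. t < r} \<partial>?L)"
    using E prob_space by simp
  also have "prob {r\<in>space D. t < r} = 1 - cdf D t" for t
  proof -
    have "{r\<in>space D. t < r} = space D - {..t}" by auto
    then show ?thesis using prob_compl[of "{..t}"] by (simp add: cdf_def2)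
  qed
  then have "(\<integral>t. ?h t * prob {r\<in>space D. t < r} \<partial>?L) = (\<integral>t. ?h t - ?h t * cdf D t \<partial>?L)"
    by (intro Bochner_Integration.integral_cong) (auto simp: algebra_simps)
  also have "\<dots> = (y - a) - (\<integral>t. ?h t * cdf D t \<partial>?L)"
    using h hc integral_lower_layer[OF y] by simp
  also have "(\<integral>t. ?h t * cdf D t \<partial>?L) = (\<integral>t. (if t < y then cdf D t else 0) \<partial>?L)"
    by (intro Bochner_Integration.integral_cong) auto
  finally show "(\<integral>r. max 0 (y - r) \<partial>D) = (\<integral>t. (if t < y then cdf D t else 0) \<partial>Ioo_lborel a b)"
    by simp
qed

text \<open>For fixed r the revenue starts at 0 (SPA) or a (POOL), jumps by
  \<open>\<alpha> r\<close> when the highest value reaches r and by \<open>\<beta> r\<close> when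
  the runner-up does, and then grows with the runner-up. Averaging over r turns the jumps into
  integrals against the density g and the growth into an integral of the cdf.\<close>

lemma total_payment:
  assumes v: "v \<in> val_profiles n a b"
  shows "(\<Sum>i<n. snd (random_mechanism D (hybrid n a vs)) v i)
     = a * (1 - cdf D vs)
       + (\<integral>t. (if t < highest n v then rate_first t else 0) \<partial>Ioo_lborel a b)
       + (\<integral>t. (if t < runner_up n a v then rate_second t else 0) \<partial>Ioo_lborel a b)"
proof -
  let ?L = "Ioo_lborel a b"
  define y1 where "y1 = highest n v"
  define y2 where "y2 = runner_up n a v"
  have va: "\<And>i. i < n \<Longrightarrow> a \<le> v i" and vb: "\<And>i. i < n \<Longrightarrow> v i \<le> b" using val_profilesD[OF v] by auto
  have va': "\<forall>i<n. a \<le> v i" using va by blast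
  have y: "a \<le> y2" "y2 \<le> y1" "y1 \<le> b"
    using runner_up_ge[of a n v] runner_up_le_highest[of n a v] va n1 highest_attained[OF n1, of v] vb
    unfolding y1_def y2_def by force+
  define \<alpha> where "\<alpha> = (\<lambda>r. if r \<le> vs then r else (real n - 1) / real n * (r - a))"
  define \<beta> where "\<beta> = (\<lambda>r. if r \<le> vs then 0 else (r - a) / real n)"
  have q: "0 \<le> (real n - 1) / real n" "(real n - 1) / real n \<le> 1" "1 \<le> real n" using n1 by auto
  have \<alpha>: "\<alpha> \<in> borel_measurable borel" "\<bar>\<alpha> r\<bar> \<le> b" if "a < r" "r \<le> b" for r
  proof -
    show "\<alpha> \<in> borel_measurable borel" unfolding \<alpha>_def by measurable
    have "(real n - 1) / real n * (r - a) \<le> 1 * (r - a)" "0 \<le> (real n - 1) / real n * (r - a)"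
      using q that by (intro mult_right_mono mult_nonneg_nonneg; simp)+
    then show "\<bar>\<alpha> r\<bar> \<le> b" using that a0 unfolding \<alpha>_def by auto
  qed
  have \<beta>: "\<beta> \<in> borel_measurable borel" "\<bar>\<beta> r\<bar> \<le> b" if "a < r" "r \<le> b" for r
  proof -
    show "\<beta> \<in> borel_measurable borel" unfolding \<beta>_def by measurable
    have "(r - a) / real n \<le> (r - a) / 1" using q that by (intro divide_left_mono) auto
    then show "\<bar>\<beta> r\<bar> \<le> b" using that a0 unfolding \<beta>_def by auto
  qed
  \<comment> \<open>The starting value and the two jumps add up to r, the price at the moment the
    runner-up reaches the threshold.\<close>
  have \<alpha>\<beta>: "\<alpha> r + \<beta> r + (if r \<le> vs then 0 else a) = r" for r
  proof (cases "r \<le> vs")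
    case False
    have "(real n - 1) / real n * (r - a) + (r - a) / real n = r - a"
      using q by (simp add: field_simps)
    then show ?thesis using False by (simp add: \<alpha>_def \<beta>_def)
  qed (simp add: \<alpha>_def \<beta>_def)
  have price: "(\<Sum>i<n. snd (hybrid n a vs r) v i)
      = (if r \<le> vs then 0 else a) + (if r \<le> y1 then \<alpha> r else 0) + (if r \<le> y2 then \<beta> r else 0)
        + max 0 (y2 - r)" if r: "a < r" for r
  proof -
    have e: "((real n - 1) * r + a) / real n = a + (real n - 1) / real n * (r - a)"
      using q by (simp add: field_simps)
    show ?thesis
      using \<alpha>\<beta>[of r] y r unfolding hybrid_revenue[of n a v r vs, OF n1 va' r] y1_def[symmetric] y2_def[symmetric]
      by (auto simp: \<alpha>_def \<beta>_def e)
  qed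
  note I1 = integral_below[OF y(3), of \<alpha>] and I3 = integral_excess[of y2]
  have y2b: "y2 \<le> b" using y by simp
  note I2 = integral_below[OF y2b, of \<beta>]
  have i0: "integrable D (\<lambda>r. if r \<le> vs then 0 else a)"
    by (intro integrable_const_bound[where B=a]) (auto simp: a0)
  have e0: "(\<integral>r. (if r \<le> vs then 0 else a) \<partial>D) = a * (1 - cdf D vs)"
  proof -
    have "(\<integral>r. (if r \<le> vs then 0 else a) \<partial>D) = (\<integral>r. a - a * indicator {..vs} r \<partial>D)"
      by (intro Bochner_Integration.integral_cong) auto
    also have "\<dots> = a * (1 - cdf D vs)"
      using prob_space
      by (subst Bochner_Integration.integral_diff)
        (simp_all add: cdf_def2 algebra_simps integrable_real_indicator emeasure_eq_measure)
    finally show ?thesis .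
  qed
  have i1: "integrable D (\<lambda>r. if r \<le> y1 then \<alpha> r else 0)"
    using I1(2)[where B=b] \<alpha> ab by blast
  have i2: "integrable D (\<lambda>r. if r \<le> y2 then \<beta> r else 0)"
    using I2(2)[where B=b] \<beta> ab by blast
  have e1: "(\<integral>r. (if r \<le> y1 then \<alpha> r else 0) \<partial>D) = (\<integral>t. (if t < y1 then \<alpha> t * g t else 0) \<partial>?L)"
    using I1(1) \<alpha> ab by blast
  have e2: "(\<integral>r. (if r \<le> y2 then \<beta> r else 0) \<partial>D) = (\<integral>t. (if t < y2 then \<beta> t * g t else 0) \<partial>?L)"
    using I2(1) \<beta> ab by blast
  have i3: "integrable D (\<lambda>r. max 0 (y2 - r))" using I3(2) y by simp
  have "(\<Sum>i<n. snd (random_mechanism D (hybrid n a vs)) v i) = (\<integral>r. (\<Sum>i<n. snd (hybrid n a vs r) v i) \<partial>D)"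
    unfolding random_mechanism_def using integrable_hybrid(2)[OF _ v]
    by (subst Bochner_Integration.integral_sum) auto
  also have "\<dots> = (\<integral>r. (if r \<le> vs then 0 else a) + (if r \<le> y1 then \<alpha> r else 0)
      + (if r \<le> y2 then \<beta> r else 0) + max 0 (y2 - r) \<partial>D)"
    using AE_above i0 i1 i2 i3 measurable_D(2)[OF _ v]
    by (intro integral_cong_AE borel_measurable_add borel_measurable_sum)
      (auto elim!: eventually_mono simp: price)
  also have "\<dots> = a * (1 - cdf D vs) + (\<integral>t. (if t < y1 then \<alpha> t * g t else 0) \<partial>?L)
      + (\<integral>t. (if t < y2 then \<beta> t * g t else 0) \<partial>?L) + (\<integral>t. (if t < y2 then cdf D t else 0) \<partial>?L)"
    using i0 i1 i2 i3 e0 e1 e2 I3(1) y by simp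
  also have "(\<lambda>t. if t < y1 then \<alpha> t * g t else 0) = (\<lambda>t. if t < y1 then rate_first t else 0)"
    by (auto simp: rate_first_def \<alpha>_def fun_eq_iff)
  also have "a * (1 - cdf D vs) + (\<integral>t. (if t < y1 then rate_first t else 0) \<partial>?L)
      + (\<integral>t. (if t < y2 then \<beta> t * g t else 0) \<partial>?L) + (\<integral>t. (if t < y2 then cdf D t else 0) \<partial>?L)
      = a * (1 - cdf D vs) + (\<integral>t. (if t < y1 then rate_first t else 0) \<partial>?L)
      + (\<integral>t. (if t < y2 then rate_second t else 0) \<partial>?L)"
  proof -
    have m: "(\<lambda>t. if t < y2 then 1 else 0 :: real) \<in> borel_measurable ?L"
      by (rule borel_measurable_Ioo_lborel) measurable
    have \<beta>g: "(\<lambda>t. \<beta> t * g t) = (\<lambda>t. rate_second t - cdf D t)"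
      by (auto simp: rate_second_def \<beta>_def fun_eq_iff)
    have "integrable ?L (\<lambda>t. \<beta> t * g t)"
      unfolding \<beta>g using integrable_rate by simp
    then have "integrable ?L (\<lambda>t. (if t < y2 then 1 else 0) * (\<beta> t * g t))"
      "integrable ?L (\<lambda>t. (if t < y2 then 1 else 0) * cdf D t)"
      using integrable_rate(3) by (auto intro!: integrable_mult_bounded[OF _ m, of _ 1])
    then have "(\<integral>t. (if t < y2 then 1 else 0) * (\<beta> t * g t) \<partial>?L) + (\<integral>t. (if t < y2 then 1 else 0) * cdf D t \<partial>?L)
       = (\<integral>t. (if t < y2 then 1 else 0) * (\<beta> t * g t) + (if t < y2 then 1 else 0) * cdf D t \<partial>?L)"
      by simp
    also have "\<dots> = (\<integral>t. (if t < y2 then rate_second t else 0) \<partial>?L)"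
      by (intro Bochner_Integration.integral_cong) (auto simp: rate_second_def \<beta>_def)
    finally show ?thesis
      by (simp add: if_distrib[where f="\<lambda>x. x * _"] cong: if_cong)
  qed
  finally show ?thesis unfolding y1_def y2_def .
qed

end

section \<open>Regret against independent values\<close>

text \<open>With A the set of values at most t, the events say that no value, respectively exactly
  one value, exceeds t. The second splits disjointly according to the coordinate that leaves
  A.\<close>

lemma measure_PiM_same:
  assumes "prob_space F" "A \<in> sets F"
  shows "measure (Pi\<^sub>M {..<n} (\<lambda>_. F)) {v \<in> space (Pi\<^sub>M {..<n} (\<lambda>_. F)). \<forall>i<n. v i \<in> A} = measure F A ^ n"
    and "measure (Pi\<^sub>M {..<n} (\<lambda>_. F))
        {v \<in> space (Pi\<^sub>M {..<n} (\<lambda>_. F)). \<exists>i<n. v i \<notin> A \<and> (\<forall>j<n. j \<noteq> i \<longrightarrow> v j \<in> A)}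
      = real n * (1 - measure F A) * measure F A ^ (n - 1)"
proof -
  interpret F: prob_space F by fact
  interpret finite_product_prob_space "\<lambda>_. F" "{..<n}" by unfold_locales auto
  let ?P = "Pi\<^sub>M {..<n} (\<lambda>_. F)"
  have A: "A \<subseteq> space F" using assms by (simp add: sets.sets_into_space)
  have "{v \<in> space ?P. \<forall>i<n. v i \<in> A} = Pi\<^sub>E {..<n} (\<lambda>_. A)"
    using A by (auto simp: space_PiM PiE_iff extensional_def)
  then show "measure ?P {v \<in> space ?P. \<forall>i<n. v i \<in> A} = measure F A ^ n"
    using finite_measure_PiM_emb[of "\<lambda>_. A"] assms by simp
  define B where "B i = Pi\<^sub>E {..<n} (\<lambda>j. if j = i then space F - A else A)" for i
  have "{v \<in> space ?P. \<exists>i<n. v i \<notin> A \<and> (\<forall>j<n. j \<noteq> i \<longrightarrow> v j \<in> A)} = (\<Union>i\<in>{..<n}. B i)"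
  proof (intro set_eqI iffI)
    fix v assume "v \<in> {v \<in> space ?P. \<exists>i<n. v i \<notin> A \<and> (\<forall>j<n. j \<noteq> i \<longrightarrow> v j \<in> A)}"
    then obtain i where "v \<in> space ?P" "i < n" "v i \<notin> A" "\<forall>j<n. j \<noteq> i \<longrightarrow> v j \<in> A" by blast
    then have "v \<in> B i" by (auto simp: B_def space_PiM PiE_iff)
    then show "v \<in> (\<Union>i\<in>{..<n}. B i)" using \<open>i < n\<close> by blast
  next
    fix v assume "v \<in> (\<Union>i\<in>{..<n}. B i)"
    then obtain i where i: "i < n" "v \<in> B i" by blast
    have *: "v j \<in> (if j = i then space F - A else A)" if "j < n" for j
      using PiE_mem[OF i(2)[unfolded B_def], of j] that by simp
    have "v i \<notin> A" using *[OF i(1)] by simp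
    moreover have "v j \<in> A" if "j < n" "j \<noteq> i" for j using *[OF that(1)] that(2) by simp
    moreover have "v \<in> space ?P"
    proof -
      have "v j \<in> space F" if "j < n" for j using *[OF that] A by (cases "j = i") auto
      moreover have "v \<in> extensional {..<n}" using i(2) unfolding B_def PiE_iff by blast
      ultimately show ?thesis unfolding space_PiM PiE_iff by simp
    qed
    ultimately show "v \<in> {v \<in> space ?P. \<exists>i<n. v i \<notin> A \<and> (\<forall>j<n. j \<noteq> i \<longrightarrow> v j \<in> A)}"
      using i(1) by blast
  qed
  moreover have "disjoint_family_on B {..<n}"
    unfolding disjoint_family_on_def
  proof (intro ballI impI)
    fix i j assume ij: "i \<in> {..<n}" "j \<in> {..<n}" "i \<noteq> j"
    show "B i \<inter> B j = {}"
    proof (rule ccontr)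
      assume "B i \<inter> B j \<noteq> {}"
      then obtain v where v: "v \<in> B i" "v \<in> B j" by blast
      have "v i \<in> space F - A" "v i \<in> A"
        using PiE_mem[OF v(1)[unfolded B_def] ij(1)] PiE_mem[OF v(2)[unfolded B_def] ij(1)] ij(3) by simp_all
      then show False by blast
    qed
  qed
  moreover have "B ` {..<n} \<subseteq> sets ?P"
    using assms by (auto simp: B_def intro!: sets_PiM_I_finite)
  ultimately have "measure ?P {v \<in> space ?P. \<exists>i<n. v i \<notin> A \<and> (\<forall>j<n. j \<noteq> i \<longrightarrow> v j \<in> A)}
      = (\<Sum>i<n. measure ?P (B i))"
    by (simp add: finite_measure_finite_Union)
  also have "measure ?P (B i) = (1 - measure F A) * measure F A ^ (n - 1)" if "i \<in> {..<n}" for i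
  proof -
    have "measure ?P (B i) = (\<Prod>j<n. measure F (if j = i then space F - A else A))"
      unfolding B_def using assms by (subst finite_measure_PiM_emb) auto
    also have "\<dots> = measure F (space F - A) * (\<Prod>j\<in>{..<n} - {i}. measure F A)"
      using that by (subst prod.remove[of _ i]) (auto intro!: prod.cong)
    finally show ?thesis
      using that assms by (simp add: F.prob_compl)
  qed
  then have "(\<Sum>i<n. measure ?P (B i)) = real n * (1 - measure F A) * measure F A ^ (n - 1)"
    by simp
  finally show "measure ?P {v \<in> space ?P. \<exists>i<n. v i \<notin> A \<and> (\<forall>j<n. j \<noteq> i \<longrightarrow> v j \<in> A)}
      = real n * (1 - measure F A) * measure F A ^ (n - 1)" .
qed

locale iid_values =
  fixes F :: "real measure" and n :: nat and a b :: real
  assumes prob_F: "prob_space F" and sets_F: "sets F = sets (restrict_space borel {a..b})" and n1: "1 \<le> n"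
begin

sublocale F: prob_space F by (rule prob_F)

abbreviation P where "P \<equiv> Pi\<^sub>M {..<n} (\<lambda>_. F)"

sublocale P: prob_space P by (rule prob_space_PiM) (rule prob_F)

lemma space_F: "space F = {a..b}"
  using sets_eq_imp_space_eq[OF sets_F] by (simp add: space_restrict_space)

lemma sets_P [measurable_cong]: "sets P = sets (val_algebra n a b)"
  by (intro sets_PiM_cong) (auto simp: sets_F)

lemma space_P: "space P = val_profiles n a b"
  by (simp add: space_PiM space_F)

lemma measurable_P: "borel_measurable P = borel_measurable (val_algebra n a b)"
  by (intro measurable_cong_sets sets_P refl)

lemma highest_borel [measurable]: "highest n \<in> borel_measurable P"
  and runner_up_borel [measurable]: "runner_up n a \<in> borel_measurable P"
  unfolding measurable_P by (rule measurable_highest measurable_runner_up)+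

lemma borel_F: "f \<in> borel_measurable borel \<Longrightarrow> f \<in> borel_measurable F"
  unfolding measurable_cong_sets[OF sets_F refl] by (rule measurable_restrict_space1)

definition H :: "real \<Rightarrow> real" where "H t = F.prob {x \<in> space F. x \<le> t}"

lemma H_bounds: "0 \<le> H t" "H t \<le> 1"
  by (simp_all add: H_def)

lemma Le_sets: "{x \<in> space F. x \<le> t} \<in> sets F"
  using borel_F[of "\<lambda>x. x"] by (simp add: borel_measurable_iff_le)

lemma H_borel [measurable]: "H \<in> borel_measurable borel"
proof (intro borel_measurable_mono monoI)
  fix s t :: real assume "s \<le> t"
  then show "H s \<le> H t"
    unfolding H_def using Le_sets by (intro F.finite_measure_mono) auto
qed

lemma prob_highest: "P.prob {v \<in> space P. t < highest n v} = 1 - H t ^ n"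
proof -
  let ?A = "{x \<in> space F. x \<le> t}"
  let ?E = "{v \<in> space P. \<forall>i<n. v i \<in> ?A}"
  have iff: "(\<forall>i<n. v i \<in> ?A) \<longleftrightarrow> \<not> t < highest n v" if v: "v \<in> space P" for v
  proof -
    have "v i \<in> ?A \<longleftrightarrow> v i \<le> t" if "i < n" for i
      using that val_profilesD[of v n a b i] v by (auto simp: space_P space_F)
    then have "(\<forall>i<n. v i \<in> ?A) \<longleftrightarrow> (\<forall>i<n. \<not> t < v i)"
      by (simp only: not_less cong: imp_cong)
    then show ?thesis using less_highest_iff[OF n1, of t v] by blast
  qed
  have E: "{v \<in> space P. t < highest n v} = space P - ?E"
    using iff by blast
  have "?E = {v \<in> space P. \<not> t < highest n v}"
    using iff by blast
  also have "\<dots> \<in> sets P" by measurable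
  finally have "P.prob {v \<in> space P. t < highest n v} = 1 - P.prob ?E"
    unfolding E by (rule P.prob_compl)
  then show ?thesis
    using measure_PiM_same(1)[OF prob_F Le_sets, of n t] by (simp only: H_def)
qed

text \<open>When the highest value exceeds t, it does so either together with the runner-up or
  alone. The latter is the event of exactly one coordinate above t, whose probability is
  subtracted.\<close>

lemma prob_runner_up:
  assumes "a \<le> t"
  shows "P.prob {v \<in> space P. t < runner_up n a v} = 1 - H t ^ n - real n * (1 - H t) * H t ^ (n - 1)"
proof -
  let ?A = "{x \<in> space F. x \<le> t}"
  let ?E = "{v \<in> space P. \<exists>i<n. v i \<notin> ?A \<and> (\<forall>j<n. j \<noteq> i \<longrightarrow> v j \<in> ?A)}"
  let ?R = "{v \<in> space P. t < runner_up n a v}"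
  have in_A: "v i \<in> ?A \<longleftrightarrow> v i \<le> t" if "v \<in> space P" "i < n" for v i
    using that val_profilesD[of v n a b i] by (auto simp: space_P space_F)
  have iff: "v \<in> ?E \<longleftrightarrow> t < highest n v \<and> \<not> t < runner_up n a v" if v: "v \<in> space P" for v
  proof -
    have "v \<in> ?E \<longleftrightarrow> (\<exists>i<n. t < v i \<and> (\<forall>j<n. j \<noteq> i \<longrightarrow> v j \<le> t))"
    proof -
      have "v \<in> ?E \<longleftrightarrow> (\<exists>i<n. v i \<notin> ?A \<and> (\<forall>j<n. j \<noteq> i \<longrightarrow> v j \<in> ?A))"
        using v by simp
      also have "\<dots> \<longleftrightarrow> (\<exists>i<n. \<not> v i \<le> t \<and> (\<forall>j<n. j \<noteq> i \<longrightarrow> v j \<le> t))"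
        using in_A[OF v] by (simp only: cong: conj_cong imp_cong)
      finally show ?thesis by (simp only: not_le)
    qed
    also have "\<dots> \<longleftrightarrow> (\<exists>i<n. t < v i) \<and> \<not> (\<exists>i j. i < j \<and> j < n \<and> t < v i \<and> t < v j)"
    proof (intro iffI conjI notI; elim exE conjE)
      fix i assume i: "i < n" "t < v i" "\<forall>j<n. j \<noteq> i \<longrightarrow> v j \<le> t"
      then show "\<exists>i<n. t < v i" by blast
      fix k j assume "k < j" "j < n" "t < v k" "t < v j"
      then have "k = i" "j = i" using i(3) by (metis not_le order.strict_trans)+
      then show False using \<open>k < j\<close> by simp
    next
      fix i assume ex: "\<not> (\<exists>i j. i < j \<and> j < n \<and> t < v i \<and> t < v j)" and i: "i < n" "t < v i"
      have "v j \<le> t" if "j < n" "j \<noteq> i" for j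
        using ex i that by (metis not_le linorder_neqE_nat)
      then show "\<exists>i<n. t < v i \<and> (\<forall>j<n. j \<noteq> i \<longrightarrow> v j \<le> t)" using i by blast
    qed
    finally show ?thesis
      using less_highest_iff[OF n1, of t v] less_runner_up_iff[OF assms, of n v] by simp
  qed
  have "?E = {v \<in> space P. t < highest n v \<and> \<not> t < runner_up n a v}"
    using iff by blast
  also have "\<dots> \<in> sets P" by measurable
  finally have Es: "?E \<in> sets P" .
  have Rs: "?R \<in> sets P" by measurable
  have le: "v \<in> space P \<Longrightarrow> runner_up n a v \<le> highest n v" for v
    using runner_up_le_highest[OF n1, of a v] val_profilesD(1)[of v n a b] by (simp add: space_P)
  have "?R \<inter> ?E = {}" using iff by blast
  from P.finite_measure_Union[OF Rs Es this]
  have "P.prob (?R \<union> ?E) = P.prob ?R + P.prob ?E" .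
  moreover have "?R \<union> ?E = {v \<in> space P. t < highest n v}"
  proof (intro set_eqI iffI)
    fix v assume "v \<in> ?R \<union> ?E"
    then have "v \<in> space P" "t < highest n v"
      using iff[of v] le[of v] by (blast intro: less_le_trans)+
    then show "v \<in> {v \<in> space P. t < highest n v}" by blast
  next
    fix v assume "v \<in> {v \<in> space P. t < highest n v}"
    then show "v \<in> ?R \<union> ?E" using iff[of v] by blast
  qed
  ultimately have "1 - H t ^ n = P.prob ?R + P.prob ?E"
    by (simp only: prob_highest)
  then show ?thesis
    using measure_PiM_same(2)[OF prob_F Le_sets, of n t] by (simp add: H_def)
qed

end

section \<open>Maximising the regret level by level\<close>

lemma regret_eq_integral:
  assumes "integrable P (\<lambda>v. lam * highest n v - (\<Sum>i<n. snd m v i))"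
  shows "regret lam n m P = ereal (\<integral>v. lam * highest n v - (\<Sum>i<n. snd m v i) \<partial>P)"
proof -
  let ?f = "\<lambda>v. lam * highest n v - (\<Sum>i<n. snd m v i)"
  have fin: "(\<integral>\<^sup>+v. ennreal (?f v) \<partial>P) \<noteq> \<infinity>" "(\<integral>\<^sup>+v. ennreal (- ?f v) \<partial>P) \<noteq> \<infinity>"
    using assms by (simp_all add: real_integrable_def)
  have e: "enn2ereal x = ereal (enn2real x)" if "x \<noteq> \<infinity>" for x
    using that by (cases x) (auto simp: enn2real_def)
  show ?thesis
    unfolding regret_def real_lebesgue_integral_def[OF assms] e[OF fin(1)] e[OF fin(2)] by simp
qed

text \<open>Convexity: the power function at s lies above its tangent at z. In the induction,
  multiplying by s leaves the nonnegative remainder (m + 1) z^m (s - z)^2.\<close>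

lemma power_tangent_le:
  fixes s z :: real
  assumes "0 \<le> s" "0 \<le> z"
  shows "z ^ Suc m + real (Suc m) * z ^ m * (s - z) \<le> s ^ Suc m"
proof (induction m)
  case (Suc m)
  have "s * (z ^ Suc m + real (Suc m) * z ^ m * (s - z)) \<le> s * s ^ Suc m"
    using Suc assms by (intro mult_left_mono) auto
  moreover have "s * (z ^ Suc m + real (Suc m) * z ^ m * (s - z))
     = z ^ Suc (Suc m) + real (Suc (Suc m)) * z ^ Suc m * (s - z) + real (Suc m) * z ^ m * (s - z)\<^sup>2"
    by (simp add: algebra_simps power2_eq_square)
  moreover have "0 \<le> real (Suc m) * z ^ m * (s - z)\<^sup>2"
    using assms by simp
  ultimately show ?case by simp
qed simp

text \<open>
  The regret density at level \<open>t\<close>, as a function of the probability \<open>z\<close> of a value below \<open>t\<close>.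
  The first-order condition in \<open>z\<close> suffices for a global maximum on \<open>[0, \<infinity>)\<close>.
\<close>

definition level_regret :: "nat \<Rightarrow> real \<Rightarrow> real \<Rightarrow> real \<Rightarrow> real" where
  "level_regret n h B z = h * (1 - z ^ n) - B * (1 - z ^ n - real n * (1 - z) * z ^ (n - 1))"

text \<open>As a polynomial in z the function is a constant plus n B z^(n-1) - E z^n. After
  multiplication by n - 1 the first-order condition replaces (n - 1) B by s E, leaving E times n s
  z^(n-1) - (n - 1) z^n, and the tangent inequality bounds the latter by s^n, its value at z = s.
  For n = 1 this multiplication would erase everything; there s E = 0 is used directly.\<close>

lemma level_regret_max:
  assumes n: "1 \<le> n" and z: "0 \<le> z" and s: "0 \<le> s"
    and E: "0 \<le> h + (real n - 1) * B" "(real n - 1) * B = s * (h + (real n - 1) * B)"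
  shows "level_regret n h B z \<le> level_regret n h B s"
proof -
  define E where "E = h + (real n - 1) * B"
  obtain m where m: "n = Suc m" using n by (cases n) auto
  have f: "level_regret n h B z = h - B + (real n * B * z ^ m - E * z ^ n)" for z
    unfolding level_regret_def E_def m by (simp add: algebra_simps)
  show ?thesis
  proof (cases "m = 0")
    case True
    then have "s * E = 0" using E(2) m by (simp add: E_def)
    moreover have "0 \<le> z * E" using z E(1) by (simp add: E_def)
    ultimately have "E * s \<le> E * z" by (simp only: mult.commute[of E])
    then show ?thesis unfolding f using True m by simp
  next
    case False
    have B: "real m * B = s * E" using E(2) by (simp add: E_def m)
    have g: "real m * (real n * B * z ^ m - E * z ^ n) = E * (real n * s * z ^ m - real m * z ^ n)" for z
    proof -
      have "real m * (real n * B * z ^ m - E * z ^ n) = real n * (real m * B) * z ^ m - real m * E * z ^ n"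
        by (simp add: algebra_simps)
      then show ?thesis unfolding B by (simp add: algebra_simps)
    qed
    have "real n * s * z ^ m - real m * z ^ n \<le> s ^ n"
      using power_tangent_le[OF s z, of m] by (simp add: m algebra_simps)
    also have "s ^ n = real n * s * s ^ m - real m * s ^ n"
      by (simp add: m algebra_simps)
    finally have "E * (real n * s * z ^ m - real m * z ^ n) \<le> E * (real n * s * s ^ m - real m * s ^ n)"
      using E(1) unfolding E_def by (intro mult_left_mono)
    then have "real m * (real n * B * z ^ m - E * z ^ n) \<le> real m * (real n * B * s ^ m - E * s ^ n)"
      unfolding g .
    then show ?thesis unfolding f using False by simp
  qed
qed

context hybrid_density
begin

lemma
  assumes z: "z \<in> borel_measurable borel" "\<And>t. a < t \<Longrightarrow> t < b \<Longrightarrow> 0 \<le> z t \<and> z t \<le> 1"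
  shows integrable_level_first: "integrable (Ioo_lborel a b) (\<lambda>t. (lam - rate_first t) * (1 - z t ^ n))"
    and integrable_level_second: "integrable (Ioo_lborel a b)
      (\<lambda>t. rate_second t * (1 - z t ^ n - real n * (1 - z t) * z t ^ (n - 1)))"
    and integrable_level_regret: "integrable (Ioo_lborel a b)
      (\<lambda>t. level_regret n (lam - rate_first t) (rate_second t) (z t))"
proof -
  let ?L = "Ioo_lborel a b"
  note [measurable] = z(1)
  have m: "(\<lambda>t. 1 - z t ^ n) \<in> borel_measurable ?L"
    "(\<lambda>t. 1 - z t ^ n - real n * (1 - z t) * z t ^ (n - 1)) \<in> borel_measurable ?L"
    by (intro borel_measurable_Ioo_lborel; measurable)+
  have c: "integrable ?L (\<lambda>_. lam)"
    by (rule finite_measure.integrable_const[OF finite_measure_Ioo_lborel])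
  have b1: "0 \<le> z t ^ k \<and> z t ^ k \<le> 1" if "t \<in> space ?L" for t k
    using that z(2)[of t] by (auto simp: space_restrict_space power_le_one)
  have b2: "\<bar>1 - z t ^ n\<bar> \<le> 1" "\<bar>1 - z t ^ n - real n * (1 - z t) * z t ^ (n - 1)\<bar> \<le> 1 + real n"
    if t: "t \<in> space ?L" for t
  proof -
    have "0 \<le> (1 - z t) * z t ^ (n - 1) \<and> (1 - z t) * z t ^ (n - 1) \<le> 1"
      using b1[OF t, of 1] b1[OF t, of "n - 1"] by (simp add: mult_le_one)
    then have "0 \<le> real n * ((1 - z t) * z t ^ (n - 1))" "real n * ((1 - z t) * z t ^ (n - 1)) \<le> real n * 1"
      by (simp, intro mult_left_mono) auto
    then show "\<bar>1 - z t ^ n\<bar> \<le> 1" "\<bar>1 - z t ^ n - real n * (1 - z t) * z t ^ (n - 1)\<bar> \<le> 1 + real n"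
      using b1[OF t, of n] by (simp_all add: mult.assoc abs_le_iff)
  qed
  have "integrable ?L (\<lambda>t. (1 - z t ^ n) * (lam - rate_first t))"
    using integrable_rate c by (intro integrable_mult_bounded[OF _ m(1) b2(1)]) auto
  then show 1: "integrable ?L (\<lambda>t. (lam - rate_first t) * (1 - z t ^ n))"
    by (simp only: mult.commute)
  have "integrable ?L (\<lambda>t. (1 - z t ^ n - real n * (1 - z t) * z t ^ (n - 1)) * rate_second t)"
    using integrable_rate by (intro integrable_mult_bounded[OF _ m(2) b2(2)]) auto
  then show 2: "integrable ?L (\<lambda>t. rate_second t * (1 - z t ^ n - real n * (1 - z t) * z t ^ (n - 1)))"
    by (simp only: mult.commute[of "rate_second _"])
  show "integrable ?L (\<lambda>t. level_regret n (lam - rate_first t) (rate_second t) (z t))"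
    unfolding level_regret_def using 1 2 by (rule Bochner_Integration.integrable_diff)
qed

text \<open>The value distribution enters only through its cdf, one level at a time. The term
  \<open>a * (1 - cdf D vs)\<close> is what pooling collects even from the lowest profile.\<close>

lemma regret_hybrid_eq:
  assumes F: "prob_space F" "sets F = sets (restrict_space borel {a..b})"
  shows "regret lam n (random_mechanism D (hybrid n a vs)) (Pi\<^sub>M {..<n} (\<lambda>_. F))
    = ereal (lam * a - a * (1 - cdf D vs)
        + (\<integral>t. level_regret n (lam - rate_first t) (rate_second t) (iid_values.H F t) \<partial>Ioo_lborel a b))"
proof -
  interpret V: iid_values F n a b by (rule iid_values.intro[OF F n1])
  let ?L = "Ioo_lborel a b" and ?P = "Pi\<^sub>M {..<n} (\<lambda>_. F)"
  let ?m = "random_mechanism D (hybrid n a vs)"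
  have c: "integrable ?L (\<lambda>_. lam)"
    by (rule finite_measure.integrable_const[OF finite_measure_Ioo_lborel])
  have i1: "integrable ?L (\<lambda>t. lam - rate_first t)" using integrable_rate c by simp
  note h = V.highest_borel V.runner_up_borel
  note E1 = V.P.integrable_layers[OF h(1) i1] V.P.expectation_layers[OF h(1) i1]
  note E2 = V.P.integrable_layers[OF h(2) integrable_rate(2)] V.P.expectation_layers[OF h(2) integrable_rate(2)]
  have eq: "lam * highest n v - (\<Sum>i<n. snd ?m v i)
      = lam * a - a * (1 - cdf D vs)
        + (\<integral>t. (if t < highest n v then lam - rate_first t else 0) \<partial>?L)
        - (\<integral>t. (if t < runner_up n a v then rate_second t else 0) \<partial>?L)" if v: "v \<in> space ?P" for v
  proof -
    have v': "v \<in> val_profiles n a b" using v by (simp add: V.space_P)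
    obtain i where i: "i < n" "v i = highest n v" using highest_attained[OF n1] by blast
    have y: "a \<le> highest n v" "highest n v \<le> b" using val_profilesD[OF v' i(1)] i by auto
    have m: "(\<lambda>t. if t < highest n v then 1 else 0 :: real) \<in> borel_measurable ?L"
      by (rule borel_measurable_Ioo_lborel) measurable
    have "integrable ?L (\<lambda>t. (if t < highest n v then 1 else 0) * lam)"
      "integrable ?L (\<lambda>t. (if t < highest n v then 1 else 0) * rate_first t)"
      by (rule integrable_mult_bounded[OF c m, of 1], simp)
        (rule integrable_mult_bounded[OF integrable_rate(1) m, of 1], simp)
    then have "(\<integral>t. (if t < highest n v then 1 else 0) * lam - (if t < highest n v then 1 else 0) * rate_first t \<partial>?L)
       = (\<integral>t. (if t < highest n v then 1 else 0) * lam \<partial>?L) - (\<integral>t. (if t < highest n v then 1 else 0) * rate_first t \<partial>?L)"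
      by simp
    also have "(\<integral>t. (if t < highest n v then 1 else 0) * lam \<partial>?L) = lam * (highest n v - a)"
      using integral_lower_layer[OF y] by simp
    also have "(\<integral>t. (if t < highest n v then 1 else 0) * rate_first t \<partial>?L)
       = (\<integral>t. (if t < highest n v then rate_first t else 0) \<partial>?L)"
      by (intro Bochner_Integration.integral_cong) auto
    also have "(\<integral>t. (if t < highest n v then 1 else 0) * lam - (if t < highest n v then 1 else 0) * rate_first t \<partial>?L)
       = (\<integral>t. (if t < highest n v then lam - rate_first t else 0) \<partial>?L)"
      by (intro Bochner_Integration.integral_cong) auto
    finally show ?thesis
      unfolding total_payment[OF v'] by (simp add: algebra_simps)
  qed
  have int: "integrable ?P (\<lambda>v. lam * highest n v - (\<Sum>i<n. snd ?m v i))"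
    using E1(1) E2(1) by (subst Bochner_Integration.integrable_cong[OF refl eq]) auto
  have "(\<integral>v. lam * highest n v - (\<Sum>i<n. snd ?m v i) \<partial>?P)
     = lam * a - a * (1 - cdf D vs)
       + (\<integral>t. (lam - rate_first t) * V.P.prob {v\<in>space ?P. t < highest n v} \<partial>?L)
       - (\<integral>t. rate_second t * V.P.prob {v\<in>space ?P. t < runner_up n a v} \<partial>?L)"
    using E1 E2 V.P.prob_space by (subst Bochner_Integration.integral_cong[OF refl eq]) auto
  also have "(\<integral>t. (lam - rate_first t) * V.P.prob {v\<in>space ?P. t < highest n v} \<partial>?L)
      = (\<integral>t. (lam - rate_first t) * (1 - V.H t ^ n) \<partial>?L)"
    by (simp add: V.prob_highest)
  also have "(\<integral>t. rate_second t * V.P.prob {v\<in>space ?P. t < runner_up n a v} \<partial>?L)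
      = (\<integral>t. rate_second t * (1 - V.H t ^ n - real n * (1 - V.H t) * V.H t ^ (n - 1)) \<partial>?L)"
    by (intro Bochner_Integration.integral_cong) (auto simp: V.prob_runner_up space_restrict_space)
  also have "lam * a - a * (1 - cdf D vs) + (\<integral>t. (lam - rate_first t) * (1 - V.H t ^ n) \<partial>?L)
      - (\<integral>t. rate_second t * (1 - V.H t ^ n - real n * (1 - V.H t) * V.H t ^ (n - 1)) \<partial>?L)
     = lam * a - a * (1 - cdf D vs)
      + (\<integral>t. level_regret n (lam - rate_first t) (rate_second t) (V.H t) \<partial>?L)"
  proof -
    have "integrable ?L (\<lambda>t. (lam - rate_first t) * (1 - V.H t ^ n))"
      by (rule integrable_level_first) (use V.H_bounds V.H_borel in auto)
    moreover have "integrable ?L (\<lambda>t. rate_second t * (1 - V.H t ^ n - real n * (1 - V.H t) * V.H t ^ (n - 1)))"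
      by (rule integrable_level_second) (use V.H_bounds V.H_borel in auto)
    ultimately show ?thesis unfolding level_regret_def by simp
  qed
  finally show ?thesis unfolding regret_eq_integral[OF int] by simp
qed

lemma regret_hybrid_le:
  assumes P: "P \<in> F_iid n a b" and zs: "zs \<in> borel_measurable borel"
    "\<And>t. a < t \<Longrightarrow> t < b \<Longrightarrow> 0 \<le> zs t \<and> zs t \<le> 1"
    and foc: "\<And>t. t \<in> {a<..<b} - S \<Longrightarrow> 0 \<le> lam - rate_first t + (real n - 1) * rate_second t"
      "\<And>t. t \<in> {a<..<b} - S \<Longrightarrow>
        (real n - 1) * rate_second t = zs t * (lam - rate_first t + (real n - 1) * rate_second t)"
  shows "regret lam n (random_mechanism D (hybrid n a vs)) P
    \<le> ereal (lam * a - a * (1 - cdf D vs)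
        + (\<integral>t. level_regret n (lam - rate_first t) (rate_second t) (zs t) \<partial>Ioo_lborel a b))"
proof -
  obtain F where F: "P = Pi\<^sub>M {..<n} (\<lambda>_. F)" "prob_space F" "sets F = sets (restrict_space borel {a..b})"
    using P by (auto simp: F_iid_def)
  interpret V: iid_values F n a b by (rule iid_values.intro[OF F(2,3) n1])
  have "AE t in Ioo_lborel a b. t \<notin> S"
  proof -
    have "AE t in lborel. t \<notin> S"
      using finS by (intro AE_not_in countable_imp_null_set_lborel countable_finite)
    then show ?thesis by (subst AE_restrict_space_iff) auto
  qed
  then have "AE t in Ioo_lborel a b. level_regret n (lam - rate_first t) (rate_second t) (V.H t)
      \<le> level_regret n (lam - rate_first t) (rate_second t) (zs t)"
  proof (rule AE_mp[OF _ AE_I2], intro impI)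
    fix t assume "t \<in> space (Ioo_lborel a b)" and t: "t \<notin> S"
    then have t': "t \<in> {a<..<b}" by (simp add: space_restrict_space)
    then have "t \<in> {a<..<b} - S" "0 \<le> zs t" using t zs(2) by auto
    then show "level_regret n (lam - rate_first t) (rate_second t) (V.H t)
      \<le> level_regret n (lam - rate_first t) (rate_second t) (zs t)"
      using foc[of t] V.H_bounds(1)[of t] n1 by (intro level_regret_max) auto
  qed
  then have "(\<integral>t. level_regret n (lam - rate_first t) (rate_second t) (V.H t) \<partial>Ioo_lborel a b)
     \<le> (\<integral>t. level_regret n (lam - rate_first t) (rate_second t) (zs t) \<partial>Ioo_lborel a b)"
    using zs V.H_bounds V.H_borel by (intro integral_mono_AE integrable_level_regret) auto
  then show ?thesis
    unfolding F(1) regret_hybrid_eq[OF F(2,3)] by simp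
qed

end

section \<open>The worst-case distribution\<close>

text \<open>On a grid of N + 1 equal steps of length d the bounds telescope to d (X y - X c) \<le>
  d, and d tends to 0. This replaces differentiation of f.\<close>

lemma le_of_small_increments:
  fixes f X :: "real \<Rightarrow> real"
  assumes cy: "c \<le> y" and X: "\<And>u. c \<le> u \<Longrightarrow> u \<le> y \<Longrightarrow> 0 \<le> X u \<and> X u \<le> 1"
    and inc: "\<And>u w. c \<le> u \<Longrightarrow> u \<le> w \<Longrightarrow> w \<le> y \<Longrightarrow> f w - f u \<le> (w - u) * (X w - X u)"
  shows "f y \<le> f c"
proof -
  have bound: "f y - f c \<le> (y - c) / real (Suc N)" for N
  proof -
    define d where "d = (y - c) / real (Suc N)"
    have d: "0 \<le> d" "real (Suc N) * d = y - c" using cy by (auto simp: d_def)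
    have kd: "c + real k * d \<le> y" if "k \<le> Suc N" for k
    proof -
      have "real k * d \<le> real (Suc N) * d" using that d by (intro mult_right_mono) auto
      then show ?thesis using d by simp
    qed
    have "f (c + real k * d) - f c \<le> d * (X (c + real k * d) - X c)" if "k \<le> Suc N" for k
      using that
    proof (induction k)
      case (Suc k)
      have "c \<le> c + real k * d" "c + real k * d \<le> c + real (Suc k) * d"
        using d by (auto simp: algebra_simps)
      from inc[OF this kd[OF Suc.prems]]
      have "f (c + real (Suc k) * d) - f (c + real k * d)
          \<le> d * (X (c + real (Suc k) * d) - X (c + real k * d))"
        by (simp add: algebra_simps)
      moreover have "f (c + real k * d) - f c \<le> d * (X (c + real k * d) - X c)"
        using Suc by simp
      ultimately show ?case by (simp add: right_diff_distrib)
    qed simp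
    from this[of "Suc N"] have "f y - f c \<le> d * (X y - X c)"
      using d by simp
    also have "\<dots> \<le> d * 1" using X[of y] X[of c] cy d by (intro mult_left_mono) auto
    finally show ?thesis by (simp add: d_def)
  qed
  have "(\<lambda>N. (y - c) / real (Suc N)) \<longlonglongrightarrow> 0"
    using LIMSEQ_Suc[OF lim_const_over_n[of "y - c"]] by simp
  then have "f y - f c \<le> 0"
    by (rule LIMSEQ_le_const) (use bound in auto)
  then show ?thesis by simp
qed

text \<open>Incentive compatibility says that X w is a subgradient of U at w. Hence X is increasing,
  its integral K gains at most (w - u) X w on [u, w], and U gains at least (w - u) X u. So K - U has
  the small increments of the preceding lemma.\<close>

lemma envelope_le:
  fixes X U :: "real \<Rightarrow> real"
  assumes cb: "c < b" and y: "c \<le> y" "y \<le> b"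
    and Xm: "X \<in> borel_measurable borel" and X: "\<And>u. c \<le> u \<Longrightarrow> u \<le> b \<Longrightarrow> 0 \<le> X u \<and> X u \<le> 1"
    and IC: "\<And>u w. c \<le> u \<Longrightarrow> u \<le> b \<Longrightarrow> c \<le> w \<Longrightarrow> w \<le> b \<Longrightarrow> U w + (u - w) * X w \<le> U u"
  shows "(\<integral>t. (if t < y then X t else 0) \<partial>Ioo_lborel c b) \<le> U y - U c"
proof -
  let ?L = "Ioo_lborel c b"
  define K where "K y = (\<integral>t. (if t < y then X t else 0) \<partial>?L)" for y
  note [measurable] = Xm
  have iX: "integrable ?L (\<lambda>t. if t < u then X t else 0)" for u
  proof -
    have "(\<lambda>t. if t < u then X t else 0) \<in> borel_measurable borel" by measurable
    from integrable_Ioo_lborel_bounded[OF borel_measurable_Ioo_lborel[OF this], of c b 1]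
    show ?thesis using X by auto
  qed
  have i1: "integrable ?L (\<lambda>t. if t < u then 1 else 0 :: real)" for u
  proof -
    have "(\<lambda>t. if t < u then 1 else 0 :: real) \<in> borel_measurable borel" by measurable
    from integrable_Ioo_lborel_bounded[OF borel_measurable_Ioo_lborel[OF this], of c b 1]
    show ?thesis by auto
  qed
  have mono: "X u \<le> X w" if "c \<le> u" "u \<le> w" "w \<le> b" for u w
  proof (cases "u = w")
    case False
    have "(w - u) * X u \<le> (w - u) * X w"
      using IC[of u w] IC[of w u] that by (simp add: algebra_simps)
    then show ?thesis using that False by simp
  qed simp
  have K: "K w - K u \<le> (w - u) * X w" if "c \<le> u" "u \<le> w" "w \<le> b" for u w
  proof -
    have "K w - K u = (\<integral>t. (if t < w then X t else 0) - (if t < u then X t else 0) \<partial>?L)"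
      unfolding K_def using iX by simp
    also have "\<dots> \<le> (\<integral>t. X w * ((if t < w then 1 else 0) - (if t < u then 1 else 0)) \<partial>?L)"
      using that mono[of _ w]
      by (intro integral_mono Bochner_Integration.integrable_diff iX i1 integrable_mult_right)
        (auto simp: space_restrict_space)
    also have "\<dots> = (w - u) * X w"
      using i1 that integral_lower_layer[of c w b] integral_lower_layer[of c u b] by simp
    finally show ?thesis .
  qed
  have "K y - U y \<le> K c - U c"
  proof (rule le_of_small_increments[OF y(1), where X=X])
    fix u assume "c \<le> u" "u \<le> y" then show "0 \<le> X u \<and> X u \<le> 1" using X y by simp
  next
    fix u w assume "c \<le> u" "u \<le> w" "w \<le> y"
    then show "K w - U w - (K u - U u) \<le> (w - u) * (X w - X u)"
      using K[of u w] IC[of w u] y by (simp add: algebra_simps)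
  qed
  moreover have "K c = 0"
  proof -
    have "K c = (\<integral>t. 0 \<partial>?L)"
      unfolding K_def by (intro Bochner_Integration.integral_cong) (auto simp: space_restrict_space)
    then show ?thesis by simp
  qed
  ultimately show ?thesis by (simp add: K_def)
qed

text \<open>
  The value distribution with constant virtual value \<open>\<phi>\<close> on \<open>[c, b)\<close> and an atom at \<open>b\<close>.
\<close>

definition const_virtual_cdf :: "real \<Rightarrow> real \<Rightarrow> real \<Rightarrow> real \<Rightarrow> real" where
  "const_virtual_cdf b c \<phi> t = (if t < c then 0 else if t < b then (t - c) / (t - \<phi>) else 1)"

locale const_virtual =
  fixes n :: nat and a b c \<phi> :: real
  assumes n1: "1 \<le> n" and ac: "a \<le> c" and cb: "c < b" and \<phi>0: "0 \<le> \<phi>" and \<phi>c: "\<phi> < c"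
begin

abbreviation Fs where "Fs \<equiv> const_virtual_cdf b c \<phi>"

lemma quot_bounds: "c \<le> t \<Longrightarrow> 0 \<le> (t - c) / (t - \<phi>) \<and> (t - c) / (t - \<phi>) < 1"
  using \<phi>c by (auto simp: divide_simps)

lemma quot_mono:
  assumes "c \<le> s" "s \<le> t"
  shows "(s - c) / (s - \<phi>) \<le> (t - c) / (t - \<phi>)"
proof -
  have "(c - \<phi>) / (t - \<phi>) \<le> (c - \<phi>) / (s - \<phi>)"
    using assms \<phi>c by (intro divide_left_mono) auto
  moreover have "(u - c) / (u - \<phi>) = 1 - (c - \<phi>) / (u - \<phi>)" if "c \<le> u" for u
    using that \<phi>c by (simp add: field_simps)
  ultimately show ?thesis using assms by simp
qed

lemma quot_continuous: "continuous_on {c..} (\<lambda>t. (t - c) / (t - \<phi>))"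
  using \<phi>c by (intro continuous_intros) auto

lemma quot_deriv:
  assumes "c \<le> t"
  shows "((\<lambda>t. (t - c) / (t - \<phi>)) has_real_derivative (c - \<phi>) / (t - \<phi>)\<^sup>2) (at t)"
  using assms \<phi>c by (auto intro!: derivative_eq_intros simp: field_simps power2_eq_square)

lemma Fs_mono: "s \<le> t \<Longrightarrow> Fs s \<le> Fs t"
  using quot_bounds[of s] quot_bounds[of t] quot_mono[of s t]
  by (auto simp: const_virtual_cdf_def)

lemma Fs_bounds: "0 \<le> Fs t" "Fs t \<le> 1"
  using quot_bounds[of t] by (auto simp: const_virtual_cdf_def)

lemma Fs_borel [measurable]: "Fs \<in> borel_measurable borel"
  by (intro borel_measurable_mono monoI Fs_mono)

definition M :: "real measure" where "M = interval_measure Fs"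

lemma real_distribution_M: "real_distribution M" and cdf_M: "cdf M = Fs"
  unfolding M_def const_virtual_cdf_def
  by (intro real_distribution_cutoff cdf_cutoff cb quot_continuous;
      use quot_bounds quot_mono in \<open>auto intro: less_imp_le\<close>)+

sublocale M: real_distribution M
  by (rule real_distribution_M)

text \<open>\<open>M\<close> lives on the whole line, where cdfs are available, whereas members of
  \<open>F_iid\<close> are built from measures on [a, b]. Almost all of \<open>M\<close> lies in (c,
  b], so the restriction loses no mass.\<close>

definition F :: "real measure" where "F = restrict_space M {a..b}"

lemma AE_M: "AE y in M. c < y \<and> y \<le> b"
proof -
  have "measure M {..c} = 0" "measure M {..b} = 1"
    using cdf_M cb by (auto simp: cdf_def2[symmetric] const_virtual_cdf_def)
  then have "{..c} \<in> null_sets M" "AE y in M. y \<in> {..b}"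
    using M.AE_prob_1[of "{..b}"] by (simp_all add: null_sets_def M.emeasure_eq_measure)
  from AE_not_in[OF this(1)] this(2) show ?thesis by eventually_elim auto
qed

lemma sets_F: "sets F = sets (restrict_space borel {a..b})"
  unfolding F_def by (intro sets_restrict_space_cong) simp

lemma measure_M_Icc: "A \<in> sets borel \<Longrightarrow> measure M (A \<inter> {a..b}) = measure M A"
proof (rule M.finite_measure_eq_AE)
  show "AE x in M. (x \<in> A \<inter> {a..b}) = (x \<in> A)"
    using AE_M by eventually_elim (use ac in auto)
qed auto

lemma measure_F: "A \<in> sets borel \<Longrightarrow> measure F (A \<inter> {a..b}) = measure M A"
  unfolding F_def by (subst measure_restrict_space) (auto simp: measure_M_Icc)

lemma space_F: "space F = {a..b}"
  by (simp add: F_def space_restrict_space)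

lemma prob_F: "prob_space F"
proof
  have "emeasure F (space F) = emeasure M {a..b}"
    unfolding space_F unfolding F_def by (subst emeasure_restrict_space) auto
  also have "\<dots> = 1"
    using measure_M_Icc[of UNIV] M.prob_space by (simp add: M.emeasure_eq_measure)
  finally show "emeasure F (space F) = 1" .
qed

sublocale V: iid_values F n a b
  by (rule iid_values.intro[OF prob_F sets_F n1])

lemma H_eq: "V.H t = Fs t"
proof -
  have "{x \<in> space F. x \<le> t} = {..t} \<inter> {a..b}" by (auto simp: space_F)
  then show ?thesis
    unfolding V.H_def using measure_F[of "{..t}"] by (simp add: cdf_def2[symmetric] cdf_M)
qed

lemma prob_below_top: "measure F {y \<in> space F. y < b} = (b - c) / (b - \<phi>)"
proof -
  have "{y \<in> space F. y < b} = {..<b} \<inter> {a..b}" by (auto simp: space_F)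
  then have *: "measure F {y \<in> space F. y < b} = measure M {..<b}"
    using measure_F[of "{..<b}"] by simp
  have "((\<lambda>t. (t - c) / (t - \<phi>)) \<longlongrightarrow> (b - c) / (b - \<phi>)) (at_left b)"
    using cb \<phi>c by (intro tendsto_intros) auto
  then have "(cdf M \<longlongrightarrow> (b - c) / (b - \<phi>)) (at_left b)"
    by (rule Lim_transform_eventually)
      (use cb in \<open>auto simp: cdf_M const_virtual_cdf_def eventually_at_left_field intro!: exI[of _ c]\<close>)
  then show ?thesis
    unfolding * using tendsto_unique[OF _ M.cdf_at_left[of b]] by force
qed

text \<open>Serving the atom b leaves no rent to higher values, because there are none; so its
  virtual value is b itself.\<close>

definition virtual_value :: "real \<Rightarrow> real" where
  "virtual_value y = (if y < b then \<phi> else b)"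

text \<open>Since p = y X - U, the claim is that E U is at least the expectation of (y - \<phi>) X
  over y < b. The envelope bounds U y below by the integral of X over (c, y); exchanging integrals
  gives X t the weight P(y > t) = (c - \<phi>) / (t - \<phi>), which is t - \<phi> times the density
  of \<open>M\<close>. That identity is what constant virtual value means.\<close>

lemma virtual_bound:
  fixes X p :: "real \<Rightarrow> real"
  assumes Xm: "X \<in> borel_measurable F" and pm: "p \<in> borel_measurable F"
    and X: "\<And>u. u \<in> {a..b} \<Longrightarrow> 0 \<le> X u \<and> X u \<le> 1"
    and IR: "\<And>u. u \<in> {a..b} \<Longrightarrow> 0 \<le> u * X u - p u"
    and IC: "\<And>u w. u \<in> {a..b} \<Longrightarrow> w \<in> {a..b} \<Longrightarrow> u * X w - p w \<le> u * X u - p u"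
  shows "(\<integral>y. p y - X y * virtual_value y \<partial>F) \<le> 0"
proof -
  let ?L = "Ioo_lborel c b"
  define Y where "Y = (\<lambda>u. X u * indicator {a..b} u)"
  define q where "q = (\<lambda>u. p u * indicator {a..b} u)"
  define U where "U u = u * Y u - q u" for u
  have meq: "borel_measurable F = borel_measurable (restrict_space borel {a..b})"
    by (intro measurable_cong_sets sets_F refl)
  have Ym [measurable]: "Y \<in> borel_measurable borel" and qm [measurable]: "q \<in> borel_measurable borel"
    using Xm pm unfolding meq Y_def q_def
    by (simp_all add: borel_measurable_restrict_space_iff mult.commute)
  have Yb: "0 \<le> Y u \<and> Y u \<le> 1" for u using X[of u] by (auto simp: Y_def indicator_def)
  have env: "(\<integral>t. (if t < y then Y t else 0) \<partial>?L) \<le> U y" if y: "c \<le> y" "y \<le> b" for y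
  proof -
    have "(\<integral>t. (if t < y then Y t else 0) \<partial>?L) \<le> U y - U c"
    proof (rule envelope_le[OF cb y Ym])
      fix u w assume "c \<le> u" "u \<le> b" "c \<le> w" "w \<le> b"
      then show "U w + (u - w) * Y w \<le> U u"
        using IC[of u w] ac by (simp add: U_def Y_def q_def algebra_simps)
    qed (use Yb in simp)
    moreover have "0 \<le> U c" using IR[of c] ac cb by (simp add: U_def Y_def q_def)
    ultimately show ?thesis by simp
  qed
  have U_mono: "U u \<le> U w" if "c \<le> u" "u \<le> w" "w \<le> b" for u w
  proof -
    have "U u + (w - u) * Y u \<le> U w"
      using IC[of w u] that ac by (simp add: U_def Y_def q_def algebra_simps)
    moreover have "0 \<le> (w - u) * Y u" using that Yb by simp
    ultimately show ?thesis by simp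
  qed
  have q_bound: "\<bar>q u\<bar> \<le> U b + b" if u: "c < u" "u \<le> b" for u
  proof -
    have "0 \<le> u * Y u" "u * Y u \<le> b * 1"
      using u \<phi>0 \<phi>c cb Yb[of u] mult_mono[of u b "Y u" 1] by auto
    moreover have "0 \<le> U u" using IR[of u] u ac by (simp add: U_def Y_def q_def)
    moreover have "U u \<le> U b" using U_mono[of u b] u by simp
    ultimately show ?thesis unfolding U_def by linarith
  qed
  have U_bound: "\<bar>U u\<bar> \<le> U b" if u: "c < u" "u \<le> b" for u
    using U_mono[of u b] IR[of u] u ac by (simp add: U_def Y_def q_def)
  have [measurable]: "U \<in> borel_measurable borel" unfolding U_def by measurable
  have iY: "integrable ?L Y"
    using Yb by (intro integrable_Ioo_lborel_bounded[where B=1] borel_measurable_Ioo_lborel) auto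
  have id: "(\<lambda>y. y) \<in> borel_measurable M" by simp
  note E = M.integrable_layers[OF id iY] M.expectation_layers[OF id iY]
  have probM: "M.prob {y \<in> space M. t < y} = (c - \<phi>) / (t - \<phi>)" if "t \<in> space ?L" for t
  proof -
    have t: "c < t" "t < b" using that by (auto simp: space_restrict_space)
    have "{y \<in> space M. t < y} = space M - {..t}" by auto
    then have "M.prob {y \<in> space M. t < y} = 1 - Fs t"
      using M.prob_compl[of "{..t}"] by (simp add: cdf_def2[symmetric] cdf_M)
    then show ?thesis using t \<phi>c by (simp add: const_virtual_cdf_def field_simps)
  qed
  have iU: "integrable M U"
  proof (rule M.integrable_const_bound[where B="U b"])
    show "AE y in M. norm (U y) \<le> U b"
      using AE_M by eventually_elim (use U_bound in auto)
  qed simp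
  have "(\<integral>y. indicator {c<..<b} y * ((y - \<phi>) * Y y) \<partial>M)
      = (\<integral>t. ((t - \<phi>) * Y t) * ((c - \<phi>) / (t - \<phi>)\<^sup>2) \<partial>?L)"
  proof (rule integral_cdf_deriv[OF M.real_distribution_axioms cb])
    show "continuous_on {c..b} (\<lambda>t. (t - c) / (t - \<phi>))"
      by (rule continuous_on_subset[OF quot_continuous]) auto
    show "finite {}" by simp
    show "\<And>t. t \<in> {c..<b} \<Longrightarrow> cdf M t = (t - c) / (t - \<phi>)"
      by (simp add: cdf_M const_virtual_cdf_def)
    show "\<And>t. t \<in> {c<..<b} - {} \<Longrightarrow>
        ((\<lambda>t. (t - c) / (t - \<phi>)) has_real_derivative (c - \<phi>) / (t - \<phi>)\<^sup>2) (at t)"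
      by (rule quot_deriv) simp
    show "\<And>t. t \<in> {c<..<b} \<Longrightarrow> 0 \<le> (c - \<phi>) / (t - \<phi>)\<^sup>2" using \<phi>c by simp
  qed measurable
  also have "\<dots> = (\<integral>t. Y t * ((c - \<phi>) / (t - \<phi>)) \<partial>?L)"
    using \<phi>c by (intro Bochner_Integration.integral_cong)
      (auto simp: space_restrict_space power2_eq_square divide_simps)
  also have "\<dots> = (\<integral>t. Y t * M.prob {y \<in> space M. t < y} \<partial>?L)"
    by (intro Bochner_Integration.integral_cong) (simp_all only: probM)
  also have "\<dots> = (\<integral>y. (\<integral>t. (if t < y then Y t else 0) \<partial>?L) \<partial>M)"
    using E(2) by simp
  also have "\<dots> \<le> (\<integral>y. U y \<partial>M)"
  proof (intro integral_mono_AE E(1) iU)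
    show "AE y in M. (\<integral>t. (if t < y then Y t else 0) \<partial>?L) \<le> U y"
      using AE_M by eventually_elim (use env in auto)
  qed
  finally have main: "(\<integral>y. indicator {c<..<b} y * ((y - \<phi>) * Y y) \<partial>M) \<le> (\<integral>y. U y \<partial>M)" .
  have iV: "integrable M (\<lambda>y. indicator {c<..<b} y * ((y - \<phi>) * Y y))"
  proof (rule M.integrable_const_bound[where B=b])
    show "AE y in M. norm (indicator {c<..<b} y * ((y - \<phi>) * Y y)) \<le> b"
    proof (rule AE_I2)
      fix y
      have "\<bar>(y - \<phi>) * Y y\<bar> \<le> b * 1" if "c < y" "y < b"
        using that \<phi>0 \<phi>c Yb[of y] unfolding abs_mult by (intro mult_mono) auto
      then show "norm (indicator {c<..<b} y * ((y - \<phi>) * Y y)) \<le> b"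
        using \<phi>0 \<phi>c cb by (auto simp: indicator_def)
    qed
  qed measurable
  have "(\<integral>y. p y - X y * virtual_value y \<partial>F)
     = (\<integral>y. indicator {a..b} y *\<^sub>R (p y - X y * virtual_value y) \<partial>M)"
    unfolding F_def by (subst integral_restrict_space) auto
  also have "\<dots> = (\<integral>y. indicator {c<..<b} y * ((y - \<phi>) * Y y) - U y \<partial>M)"
  proof (rule integral_cong_AE)
    have "(\<lambda>y. q y - Y y * virtual_value y) \<in> borel_measurable borel"
      unfolding virtual_value_def by measurable
    moreover have "(\<lambda>y. indicator {a..b} y *\<^sub>R (p y - X y * virtual_value y)) = (\<lambda>y. q y - Y y * virtual_value y)"
      by (auto simp: q_def Y_def indicator_def fun_eq_iff)
    ultimately show "(\<lambda>y. indicator {a..b} y *\<^sub>R (p y - X y * virtual_value y)) \<in> borel_measurable M"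
      by simp
    show "(\<lambda>y. indicator {c<..<b} y * ((y - \<phi>) * Y y) - U y) \<in> borel_measurable M" by simp
    show "AE y in M. indicator {a..b} y *\<^sub>R (p y - X y * virtual_value y)
        = indicator {c<..<b} y * ((y - \<phi>) * Y y) - U y"
      using AE_M
    proof eventually_elim
      case (elim y)
      then show ?case using ac
        by (cases "y < b") (auto simp: U_def Y_def q_def virtual_value_def algebra_simps)
    qed
  qed
  also have "\<dots> = (\<integral>y. indicator {c<..<b} y * ((y - \<phi>) * Y y) \<partial>M) - (\<integral>y. U y \<partial>M)"
    using iV iU by simp
  finally show ?thesis using main by simp
qed

section \<open>Revenue bound for arbitrary mechanisms\<close>

lemma virtual_value_nonneg: "0 \<le> virtual_value y"
  using \<phi>0 \<phi>c cb by (simp add: virtual_value_def)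

lemma virtual_value_le: "virtual_value y \<le> b"
  using \<phi>c cb by (simp add: virtual_value_def)

lemma virtual_value_borel [measurable]: "virtual_value \<in> borel_measurable borel"
  unfolding virtual_value_def[abs_def] by measurable

lemma expected_highest:
  shows "integrable V.P (highest n)"
    "(\<integral>v. highest n v \<partial>V.P) = a + (\<integral>t. 1 - Fs t ^ n \<partial>Ioo_lborel a b)"
proof -
  let ?L = "Ioo_lborel a b"
  note h = V.highest_borel
  have one: "integrable ?L (\<lambda>_. 1 :: real)"
    by (rule finite_measure.integrable_const[OF finite_measure_Ioo_lborel])
  note E = V.P.integrable_layers[OF h one] V.P.expectation_layers[OF h one]
  have eq: "highest n v = a + (\<integral>t. (if t < highest n v then 1 else 0) \<partial>?L)" if v: "v \<in> space V.P" for v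
  proof -
    have v': "v \<in> val_profiles n a b" using v by (simp add: V.space_P)
    obtain i where "i < n" "v i = highest n v" using highest_attained[OF n1] by blast
    then have "a \<le> highest n v" "highest n v \<le> b" using val_profilesD[OF v', of i] by auto
    then show ?thesis using integral_lower_layer[of a "highest n v" b] by simp
  qed
  show "integrable V.P (highest n)"
    using E(1) by (subst Bochner_Integration.integrable_cong[OF refl eq]) auto
  have "(\<integral>v. highest n v \<partial>V.P) = (\<integral>v. a + (\<integral>t. (if t < highest n v then 1 else 0) \<partial>?L) \<partial>V.P)"
    by (rule Bochner_Integration.integral_cong[OF refl eq])
  also have "\<dots> = a + (\<integral>v. (\<integral>t. (if t < highest n v then 1 else 0) \<partial>?L) \<partial>V.P)"
    using E(1) V.P.prob_space by simp
  also have "\<dots> = a + (\<integral>t. 1 - Fs t ^ n \<partial>?L)"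
    unfolding E(2) V.prob_highest H_eq by simp
  finally show "(\<integral>v. highest n v \<partial>V.P) = a + (\<integral>t. 1 - Fs t ^ n \<partial>?L)" .
qed

lemma prob_top: "V.P.prob {v \<in> space V.P. b \<le> highest n v} = 1 - ((b - c) / (b - \<phi>)) ^ n"
proof -
  let ?A = "{y \<in> space F. y < b}"
  let ?E = "{v \<in> space V.P. \<forall>i<n. v i \<in> ?A}"
  have A: "?A \<in> sets F"
  proof -
    have "?A = {..<b} \<inter> {a..b}" by (auto simp: space_F)
    then show ?thesis
      unfolding sets_F sets_restrict_space by (intro image_eqI[where x="{..<b}"]) (simp_all add: Int_commute)
  qed
  have iff: "(\<forall>i<n. v i \<in> ?A) \<longleftrightarrow> \<not> b \<le> highest n v" if v: "v \<in> space V.P" for v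
  proof -
    have "v i \<in> ?A \<longleftrightarrow> v i < b" if "i < n" for i
      using that val_profilesD[of v n a b i] v by (auto simp: V.space_P space_F)
    then have 1: "(\<forall>i<n. v i \<in> ?A) \<longleftrightarrow> (\<forall>i<n. v i < b)"
      by (simp only: cong: imp_cong)
    have "(\<forall>i<n. v i < b) \<longleftrightarrow> highest n v < b"
      using highest_attained[OF n1, of v] highest_ge[of _ n v] by (metis le_less_trans)
    then show ?thesis using 1 by (simp only: not_le)
  qed
  have E: "{v \<in> space V.P. b \<le> highest n v} = space V.P - ?E"
    using iff by blast
  have "?E = {v \<in> space V.P. \<not> b \<le> highest n v}"
    using iff by blast
  also have "\<dots> \<in> sets V.P" by measurable
  finally have "V.P.prob {v \<in> space V.P. b \<le> highest n v} = 1 - V.P.prob ?E"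
    unfolding E by (rule V.P.prob_compl)
  then show ?thesis
    using measure_PiM_same(1)[OF prob_F A, of n] by (simp only: prob_below_top)
qed

text \<open>Expected largest virtual value: b if some buyer sits at the atom, \<phi>
  otherwise.\<close>

definition top_revenue :: real where
  "top_revenue = \<phi> + (b - \<phi>) * (1 - ((b - c) / (b - \<phi>)) ^ n)"

text \<open>The single-buyer bound is applied to each buyer with the rivals' values fixed; the
  supply constraint then bounds the total by the largest virtual value.\<close>

lemma revenue_le:
  assumes m: "(x, p) \<in> M_all n a b" and int: "\<And>i. i < n \<Longrightarrow> integrable V.P (\<lambda>v. p v i)"
  shows "(\<integral>v. (\<Sum>i<n. p v i) \<partial>V.P) \<le> top_revenue"
proof -
  have mx: "(\<lambda>v. x v i) \<in> borel_measurable V.P" and mp: "(\<lambda>v. p v i) \<in> borel_measurable V.P" if "i < n" for i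
    using m that unfolding V.measurable_P by (auto simp: M_all_def)
  have xb: "0 \<le> x v i \<and> x v i \<le> 1" and IR: "0 \<le> v i * x v i - p v i"
    and IC: "u \<in> {a..b} \<Longrightarrow> v i * x (v(i := u)) i - p (v(i := u)) i \<le> v i * x v i - p v i"
    if "v \<in> val_profiles n a b" "i < n" for v i u
    using m that by (auto simp: M_all_def)
  have AC: "(\<Sum>i<n. x v i) \<le> 1" if "v \<in> val_profiles n a b" for v
    using m that by (auto simp: M_all_def)
  have mv: "(\<lambda>v. virtual_value (v i)) \<in> borel_measurable V.P" if "i < n" for i
    unfolding V.measurable_P
    by (rule measurable_compose[OF measurable_coord[OF that] virtual_value_borel])
  have ixv: "integrable V.P (\<lambda>v. x v i * virtual_value (v i))" if i: "i < n" for i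
  proof (rule V.P.integrable_const_bound[where B=b])
    show "AE v in V.P. norm (x v i * virtual_value (v i)) \<le> b"
    proof (rule AE_I2)
      fix v assume "v \<in> space V.P"
      then have "v \<in> val_profiles n a b" by (simp add: V.space_P)
      from xb[OF this i] have "x v i * virtual_value (v i) \<le> 1 * b" "0 \<le> x v i * virtual_value (v i)"
        using virtual_value_nonneg[of "v i"] virtual_value_le[of "v i"]
        by (intro mult_mono mult_nonneg_nonneg; simp)+
      then show "norm (x v i * virtual_value (v i)) \<le> b" by simp
    qed
  qed (intro borel_measurable_times mx mv i)
  have each: "(\<integral>v. p v i \<partial>V.P) \<le> (\<integral>v. x v i * virtual_value (v i) \<partial>V.P)" if i: "i < n" for i
  proof -
    interpret product_sigma_finite "\<lambda>_. F" by unfold_locales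
    let ?I = "{..<n} - {i}"
    have I: "finite ?I" "i \<notin> ?I" "insert i ?I = {..<n}" using i by auto
    let ?q = "\<lambda>v. p v i - x v i * virtual_value (v i)"
    have iq: "integrable (Pi\<^sub>M (insert i ?I) (\<lambda>_. F)) ?q"
      unfolding I(3) using int[OF i] ixv[OF i] by (rule Bochner_Integration.integrable_diff)
    have "integral\<^sup>L V.P ?q = (\<integral>w. (\<integral>y. ?q (w(i := y)) \<partial>F) \<partial>Pi\<^sub>M ?I (\<lambda>_. F))"
      using product_integral_insert[OF I(1,2) iq] unfolding I(3) .
    also have "\<dots> \<le> 0"
    proof -
    \<comment> \<open>The sign is reversed because nonnegativity of an integral can be concluded
      without an integrability argument for the inner integral as a function of w.\<close>
    have "0 \<le> (\<integral>w. - (\<integral>y. ?q (w(i := y)) \<partial>F) \<partial>Pi\<^sub>M ?I (\<lambda>_. F))"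
    proof (rule integral_nonneg_AE, rule AE_I2)
      fix w assume w: "w \<in> space (Pi\<^sub>M ?I (\<lambda>_. F))"
      have upd: "w(i := y) \<in> val_profiles n a b" if "y \<in> {a..b}" for y
        using w PiE_fun_upd[of y "\<lambda>_. {a..b}" i w ?I] that unfolding I(3)
        by (simp only: space_PiM space_F)
      have mu: "(\<lambda>y. w(i := y)) \<in> F \<rightarrow>\<^sub>M V.P"
        using measurable_component_update[OF w I(2)] unfolding I(3) .
      have "(\<integral>y. p (w(i := y)) i - x (w(i := y)) i * virtual_value y \<partial>F) \<le> 0"
      proof (rule virtual_bound)
        show "(\<lambda>y. x (w(i := y)) i) \<in> borel_measurable F" "(\<lambda>y. p (w(i := y)) i) \<in> borel_measurable F"
          by (rule measurable_compose[OF mu mx[OF i]] measurable_compose[OF mu mp[OF i]])+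
      next
        fix u assume u: "u \<in> {a..b}"
        show "0 \<le> x (w(i := u)) i \<and> x (w(i := u)) i \<le> 1" using xb[OF upd[OF u] i] .
        show "0 \<le> u * x (w(i := u)) i - p (w(i := u)) i" using IR[OF upd[OF u] i] by simp
      next
        fix u u' assume u: "u \<in> {a..b}" "u' \<in> {a..b}"
        show "u * x (w(i := u')) i - p (w(i := u')) i \<le> u * x (w(i := u)) i - p (w(i := u)) i"
          using IC[OF upd[OF u(1)] i u(2)] by simp
      qed
      then show "0 \<le> - (\<integral>y. ?q (w(i := y)) \<partial>F)" by simp
    qed
    then have "(\<integral>w. (\<integral>y. ?q (w(i := y)) \<partial>F) \<partial>Pi\<^sub>M ?I (\<lambda>_. F)) \<le> 0" by simp
    then show ?thesis .
    qed
    finally show ?thesis using int[OF i] ixv[OF i] by simp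
  qed
  have "(\<integral>v. (\<Sum>i<n. p v i) \<partial>V.P) = (\<Sum>i<n. \<integral>v. p v i \<partial>V.P)"
    using int by (intro Bochner_Integration.integral_sum) auto
  also have "\<dots> \<le> (\<Sum>i<n. \<integral>v. x v i * virtual_value (v i) \<partial>V.P)"
    using each by (intro sum_mono) auto
  also have "\<dots> = (\<integral>v. (\<Sum>i<n. x v i * virtual_value (v i)) \<partial>V.P)"
    using ixv by (intro Bochner_Integration.integral_sum[symmetric]) auto
  also have "\<dots> \<le> (\<integral>v. \<phi> + (b - \<phi>) * indicator {v \<in> space V.P. b \<le> highest n v} v \<partial>V.P)"
  proof (rule integral_mono)
    have s: "{v \<in> space V.P. b \<le> highest n v} \<in> sets V.P" by measurable
    then show "integrable V.P (\<lambda>v. \<phi> + (b - \<phi>) * indicator {v \<in> space V.P. b \<le> highest n v} v)"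
      by (intro Bochner_Integration.integrable_add integrable_mult_right V.P.integrable_const
          integrable_real_indicator) (simp_all add: V.P.emeasure_eq_measure)
    show "integrable V.P (\<lambda>v. \<Sum>i<n. x v i * virtual_value (v i))"
      using ixv by (intro Bochner_Integration.integrable_sum) auto
    fix v assume v: "v \<in> space V.P"
    then have v': "v \<in> val_profiles n a b" by (simp add: V.space_P)
    let ?g = "\<phi> + (b - \<phi>) * indicator {v \<in> space V.P. b \<le> highest n v} v"
    have g0: "0 \<le> ?g" using \<phi>0 \<phi>c cb by (auto simp: indicator_def)
    have "virtual_value (v i) \<le> ?g" if "i < n" for i
      using highest_ge[OF that, of v] v \<phi>c cb by (auto simp: virtual_value_def indicator_def)
    then have "(\<Sum>i<n. x v i * virtual_value (v i)) \<le> (\<Sum>i<n. x v i * ?g)"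
      using xb[OF v'] by (intro sum_mono mult_left_mono) auto
    also have "\<dots> = (\<Sum>i<n. x v i) * ?g" by (rule sum_distrib_right[symmetric])
    also have "\<dots> \<le> 1 * ?g" using AC[OF v'] g0 by (intro mult_right_mono)
    finally show "(\<Sum>i<n. x v i * virtual_value (v i)) \<le> ?g" by simp
  qed
  also have "\<dots> = top_revenue"
  proof -
    have s: "{v \<in> space V.P. b \<le> highest n v} \<in> sets V.P" by measurable
    have i: "integrable V.P (indicator {v \<in> space V.P. b \<le> highest n v} :: _ \<Rightarrow> real)"
      using s by (intro integrable_real_indicator) (simp_all add: V.P.emeasure_eq_measure)
    have "(\<integral>v. \<phi> + (b - \<phi>) * indicator {v \<in> space V.P. b \<le> highest n v} v \<partial>V.P)
        = \<phi> + (b - \<phi>) * V.P.prob {v \<in> space V.P. b \<le> highest n v}"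
      using i s V.P.prob_space
      by (subst Bochner_Integration.integral_add) (auto intro!: integrable_mult_right)
    then show ?thesis by (simp only: prob_top top_revenue_def)
  qed
  finally show ?thesis .
qed

text \<open>Individual rationality bounds payments above by b, but nothing bounds them below. The
  negative part of the integrand is thus integrable; either its positive part is not and the regret
  is infinite, or the revenue bound applies.\<close>

lemma regret_worst_case_ge:
  assumes m: "m \<in> M_all n a b"
  shows "ereal (lam * (a + (\<integral>t. 1 - Fs t ^ n \<partial>Ioo_lborel a b)) - top_revenue) \<le> regret lam n m V.P"
proof -
  obtain x p where xp: "m = (x, p)" by force
  let ?f = "\<lambda>v. lam * highest n v - (\<Sum>i<n. p v i)"
  have mp: "(\<lambda>v. p v i) \<in> borel_measurable V.P" if "i < n" for i
    using m that unfolding V.measurable_P xp by (auto simp: M_all_def)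
  have pb: "p v i \<le> b" if "v \<in> space V.P" "i < n" for v i
  proof -
    have v: "v \<in> val_profiles n a b" using that by (simp add: V.space_P)
    have x: "0 \<le> x v i" "x v i \<le> 1" "0 \<le> v i * x v i - p v i"
      using m v that(2) by (auto simp: xp M_all_def)
    have "v i * x v i \<le> b * x v i"
      using val_profilesD(2)[OF v that(2)] x by (intro mult_right_mono)
    also have "\<dots> \<le> b * 1" using x \<phi>0 \<phi>c cb by (intro mult_left_mono) auto
    finally show ?thesis using x by simp
  qed
  have mf: "?f \<in> borel_measurable V.P"
    by (intro borel_measurable_diff borel_measurable_times borel_measurable_const borel_measurable_sum mp
        V.highest_borel) auto
  have hb: "\<bar>highest n v\<bar> \<le> \<bar>a\<bar> + \<bar>b\<bar>" if "v \<in> space V.P" for v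
  proof -
    obtain i where "i < n" "v i = highest n v" using highest_attained[OF n1] by blast
    then have "a \<le> highest n v" "highest n v \<le> b"
      using val_profilesD[of v n a b i] that by (auto simp: V.space_P)
    then show ?thesis by linarith
  qed
  define C where "C = \<bar>lam\<bar> * (\<bar>a\<bar> + \<bar>b\<bar>) + real n * b"
  have neg: "- ?f v \<le> C" if v: "v \<in> space V.P" for v
  proof -
    have "(\<Sum>i<n. p v i) \<le> (\<Sum>i<n. b)" using pb[OF v] by (intro sum_mono) auto
    moreover have "\<bar>lam * highest n v\<bar> \<le> \<bar>lam\<bar> * (\<bar>a\<bar> + \<bar>b\<bar>)"
      unfolding abs_mult using hb[OF v] by (intro mult_left_mono) auto
    ultimately show ?thesis by (simp add: C_def)
  qed
  have negfin: "(\<integral>\<^sup>+v. ennreal (- ?f v) \<partial>V.P) < \<infinity>"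
  proof -
    have "(\<integral>\<^sup>+v. ennreal (- ?f v) \<partial>V.P) \<le> (\<integral>\<^sup>+v. ennreal C \<partial>V.P)"
      using neg by (intro nn_integral_mono ennreal_leI) auto
    also have "\<dots> < \<infinity>" by (simp add: V.P.emeasure_space_1)
    finally show ?thesis .
  qed
  show ?thesis
  proof (cases "integrable V.P ?f")
    case False
    then have "(\<integral>\<^sup>+v. ennreal (?f v) \<partial>V.P) = \<infinity>"
      using mf negfin unfolding real_integrable_def by auto
    then have "regret lam n m V.P = \<infinity> - enn2ereal (\<integral>\<^sup>+v. ennreal (- ?f v) \<partial>V.P)"
      unfolding regret_def xp by (simp add: top_ereal_def enn2ereal_top)
    also have "\<dots> = \<infinity>"
      using negfin by (cases "\<integral>\<^sup>+v. ennreal (- ?f v) \<partial>V.P") (auto simp: enn2ereal_ennreal)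
    finally show ?thesis by simp
  next
    case True
    have ih: "integrable V.P (\<lambda>v. lam * highest n v)" using expected_highest(1) by simp
    have "integrable V.P (\<lambda>v. lam * highest n v - ?f v)"
      by (rule Bochner_Integration.integrable_diff[OF ih True])
    then have isum: "integrable V.P (\<lambda>v. \<Sum>i<n. p v i)" by simp
    \<comment> \<open>Each payment is recovered from the integrable sum: all other summands are at
      most b, so it is at least the sum minus n b.\<close>
    have ip: "integrable V.P (\<lambda>v. p v i)" if i: "i < n" for i
    proof (rule Bochner_Integration.integrable_bound[of _ "\<lambda>v. \<bar>\<Sum>i<n. p v i\<bar> + real n * b"])
      show "integrable V.P (\<lambda>v. \<bar>\<Sum>i<n. p v i\<bar> + real n * b)" using isum by simp
      show "(\<lambda>v. p v i) \<in> borel_measurable V.P" by (rule mp[OF i])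
      show "AE v in V.P. norm (p v i) \<le> norm (\<bar>\<Sum>i<n. p v i\<bar> + real n * b)"
      proof (rule AE_I2)
        fix v assume v: "v \<in> space V.P"
        have b0: "0 \<le> b" using \<phi>0 \<phi>c cb by simp
        have "(\<Sum>i<n. p v i) = p v i + (\<Sum>j\<in>{..<n} - {i}. p v j)"
          using i by (intro sum.remove) auto
        also have "(\<Sum>j\<in>{..<n} - {i}. p v j) \<le> (\<Sum>j\<in>{..<n} - {i}. b)"
          using pb[OF v] by (intro sum_mono) auto
        also have "(\<Sum>j\<in>{..<n} - {i}. b) \<le> real n * b"
          using i b0 by (simp add: mult_right_mono)
        finally have "(\<Sum>i<n. p v i) \<le> p v i + real n * b" by simp
        moreover have "p v i \<le> real n * b"
          using pb[OF v i] mult_right_mono[of 1 "real n" b] n1 b0 by simp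
        ultimately have "\<bar>p v i\<bar> \<le> \<bar>\<Sum>i<n. p v i\<bar> + real n * b" by linarith
        then show "norm (p v i) \<le> norm (\<bar>\<Sum>i<n. p v i\<bar> + real n * b)" by simp
      qed
    qed
    have "(\<integral>v. ?f v \<partial>V.P) = lam * (\<integral>v. highest n v \<partial>V.P) - (\<integral>v. (\<Sum>i<n. p v i) \<partial>V.P)"
      using ih isum by simp
    moreover have "(\<integral>v. (\<Sum>i<n. p v i) \<partial>V.P) \<le> top_revenue"
      using revenue_le[of x p] m ip unfolding xp by blast
    ultimately show ?thesis
      using regret_eq_integral[of V.P lam n m] True expected_highest(2) by (simp add: xp)
  qed
qed

lemma worst_case_in_F_iid: "V.P \<in> F_iid n a b"
  using prob_F sets_F by (auto simp: F_iid_def)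

end

section \<open>The saddle point\<close>

text \<open>Saddle-point criterion with common value V: m keeps the regret below V against every
  distribution, and Q keeps it above V for every mechanism.\<close>

lemma robustly_optimalI:
  assumes "m \<in> M_all n a b" "Q \<in> F_iid n a b"
    and upper: "\<And>P. P \<in> F_iid n a b \<Longrightarrow> regret lam n m P \<le> V"
    and lower: "\<And>m'. m' \<in> M_all n a b \<Longrightarrow> V \<le> regret lam n m' Q"
  shows "robustly_optimal lam n a b m"
  unfolding robustly_optimal_def
proof (intro conjI antisym)
  have "V \<le> (INF m'\<in>M_all n a b. SUP P\<in>F_iid n a b. regret lam n m' P)"
    using lower assms(2) by (intro INF_greatest) (meson SUP_upper2)
  moreover have "(SUP P\<in>F_iid n a b. regret lam n m P) \<le> V"
    using upper by (intro SUP_least)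
  ultimately show "(SUP P\<in>F_iid n a b. regret lam n m P)
      \<le> (INF m'\<in>M_all n a b. SUP P\<in>F_iid n a b. regret lam n m' P)" by simp
  show "(INF m'\<in>M_all n a b. SUP P\<in>F_iid n a b. regret lam n m' P)
      \<le> (SUP P\<in>F_iid n a b. regret lam n m P)"
    using assms(1) by (rule INF_lower)
qed (rule assms(1))

text \<open>Logistic form of the derivative, from which the conditions on \<open>dz\<close> in the
  two revenue lemmas are immediate.\<close>

lemma (in const_virtual) quot_deriv':
  assumes "c < t"
  shows "((\<lambda>t. (t - c) / (t - \<phi>)) has_real_derivative ((t - c) / (t - \<phi>)) * (1 - (t - c) / (t - \<phi>)) / (t - c)) (at t)"
proof -
  have "((t - c) / (t - \<phi>)) * (1 - (t - c) / (t - \<phi>)) / (t - c) = (c - \<phi>) / (t - \<phi>)\<^sup>2"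
  proof -
    have "1 - (t - c) / (t - \<phi>) = (c - \<phi>) / (t - \<phi>)"
      using assms \<phi>c by (simp add: field_simps)
    then show ?thesis using assms \<phi>c by (simp add: power2_eq_square)
  qed
  then show ?thesis using quot_deriv[of t] assms by simp
qed

text \<open>Provides the antiderivative of the revenue density in the SPA range. The condition on
  \<open>dz\<close> says that t (1 - z t) has derivative 0, that is, that the virtual value is
  0.\<close>

lemma has_derivative_SPA_revenue:
  fixes G z :: "real \<Rightarrow> real"
  assumes n: "1 \<le> n" and G: "(G has_real_derivative g) (at t)" and z: "(z has_real_derivative dz) (at t)"
    and dz: "t * dz = 1 - z t"
  shows "((\<lambda>t. t * G t * (1 - z t ^ n)) has_real_derivative
     t * g * (1 - z t ^ n) + G t * (1 - z t ^ n - real n * (1 - z t) * z t ^ (n - 1))) (at t)"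
proof -
  have "((\<lambda>t. t * G t * (1 - z t ^ n)) has_real_derivative
      (1 * G t + g * t) * (1 - z t ^ n) + (0 - real n * (dz * z t ^ (n - Suc 0))) * (t * G t)) (at t)"
    by (intro DERIV_mult DERIV_diff DERIV_power DERIV_ident DERIV_const G z)
  moreover have "(0 - real n * (dz * z t ^ (n - Suc 0))) * (t * G t)
      = - real n * (1 - z t) * z t ^ (n - 1) * G t" unfolding dz[symmetric] by simp
  then have "(1 * G t + g * t) * (1 - z t ^ n) + (0 - real n * (dz * z t ^ (n - Suc 0))) * (t * G t)
      = t * g * (1 - z t ^ n) + G t * (1 - z t ^ n - real n * (1 - z t) * z t ^ (n - 1))"
    by (simp only:) (simp add: algebra_simps)
  ultimately show ?thesis by (simp only:)
qed

text \<open>Counterpart in the POOL range, now with exponent n - 1. For c = a the condition on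
  \<open>dz\<close> holds with every \<phi>, so this covers both \<phi> = 0 and \<phi> > 0.\<close>

lemma has_derivative_POOL_revenue:
  fixes G z :: "real \<Rightarrow> real"
  assumes n: "1 \<le> n" and G: "(G has_real_derivative g) (at t)" and z: "(z has_real_derivative dz) (at t)"
    and dz: "(t - a) * dz = z t * (1 - z t)"
  shows "((\<lambda>t. (t - a) * G t * (1 - z t ^ (n - 1))) has_real_derivative
     (real n - 1) / real n * (t - a) * g * (1 - z t ^ n)
     + (G t + (t - a) / real n * g) * (1 - z t ^ n - real n * (1 - z t) * z t ^ (n - 1))) (at t)"
proof -
  obtain m where m: "n = Suc m" using n by (cases n) auto
  have d1: "((\<lambda>t. (t - a) * G t * (1 - z t ^ m)) has_real_derivative
      ((1 - 0) * G t + g * (t - a)) * (1 - z t ^ m) + (0 - real m * (dz * z t ^ (m - Suc 0))) * ((t - a) * G t)) (at t)"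
    by (intro DERIV_mult DERIV_diff DERIV_power DERIV_ident DERIV_const G z)
  have e1: "(0 - real m * (dz * z t ^ (m - Suc 0))) * ((t - a) * G t)
      = - real m * (1 - z t) * z t ^ m * G t"
  proof -
    have "(0 - real m * (dz * z t ^ (m - Suc 0))) * ((t - a) * G t)
        = - real m * ((t - a) * dz) * z t ^ (m - 1) * G t" by simp
    also have "\<dots> = - real m * (1 - z t) * z t ^ m * G t"
      unfolding dz by (cases m) simp_all
    finally show ?thesis .
  qed
  have e2: "(real n - 1) / real n * (t - a) * g * (1 - z t ^ n)
     + (G t + (t - a) / real n * g) * (1 - z t ^ n - real n * (1 - z t) * z t ^ m)
     = ((1 - 0) * G t + g * (t - a)) * (1 - z t ^ m) - real m * (1 - z t) * z t ^ m * G t"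
  proof -
    define w N where "w = z t ^ m" and "N = real n"
    have N: "N \<noteq> 0" "real m = N - 1" using m by (simp_all add: N_def)
    have w: "z t ^ n = z t * w" by (simp add: w_def m)
    have g: "(N - 1) / N * (t - a) * g * (1 - z t * w) + (t - a) / N * g * (1 - z t * w - N * (1 - z t) * w)
       = (t - a) * g * (1 - w)"
      using N(1) by (simp add: field_simps)
    show ?thesis
      unfolding w w_def[symmetric] N_def[symmetric] N(2) using g by (simp add: algebra_simps)
  qed
  have "((\<lambda>t. (t - a) * G t * (1 - z t ^ m)) has_real_derivative
     (real n - 1) / real n * (t - a) * g * (1 - z t ^ n)
     + (G t + (t - a) / real n * g) * (1 - z t ^ n - real n * (1 - z t) * z t ^ m)) (at t)"
  proof (rule DERIV_cong[OF d1])
    show "((1 - 0) * G t + g * (t - a)) * (1 - z t ^ m)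
        + (0 - real m * (dz * z t ^ (m - Suc 0))) * ((t - a) * G t)
      = (real n - 1) / real n * (t - a) * g * (1 - z t ^ n)
        + (G t + (t - a) / real n * g) * (1 - z t ^ n - real n * (1 - z t) * z t ^ m)"
      unfolding e1 e2 by simp
  qed
  then show ?thesis by (simp only: m diff_Suc_1)
qed

text \<open>\<open>spa\<close> and \<open>pool\<close> are the first-order condition at z = (t - c)
  / (t - \<phi>), rearranged into equations for the density; \<open>low\<close> keeps thresholds
  above c; \<open>top\<close> leaves no mass above b, except possibly for n = 1. They make the
  worst-case cdf a maximiser at almost every level. The antiderivative \<open>Q\<close> then
  identifies the resulting upper bound with the lower bound.\<close>

lemma robustly_optimal_hybrid:
  fixes D :: "real measure" and n :: nat and lam a b c \<phi> vs :: real and g :: "real \<Rightarrow> real" and S :: "real set"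
  assumes HD: "hybrid_density D n a b vs g S" and CV: "const_virtual n a b c \<phi>"
    and lam: "0 \<le> lam" and cvs: "c \<le> vs" "c < vs \<Longrightarrow> \<phi> = 0" "vs < b \<Longrightarrow> c = a" and S: "{c, vs} \<subseteq> S"
    and low: "\<And>t. t \<le> c \<Longrightarrow> cdf D t = 0" "\<And>t. a < t \<Longrightarrow> t < c \<Longrightarrow> g t = 0"
    and spa: "\<And>t. c < t \<Longrightarrow> t < vs \<Longrightarrow>
        t * (t - c) * g t + (real n - 1) * c * cdf D t = lam * (t - c)"
    and pool: "\<And>t. vs < t \<Longrightarrow> t < b \<Longrightarrow>
        (real n - 1) / real n * (t - a) * (t - \<phi>) * g t + (real n - 1) * (a - \<phi>) * cdf D t = lam * (t - a)"
    and top: "cdf D b = 1 \<or> n = 1 \<and> c = a \<and> vs = b"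
  shows "robustly_optimal lam n a b (random_mechanism D (hybrid n a vs))"
proof -
  interpret X: hybrid_density D n a b vs g S by fact
  interpret W: const_virtual n a b c \<phi> by fact
  let ?L = "Ioo_lborel a b"
  let ?G = "cdf D"
  let ?A = "X.rate_first" and ?B = "X.rate_second" and ?z = "W.Fs"
  have n0: "0 < real n" using X.n1 by simp
  have q0: "0 \<le> real n - 1" using X.n1 by simp
  have z_eq: "?z t = (t - c) / (t - \<phi>)" if "c < t" "t < b" for t
    using that by (simp add: const_virtual_cdf_def)
  have tri: "t < c \<or> c < t \<and> t < vs \<or> vs < t" if "t \<in> {a<..<b} - S" for t
  proof -
    have "t \<noteq> c" "t \<noteq> vs" using that S by auto
    then show ?thesis using cvs(1) by linarith
  qed
  have foc: "0 \<le> lam - ?A t + (real n - 1) * ?B t \<and>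
      (real n - 1) * ?B t = ?z t * (lam - ?A t + (real n - 1) * ?B t)" if t: "t \<in> {a<..<b} - S" for t
    using tri[OF t]
  proof (elim disjE conjE)
    assume "t < c"
    then have "?A t = 0" "?B t = 0" "?z t = 0"
      using t low[of t] cvs(1) by (auto simp: X.rate_first_def X.rate_second_def const_virtual_cdf_def)
    then show ?thesis using lam by simp
  next
    assume t1: "c < t" "t < vs"
    have \<phi>: "\<phi> = 0" using t1 cvs by simp
    have A: "?A t = t * g t" and B: "?B t = ?G t"
      using t1 by (auto simp: X.rate_first_def X.rate_second_def)
    let ?E = "lam - t * g t + (real n - 1) * ?G t"
    have E: "(t - c) * ?E = (real n - 1) * ?G t * t"
      using spa[OF t1] by (simp add: algebra_simps)
    have tp: "0 < t" "0 < t - c" using t1 W.\<phi>0 W.\<phi>c by auto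
    have "?E = (real n - 1) * ?G t * t / (t - c)"
      using E tp by (simp add: field_simps)
    then have "0 \<le> ?E"
      using tp q0 X.cdf_nonneg[of t] by simp
    moreover have "(t - c) / t * ?E = (real n - 1) * ?G t"
      using E tp by (simp add: field_simps)
    ultimately show ?thesis
      unfolding A B using z_eq[of t] t1 t \<phi> by simp
  next
    assume t1: "vs < t"
    have ca: "c = a" using t1 t cvs by auto
    have t\<phi>: "0 < t - \<phi>" using t1 cvs W.\<phi>c by simp
    have A: "?A t = (real n - 1) / real n * (t - a) * g t" and B: "?B t = ?G t + (t - a) / real n * g t"
      using t1 by (auto simp: X.rate_first_def X.rate_second_def)
    \<comment> \<open>In the POOL range the density terms of the two rates cancel, and a visibly
      nonnegative number remains.\<close>
    have E: "lam - ?A t + (real n - 1) * ?B t = lam + (real n - 1) * ?G t"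
      unfolding A B using n0 by (simp add: field_simps)
    have "(t - a) * (lam + (real n - 1) * ?G t) = (t - \<phi>) * ((real n - 1) * ?B t)"
    proof -
      have "(t - a) * (lam + (real n - 1) * ?G t) = lam * (t - a) + (t - a) * (real n - 1) * ?G t"
        by (simp add: algebra_simps)
      also have "\<dots> = (real n - 1) / real n * (t - a) * (t - \<phi>) * g t + (real n - 1) * (a - \<phi>) * ?G t
          + (t - a) * (real n - 1) * ?G t"
        using pool[OF t1] t by simp
      also have "\<dots> = (t - \<phi>) * ((real n - 1) * ?B t)"
        unfolding B by (simp add: algebra_simps add_divide_distrib diff_divide_distrib)
      finally show ?thesis .
    qed
    then have "(real n - 1) * ?B t = (t - a) / (t - \<phi>) * (lam + (real n - 1) * ?G t)"
      using t\<phi> by (simp add: field_simps)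
    moreover have "?z t = (t - a) / (t - \<phi>)" using z_eq[of t] t t1 cvs(1) ca by simp
    moreover have "0 \<le> lam + (real n - 1) * ?G t" using lam q0 X.cdf_nonneg[of t] by simp
    ultimately show ?thesis unfolding E by simp
  qed
  \<comment> \<open>Revenue density of the hybrid mechanism at level t against the worst
    case.\<close>
  define R where "R t = ?A t * (1 - ?z t ^ n) + ?B t * (1 - ?z t ^ n - real n * (1 - ?z t) * ?z t ^ (n - 1))" for t
  define Z where "Z t = (if t \<le> c then 0 else (t - c) / (t - \<phi>))" for t
  \<comment> \<open>Antiderivative of \<open>R\<close>; the constant \<open>a * ?G vs\<close> makes
    its two pieces agree at vs.\<close>
  define Q where "Q t = (if t \<le> vs then t * ?G t * (1 - Z t ^ n)
      else a * ?G vs + (t - a) * ?G t * (1 - Z t ^ (n - 1)))" for t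
  have Zc: "continuous_on {a..b} Z"
  proof -
    have "continuous_on ({a..c} \<union> {c..b}) (\<lambda>t. if t \<le> c then 0 else (t - c) / (t - \<phi>))"
      by (intro continuous_on_If continuous_on_subset[OF W.quot_continuous] continuous_on_const) auto
    moreover have "{a..c} \<union> {c..b} = {a..b}" using W.ac W.cb by auto
    ultimately show ?thesis unfolding Z_def[abs_def] by simp
  qed
  have Zz: "Z t = ?z t" if "t < b" for t
    using that by (auto simp: Z_def const_virtual_cdf_def)
  have Qc: "continuous_on {a..b} Q"
  proof -
    have c1: "continuous_on {a..b} (\<lambda>t. t * ?G t * (1 - Z t ^ n))"
      by (intro continuous_intros X.cdf_cont Zc)
    show ?thesis
    proof (cases "vs = b")
      case True
      then show ?thesis
        using c1 by (subst continuous_on_cong[OF refl, of _ Q "\<lambda>t. t * ?G t * (1 - Z t ^ n)"]) (auto simp: Q_def)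
    next
      case False
      then have ca: "c = a" using cvs(3) X.vs by simp
      have c2: "continuous_on {a..b} (\<lambda>t. a * ?G vs + (t - a) * ?G t * (1 - Z t ^ (n - 1)))"
        by (intro continuous_intros X.cdf_cont Zc)
      \<comment> \<open>If c < vs, then \<phi> = 0 and Z vs = (vs - a) / vs, so the extra factor Z
        vs turns vs into vs - a. If vs = c, the cdf is 0 there.\<close>
      have join: "vs * ?G vs * (1 - Z vs ^ n) = a * ?G vs + (vs - a) * ?G vs * (1 - Z vs ^ (n - 1))"
      proof (cases "vs = c")
        case True
        then show ?thesis using low(1)[of c] by simp
      next
        case False
        then have v: "c < vs" "\<phi> = 0" using cvs by auto
        have "vs * Z vs ^ n = (vs - a) * Z vs ^ (n - 1)"
          using v ca W.\<phi>0 W.\<phi>c X.n1 by (cases n) (auto simp: Z_def)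
        then have "?G vs * (vs * Z vs ^ n) = ?G vs * ((vs - a) * Z vs ^ (n - 1))" by simp
        then show ?thesis by (simp add: algebra_simps)
      qed
      have "continuous_on ({a..vs} \<union> {vs..b}) (\<lambda>t. if t \<le> vs then t * ?G t * (1 - Z t ^ n)
          else a * ?G vs + (t - a) * ?G t * (1 - Z t ^ (n - 1)))"
        using X.vs join
        by (intro continuous_on_If continuous_on_subset[OF c1] continuous_on_subset[OF c2]) auto
      moreover have "{a..vs} \<union> {vs..b} = {a..b}" using X.vs by auto
      ultimately show ?thesis unfolding Q_def[abs_def] by simp
    qed
  qed
  have Qd: "(Q has_real_derivative R t) (at t)" if t: "t \<in> {a<..<b} - S" for t
    using tri[OF t]
  proof (elim disjE conjE)
    assume t1: "t < c"
    have "?A t = 0" "?B t = 0"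
      using t t1 low[of t] cvs(1) by (auto simp: X.rate_first_def X.rate_second_def)
    then have R0: "R t = 0" by (simp add: R_def)
    have "(Q has_real_derivative 0) (at t)"
      by (rule has_field_derivative_transform_within_open[where S="{..<c}" and f="\<lambda>_. 0"])
        (use t1 low(1) cvs(1) in \<open>auto simp: Q_def\<close>)
    then show ?thesis by (simp add: R0)
  next
    assume t1: "c < t" "t < vs"
    have \<phi>: "\<phi> = 0" using t1 cvs by simp
    have tp: "0 < t" using t1 W.\<phi>0 W.\<phi>c by auto
    have A: "?A t = t * g t" and B: "?B t = ?G t"
      using t1 by (auto simp: X.rate_first_def X.rate_second_def)
    let ?q = "\<lambda>t. (t - c) / (t - \<phi>)"
    have "((\<lambda>t. t * ?G t * (1 - ?q t ^ n)) has_real_derivative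
       t * g t * (1 - ?q t ^ n) + ?G t * (1 - ?q t ^ n - real n * (1 - ?q t) * ?q t ^ (n - 1))) (at t)"
    proof (rule has_derivative_SPA_revenue[OF X.n1 X.cdf_deriv[OF t] W.quot_deriv'[OF t1(1)]])
      show "t * (?q t * (1 - ?q t) / (t - c)) = 1 - ?q t"
        using tp t1 \<phi> by simp
    qed
    then have "(Q has_real_derivative
       t * g t * (1 - ?q t ^ n) + ?G t * (1 - ?q t ^ n - real n * (1 - ?q t) * ?q t ^ (n - 1))) (at t)"
      by (rule has_field_derivative_transform_within_open[where S="{c<..<vs}"])
        (use t1 in \<open>auto simp: Q_def Z_def\<close>)
    moreover have "?z t = ?q t" using z_eq[of t] t1 t by simp
    ultimately show ?thesis unfolding R_def A B by simp
  next
    assume t1: "vs < t"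
    have ca: "c = a" using t1 t cvs by auto
    have ct: "c < t" using t1 cvs by simp
    have A: "?A t = (real n - 1) / real n * (t - a) * g t" and B: "?B t = ?G t + (t - a) / real n * g t"
      using t1 by (auto simp: X.rate_first_def X.rate_second_def)
    let ?q = "\<lambda>t. (t - c) / (t - \<phi>)"
    have "((\<lambda>t. (t - a) * ?G t * (1 - ?q t ^ (n - 1))) has_real_derivative
       (real n - 1) / real n * (t - a) * g t * (1 - ?q t ^ n)
       + (?G t + (t - a) / real n * g t) * (1 - ?q t ^ n - real n * (1 - ?q t) * ?q t ^ (n - 1))) (at t)"
    proof (rule has_derivative_POOL_revenue[OF X.n1 X.cdf_deriv[OF t] W.quot_deriv'[OF ct]])
      show "(t - a) * (?q t * (1 - ?q t) / (t - c)) = ?q t * (1 - ?q t)"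
        using ct ca by simp
    qed
    from DERIV_add[OF DERIV_const[of "a * ?G vs"] this]
    have "(Q has_real_derivative 0 +
       ((real n - 1) / real n * (t - a) * g t * (1 - ?q t ^ n)
       + (?G t + (t - a) / real n * g t) * (1 - ?q t ^ n - real n * (1 - ?q t) * ?q t ^ (n - 1)))) (at t)"
      by (rule has_field_derivative_transform_within_open[where S="{vs<..}"])
        (use t1 cvs(1) in \<open>auto simp: Q_def Z_def\<close>)
    moreover have "?z t = ?q t" using z_eq[of t] ct t by simp
    ultimately show ?thesis unfolding R_def A B by simp
  qed
  have R_eq: "R t = lam * (1 - ?z t ^ n) - level_regret n (lam - ?A t) (?B t) (?z t)" for t
    by (simp add: R_def level_regret_def algebra_simps)
  have iz: "integrable ?L (\<lambda>t. 1 - ?z t ^ n)"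
    using W.Fs_bounds by (intro integrable_Ioo_lborel_bounded[where B=1] borel_measurable_Ioo_lborel)
      (auto simp: power_le_one abs_le_iff)
  have il: "integrable ?L (\<lambda>t. level_regret n (lam - ?A t) (?B t) (?z t))"
    using W.Fs_bounds by (intro X.integrable_level_regret) auto
  have iR: "integrable ?L R"
    unfolding R_eq[abs_def] using iz il by simp
  have "(\<integral>t. R t \<partial>?L) = Q b - Q a"
    using X.ab by (intro integral_Ioo_lborel_FTC[OF _ Qc X.finS Qd iR]) auto
  moreover have "Q a = 0" using low(1)[of a] W.ac X.vs by (simp add: Q_def)
  moreover have "Q b = W.top_revenue - a * (1 - ?G vs)"
  proof (cases "vs = b")
    case True
    then have \<phi>: "\<phi> = 0" using W.cb cvs by simp
    have "0 < b" using W.cb W.\<phi>0 W.\<phi>c by simp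
    have Qb: "Q b = b * ?G b * (1 - ((b - c) / b) ^ n)"
      using True \<phi> W.cb by (simp add: Q_def Z_def)
    have T: "W.top_revenue = b * (1 - ((b - c) / b) ^ n)"
      unfolding W.top_revenue_def using \<phi> by simp
    \<comment> \<open>In the exceptional case n = 1, c = a, \<open>top_revenue\<close> is a and
      \<open>Q b\<close> is a times the cdf at b: every price in [a, b] earns a, so missing mass
      lowers \<open>Q b\<close> by exactly a (1 - cdf D b).\<close>
    show ?thesis
      unfolding Qb T using top True \<open>0 < b\<close> by (auto simp: field_simps)
  next
    case False
    then have v: "vs < b" using X.vs by simp
    then have ca: "c = a" and Gb: "?G b = 1" using cvs top by auto
    have zb: "Z b = (b - a) / (b - \<phi>)" using W.cb ca by (simp add: Z_def)
    have b\<phi>: "0 < b - \<phi>" using W.cb W.\<phi>c by simp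
    have "(b - \<phi>) * Z b ^ n = (b - a) * Z b ^ (n - 1)"
      using b\<phi> X.n1 by (cases n) (auto simp: zb)
    moreover have "W.top_revenue = \<phi> + (b - \<phi>) - (b - \<phi>) * Z b ^ n"
      unfolding W.top_revenue_def zb by (simp add: ca algebra_simps)
    moreover have "Q b = a * ?G vs + (b - a) - (b - a) * Z b ^ (n - 1)"
      using v Gb by (simp add: Q_def algebra_simps)
    ultimately show ?thesis by (simp add: algebra_simps)
  qed
  ultimately have rev: "(\<integral>t. R t \<partial>?L) = W.top_revenue - a * (1 - ?G vs)" by simp
  have intR: "(\<integral>t. R t \<partial>?L) = lam * (\<integral>t. 1 - ?z t ^ n \<partial>?L)
      - (\<integral>t. level_regret n (lam - ?A t) (?B t) (?z t) \<partial>?L)"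
    unfolding R_eq using iz il by (subst Bochner_Integration.integral_diff) auto
  show ?thesis
  proof (rule robustly_optimalI[OF X.random_hybrid_in_M_all W.worst_case_in_F_iid])
    fix P assume P: "P \<in> F_iid n a b"
    have "regret lam n (random_mechanism D (hybrid n a vs)) P
      \<le> ereal (lam * a - a * (1 - ?G vs) + (\<integral>t. level_regret n (lam - ?A t) (?B t) (?z t) \<partial>?L))"
      using foc W.Fs_bounds by (intro X.regret_hybrid_le[OF P W.Fs_borel]) auto
    also have "lam * a - a * (1 - ?G vs) + (\<integral>t. level_regret n (lam - ?A t) (?B t) (?z t) \<partial>?L)
        = lam * (a + (\<integral>t. 1 - ?z t ^ n \<partial>?L)) - W.top_revenue"
      using rev intR by (simp add: algebra_simps)
    finally show "regret lam n (random_mechanism D (hybrid n a vs)) P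
        \<le> ereal (lam * (a + (\<integral>t. 1 - ?z t ^ n \<partial>?L)) - W.top_revenue)" .
  next
    fix m' assume "m' \<in> M_all n a b"
    then show "ereal (lam * (a + (\<integral>t. 1 - ?z t ^ n \<partial>?L)) - W.top_revenue) \<le> regret lam n m' W.V.P"
      by (rule W.regret_worst_case_ge)
  qed
qed

section \<open>Solving the first-order condition\<close>

text \<open>Mass 1 - G b, if any, is placed at b + 1, a threshold above every value. Freezing
  \<open>G\<close> at b keeps the cdf continuous there.\<close>

lemma exists_real_distribution_cdf:
  fixes G :: "real \<Rightarrow> real"
  assumes cb: "c < b" and cont: "continuous_on {c..b} G"
    and mono: "\<And>s t. c \<le> s \<Longrightarrow> s \<le> t \<Longrightarrow> t \<le> b \<Longrightarrow> G s \<le> G t"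
    and Gc: "G c = 0" and Gb: "G b \<le> 1"
  shows "\<exists>D. real_distribution D \<and> (\<forall>t\<le>c. cdf D t = 0) \<and> (\<forall>t\<in>{c..b}. cdf D t = G t)"
proof -
  have "continuous_on {c..} (\<lambda>t. G (min t b))"
    using cb by (intro continuous_on_compose2[OF cont] continuous_intros) auto
  moreover have "0 \<le> G (min t b) \<and> G (min t b) \<le> 1" if "c \<le> t" for t
    using mono[of c "min t b"] mono[of "min t b" b] that cb Gc Gb by auto
  moreover have "G (min s b) \<le> G (min t b)" if "c \<le> s" "s \<le> t" for s t
    using mono[of "min s b" "min t b"] that cb by auto
  ultimately show ?thesis
    using real_distribution_cutoff[of c "b + 1" "\<lambda>t. G (min t b)"]
      cdf_cutoff[of c "b + 1" "\<lambda>t. G (min t b)"] Gc cb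
    by (intro exI[of _ "interval_measure (\<lambda>t. if t < c then 0 else if t < b + 1 then G (min t b) else 1)"])
      auto
qed

text \<open>
  The two solution branches of the first-order condition; \<open>q\<close> is the constant of integration of the
  second one.
\<close>

definition spa_cdf :: "real \<Rightarrow> nat \<Rightarrow> real \<Rightarrow> real \<Rightarrow> real" where
  "spa_cdf lam n c t = lam * lratio (n - 1) ((t - c) / t)"

definition pool_cdf :: "real \<Rightarrow> nat \<Rightarrow> real \<Rightarrow> real \<Rightarrow> real \<Rightarrow> real \<Rightarrow> real" where
  "pool_cdf lam n q a \<phi> t = real n / (real n - 1) *
     (lam * lratio n ((t - a) / (t - \<phi>)) + q / ((t - a) / (t - \<phi>)) ^ n)"

text \<open>Common form of the three regimes, with (c, \<phi>, vs, q) equal to (k_l b, 0, b, 0), (a,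
  \<phi>_0, a, 0) or (a, 0, vs, q). A reserve branch forces \<phi> = 0, a pooling branch forces c =
  a, and \<open>join\<close> is continuity at the switch. The sign of q makes q / z^n increasing; q
  is 0 when the pooling branch starts at z = 0, where that term would be singular.\<close>

locale threshold_cdf = const_virtual n a b c \<phi> for n a b c \<phi> +
  fixes lam vs q :: real
  assumes a0: "0 \<le> a" and lam0: "0 < lam" and cvs: "c \<le> vs" and vsb: "vs \<le> b"
    and spa_\<phi>: "c < vs \<Longrightarrow> \<phi> = 0" and pool_c: "vs < b \<Longrightarrow> c = a" and pool_n: "vs < b \<Longrightarrow> 2 \<le> n"
    and q_le: "q \<le> 0" and q_0: "vs = c \<Longrightarrow> q = 0"
    and join: "c < vs \<Longrightarrow> vs < b \<Longrightarrow> spa_cdf lam n c vs = pool_cdf lam n q a \<phi> vs"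
begin

definition G :: "real \<Rightarrow> real" where
  "G t = (if t \<le> vs then spa_cdf lam n c t else pool_cdf lam n q a \<phi> t)"

lemma spa_cdf_c: "spa_cdf lam n c c = 0"
  by (simp add: spa_cdf_def)

lemma G_c: "G c = 0"
  using cvs by (simp add: G_def spa_cdf_c)

lemma spa_cdf_quot: "c \<le> t \<Longrightarrow> t \<le> vs \<Longrightarrow> spa_cdf lam n c t = lam * lratio (n - 1) ((t - c) / (t - \<phi>))"
  using spa_\<phi> by (cases "t = c") (auto simp: spa_cdf_def)

lemma spa_cdf_continuous: "continuous_on {c..vs} (spa_cdf lam n c)"
proof -
  have "continuous_on {c..vs} (\<lambda>t. lam * lratio (n - 1) ((t - c) / (t - \<phi>)))"
    using quot_bounds
    by (intro continuous_on_mult continuous_on_const continuous_on_compose2[OF lratio_continuous]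
        continuous_on_subset[OF quot_continuous]) auto
  then show ?thesis by (rule continuous_on_cong[THEN iffD1, rotated 2]) (auto simp: spa_cdf_quot)
qed

lemma join': "vs < b \<Longrightarrow> spa_cdf lam n c vs = pool_cdf lam n q a \<phi> vs"
proof (cases "vs = c")
  case True
  assume "vs < b"
  then have "pool_cdf lam n q a \<phi> vs = 0" using True pool_c q_0 by (simp add: pool_cdf_def)
  moreover have "spa_cdf lam n c vs = 0" using True by (simp add: spa_cdf_def)
  ultimately show ?thesis by simp
next
  case False
  assume "vs < b"
  then show ?thesis using False cvs join by simp
qed

lemma pool_cdf_continuous:
  assumes "vs < b"
  shows "continuous_on {vs..b} (pool_cdf lam n q a \<phi>)"
proof -
  have ca: "c = a" using assms pool_c by simp
  have qc: "continuous_on {vs..b} (\<lambda>t. (t - a) / (t - \<phi>))"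
    using quot_continuous cvs ca by (auto intro: continuous_on_subset)
  have lc: "continuous_on {vs..b} (\<lambda>t. lratio n ((t - a) / (t - \<phi>)))"
    using quot_bounds cvs ca by (intro continuous_on_compose2[OF lratio_continuous qc]) auto
  have "continuous_on {vs..b} (\<lambda>t. q / ((t - a) / (t - \<phi>)) ^ n)"
  proof (cases "vs = c")
    case True
    then show ?thesis using q_0 by simp
  next
    case False
    then show ?thesis
      using cvs ca \<phi>c by (intro continuous_intros qc) auto
  qed
  then show ?thesis
    unfolding pool_cdf_def by (intro continuous_on_mult continuous_on_add continuous_on_const lc)
qed

lemma G_continuous: "continuous_on {c..b} G"
proof (cases "vs = b")
  case True
  have "G t = spa_cdf lam n c t" if "t \<in> {c..b}" for t
    unfolding G_def using True that by simp
  then have "continuous_on {c..b} G \<longleftrightarrow> continuous_on {c..b} (spa_cdf lam n c)"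
    by (intro continuous_on_cong refl)
  then show ?thesis using spa_cdf_continuous unfolding True by simp
next
  case False
  then have "vs < b" using vsb by simp
  then have "continuous_on ({c..vs} \<union> {vs..b}) (\<lambda>t. if t \<le> vs then spa_cdf lam n c t else pool_cdf lam n q a \<phi> t)"
    using join' by (intro continuous_on_If spa_cdf_continuous pool_cdf_continuous) auto
  moreover have "{c..vs} \<union> {vs..b} = {c..b}" using cvs vsb by auto
  ultimately show ?thesis unfolding G_def[abs_def] by simp
qed

lemma G_mono:
  assumes st: "c \<le> s" "s \<le> t" "t \<le> b"
  shows "G s \<le> G t"
proof -
  have spa: "spa_cdf lam n c s \<le> spa_cdf lam n c t" if "c \<le> s" "s \<le> t" "t \<le> vs" for s t
    using that quot_bounds[of s] quot_bounds[of t] quot_mono[of s t] lam0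
    by (auto simp: spa_cdf_quot intro!: mult_left_mono lratio_mono)
  have pool: "pool_cdf lam n q a \<phi> s \<le> pool_cdf lam n q a \<phi> t" if "vs \<le> s" "s \<le> t" "t \<le> b" "vs < b" for s t
  proof -
    have ca: "c = a" using that pool_c by simp
    let ?z = "\<lambda>t. (t - a) / (t - \<phi>)"
    have z: "0 \<le> ?z s" "?z s \<le> ?z t" "?z t < 1"
      using quot_bounds[of s] quot_bounds[of t] quot_mono[of s t] that cvs ca by auto
    have "q / ?z s ^ n \<le> q / ?z t ^ n"
    proof (cases "?z s = 0")
      case True
      then have "s = a" using that cvs ca \<phi>c by auto
      then show ?thesis using that cvs ca q_0 by simp
    next
      case False
      then have "0 < ?z s" using z(1) by linarith
      then have "0 < ?z s ^ n" "?z s ^ n \<le> ?z t ^ n" using z by (auto intro!: power_mono zero_less_power simp del: zero_less_divide_iff)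
      then have "- q / ?z t ^ n \<le> - q / ?z s ^ n" using q_le by (intro divide_left_mono) auto
      then show ?thesis by simp
    qed
    moreover have "lam * lratio n (?z s) \<le> lam * lratio n (?z t)"
      using lam0 z by (intro mult_left_mono lratio_mono) auto
    moreover have "0 \<le> real n / (real n - 1)" using n1 by simp
    ultimately show ?thesis unfolding pool_cdf_def by (intro mult_left_mono) auto
  qed
  consider "t \<le> vs" | "s \<le> vs" "vs < t" | "vs < s" using st by linarith
  then show ?thesis
  proof cases
    case 1 then show ?thesis using spa[of s t] st by (simp add: G_def)
  next
    case 2
    then have "spa_cdf lam n c s \<le> spa_cdf lam n c vs" using spa[of s vs] st by simp
    also have "\<dots> = pool_cdf lam n q a \<phi> vs" using 2 st join' by simp
    also have "\<dots> \<le> pool_cdf lam n q a \<phi> t" using pool[of vs t] 2 st by simp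
    finally show ?thesis using 2 by (simp add: G_def)
  next
    case 3 then show ?thesis using pool[of s t] st by (simp add: G_def)
  qed
qed

lemma spa_cdf_deriv:
  assumes t: "c < t" "t < vs"
  shows "(spa_cdf lam n c has_real_derivative
     (lam * (t - c) - (real n - 1) * c * spa_cdf lam n c t) / (t * (t - c))) (at t)"
proof -
  have \<phi>: "\<phi> = 0" using t spa_\<phi> by simp
  have tp: "0 < t" "0 < c" using t \<phi>c \<phi> by auto
  let ?z = "(t - c) / t"
  have z: "0 < ?z" "?z < 1" using t tp by auto
  have "((\<lambda>t. (t - c) / t) has_real_derivative c / t\<^sup>2) (at t)"
    using quot_deriv[of t] t \<phi> by simp
  from DERIV_cmult[OF DERIV_chain2[OF lratio_deriv[OF z] this], of lam "n - 1"]
  have "(spa_cdf lam n c has_real_derivative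
      lam * ((1 / (1 - ?z) - real (n - 1) * lratio (n - 1) ?z / ?z) * (c / t\<^sup>2))) (at t)"
    unfolding spa_cdf_def[abs_def] .
  moreover have "lam * ((1 / (1 - ?z) - real (n - 1) * lratio (n - 1) ?z / ?z) * (c / t\<^sup>2))
      = (lam * (t - c) - (real n - 1) * c * spa_cdf lam n c t) / (t * (t - c))"
  proof -
    have "1 - ?z = c / t" using tp by (simp add: field_simps)
    then show ?thesis
      using tp t n1 by (simp add: spa_cdf_def field_simps power2_eq_square of_nat_diff)
  qed
  ultimately show ?thesis by simp
qed

text \<open>By \<open>lratio_le\<close> the subtracted term is at most (n - 1)/n of
  \<open>lam * (t - c)\<close>.\<close>

lemma spa_cdf_deriv_nonneg:
  assumes t: "c < t" "t \<le> vs"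
  shows "0 \<le> (lam * (t - c) - (real n - 1) * c * spa_cdf lam n c t) / (t * (t - c))"
proof -
  have \<phi>: "\<phi> = 0" using t spa_\<phi> by simp
  have tp: "0 < t" "0 < c" using t \<phi>c \<phi> by auto
  let ?z = "(t - c) / t"
  have z: "0 \<le> ?z" "?z < 1" using t tp by auto
  have n: "real (Suc (n - 1)) = real n" using n1 by simp
  have e: "?z / (real n * (1 - ?z)) = (t - c) / (real n * c)" using tp n1 by (simp add: field_simps)
  then have "lratio (n - 1) ?z \<le> (t - c) / (real n * c)"
    using lratio_le[OF z, of "n - 1"] unfolding n e by blast
  then have "(real n - 1) * c * (lam * lratio (n - 1) ?z) \<le> (real n - 1) * c * (lam * ((t - c) / (real n * c)))"
    using n1 tp lam0 by (intro mult_left_mono) auto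
  also have "\<dots> = (real n - 1) / real n * (lam * (t - c))" using tp n1 by (simp add: field_simps)
  also have "\<dots> \<le> 1 * (lam * (t - c))" using n1 lam0 t by (intro mult_right_mono) auto
  finally show ?thesis using tp t by (simp add: spa_cdf_def)
qed

lemma pool_cdf_deriv:
  assumes t: "vs < t" "t < b"
  shows "(pool_cdf lam n q a \<phi> has_real_derivative
     real n * (lam * (t - a) - (real n - 1) * (a - \<phi>) * pool_cdf lam n q a \<phi> t)
       / ((real n - 1) * (t - a) * (t - \<phi>))) (at t)"
proof -
  have ca: "c = a" and n2: "2 \<le> n" using t pool_c pool_n by auto
  have tp: "0 < t - a" "0 < a - \<phi>" "0 < t - \<phi>" "0 < real n - 1" using t cvs ca \<phi>c n2 by auto
  let ?z = "(t - a) / (t - \<phi>)"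
  have z: "0 < ?z" "?z < 1" using tp by auto
  have dz: "((\<lambda>t. (t - a) / (t - \<phi>)) has_real_derivative (a - \<phi>) / (t - \<phi>)\<^sup>2) (at t)"
    using quot_deriv[of t] t cvs ca by simp
  let ?N = "real n / (real n - 1)"
  have d1: "((\<lambda>z. ?N * (lam * lratio n z + q / z ^ n)) has_real_derivative
      ?N * (lam * (1 / (1 - ?z) - real n * lratio n ?z / ?z) - real n * (q / ?z ^ n) / ?z)) (at ?z)"
  proof -
    have "((\<lambda>z. q / z ^ n) has_real_derivative
        (0 * ?z ^ n - q * (real n * (1 * ?z ^ (n - Suc 0)))) / (?z ^ n * ?z ^ n)) (at ?z)"
      using z by (intro DERIV_divide DERIV_const DERIV_power DERIV_ident) auto
    moreover have "(0 * ?z ^ n - q * (real n * (1 * ?z ^ (n - Suc 0)))) / (?z ^ n * ?z ^ n)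
        = - (real n * (q / ?z ^ n) / ?z)"
    proof -
      have "?z ^ n = ?z * ?z ^ (n - Suc 0)" using n2 by (cases n) auto
      moreover have "(0 * (w * y) - q * (real n * (1 * y))) / ((w * y) * (w * y))
        = - (real n * (q / (w * y)) / w)" if "0 < w" "0 < y" for w y :: real
        using that by (simp add: field_simps)
      ultimately show ?thesis using z by (metis zero_less_power)
    qed
    ultimately have "((\<lambda>z. q / z ^ n) has_real_derivative - (real n * (q / ?z ^ n) / ?z)) (at ?z)"
      by (simp only:)
    from DERIV_cmult[OF DERIV_add[OF DERIV_cmult[OF lratio_deriv[OF z]] this]]
    show ?thesis by (simp only: diff_conv_add_uminus)
  qed
  have d2: "(pool_cdf lam n q a \<phi> has_real_derivative
      ?N * (lam * (1 / (1 - ?z) - real n * lratio n ?z / ?z) - real n * (q / ?z ^ n) / ?z)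
        * ((a - \<phi>) / (t - \<phi>)\<^sup>2)) (at t)"
    unfolding pool_cdf_def[abs_def] by (rule DERIV_chain2[OF d1 dz])
  have z1: "1 - ?z = (a - \<phi>) / (t - \<phi>)" using tp by (simp add: field_simps)
  have "?N * (lam * (1 / (1 - ?z) - real n * lratio n ?z / ?z) - real n * (q / ?z ^ n) / ?z)
      = ?N * lam / (1 - ?z) - real n * pool_cdf lam n q a \<phi> t / ?z"
    unfolding pool_cdf_def by (simp add: algebra_simps add_divide_distrib diff_divide_distrib)
  also have "\<dots> * ((a - \<phi>) / (t - \<phi>)\<^sup>2)
     = real n * (lam * (t - a) - (real n - 1) * (a - \<phi>) * pool_cdf lam n q a \<phi> t)
       / ((real n - 1) * (t - a) * (t - \<phi>))"
  proof -
    have "(N / M * lam / (d / y) - N * P / (x / y)) * (d / y\<^sup>2) = N * (lam * x - M * d * P) / (M * x * y)"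
      if "0 < x" "0 < y" "0 < d" "0 < M" for x y d M N P :: real
      using that by (simp add: field_simps power2_eq_square)
    from this[OF tp(1,3,2,4)] show ?thesis unfolding z1 .
  qed
  finally show ?thesis using d2 by simp
qed

text \<open>Dropping the term with q \<le> 0 only enlarges \<open>pool_cdf\<close>;
  \<open>lratio_le\<close> then bounds the subtracted term by n/(n + 1) of
  \<open>lam * (t - a)\<close>.\<close>

lemma pool_cdf_deriv_nonneg:
  assumes t: "vs < t" "t < b"
  shows "0 \<le> real n * (lam * (t - a) - (real n - 1) * (a - \<phi>) * pool_cdf lam n q a \<phi> t)
       / ((real n - 1) * (t - a) * (t - \<phi>))"
proof -
  have ca: "c = a" and n2: "2 \<le> n" using t pool_c pool_n by auto
  have tp: "0 < t - a" "0 < a - \<phi>" "0 < t - \<phi>" "0 < real n - 1" using t cvs ca \<phi>c n2 by auto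
  let ?z = "(t - a) / (t - \<phi>)"
  have z: "0 < ?z" "?z < 1" using tp by auto
  have z1: "1 - ?z = (a - \<phi>) / (t - \<phi>)" using tp by (simp add: field_simps)
  have "q / ?z ^ n \<le> 0" using z q_le by (simp add: divide_nonpos_pos)
  have "lratio n ?z \<le> ?z / (real (Suc n) * (1 - ?z))" using lratio_le[of ?z n] z by simp
  also have "\<dots> = (t - a) / (real (Suc n) * (a - \<phi>))" unfolding z1 using tp by simp
  finally have l: "lratio n ?z \<le> (t - a) / (real (Suc n) * (a - \<phi>))" .
  have "(real n - 1) * (a - \<phi>) * pool_cdf lam n q a \<phi> t = (a - \<phi>) * (real n * (lam * lratio n ?z + q / ?z ^ n))"
    using tp by (simp add: pool_cdf_def)
  also have "\<dots> \<le> (a - \<phi>) * (real n * (lam * ((t - a) / (real (Suc n) * (a - \<phi>))) + 0))"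
    using tp lam0 l \<open>q / ?z ^ n \<le> 0\<close> by (intro mult_left_mono add_mono) auto
  also have "\<dots> = real n / real (Suc n) * (lam * (t - a))" using tp by (simp del: of_nat_Suc)
  also have "\<dots> \<le> 1 * (lam * (t - a))" using lam0 tp by (intro mult_right_mono) auto
  finally show ?thesis using tp by simp
qed

lemma exists_distribution:
  assumes "G b \<le> 1"
  shows "\<exists>D. real_distribution D \<and> (\<forall>t\<le>c. cdf D t = 0) \<and> (\<forall>t\<in>{c..b}. cdf D t = G t)"
  using assms by (intro exists_real_distribution_cdf cb G_continuous G_mono G_c)

lemma hybrid_optimal:
  assumes D: "real_distribution D" and low: "\<forall>t\<le>c. cdf D t = 0" and cdf_D: "\<forall>t\<in>{c..b}. cdf D t = G t"
    and top: "G b = 1 \<or> n = 1 \<and> c = a \<and> vs = b"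
  shows "robustly_optimal lam n a b (random_mechanism D (hybrid n a vs))"
proof -
  interpret D: real_distribution D by fact
  \<comment> \<open>The right-hand side of the differential equation, written with
    \<open>cdf D\<close> itself, so that the conditions \<open>spa\<close> and \<open>pool\<close>
    become algebraic identities.\<close>
  define g where "g t = (if t \<le> c then 0 else if t \<le> vs
      then (lam * (t - c) - (real n - 1) * c * cdf D t) / (t * (t - c))
      else real n * (lam * (t - a) - (real n - 1) * (a - \<phi>) * cdf D t)
       / ((real n - 1) * (t - a) * (t - \<phi>)))" for t
  have ab: "a < b" using ac cb by simp
  have cdf_spa: "cdf D t = spa_cdf lam n c t" if "c \<le> t" "t \<le> vs" for t
    using cdf_D that vsb by (simp add: G_def)
  have cdf_pool: "cdf D t = pool_cdf lam n q a \<phi> t" if "vs < t" "t \<le> b" for t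
    using cdf_D that cvs by (simp add: G_def)
  have m: "cdf D \<in> borel_measurable borel"
    by (intro borel_measurable_mono monoI D.cdf_nondecreasing)
  have "hybrid_density D n a b vs g {c, vs}"
  proof (intro hybrid_density.intro hybrid_auction.intro hybrid_auction_axioms.intro hybrid_density_axioms.intro)
    show "cdf D a = 0" using low ac by simp
    show "continuous_on {a..b} (cdf D)"
    proof -
      have "continuous_on ({a..c} \<union> {c..b}) (\<lambda>t. if t \<le> c then 0 else G t)"
        by (intro continuous_on_If G_continuous continuous_on_const) (auto simp: G_c)
      moreover have "{a..c} \<union> {c..b} = {a..b}" using ac cb by auto
      ultimately have "continuous_on {a..b} (\<lambda>t. if t \<le> c then 0 else G t)" by simp
      then show ?thesis
        by (rule continuous_on_cong[THEN iffD1, rotated 2]) (use low cdf_D in auto)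
    qed
    show "g \<in> borel_measurable borel"
      unfolding g_def[abs_def] using m by measurable
    fix t assume t: "t \<in> {a<..<b}"
    then show "0 \<le> g t"
      using spa_cdf_deriv_nonneg[of t] pool_cdf_deriv_nonneg[of t] cdf_spa[of t] cdf_pool[of t]
      by (auto simp: g_def)
  next
    fix t assume t: "t \<in> {a<..<b} - {c, vs}"
    then consider "t < c" | "c < t" "t < vs" | "vs < t" "t < b" using cvs by fastforce
    then show "(cdf D has_real_derivative g t) (at t)"
    proof cases
      case 1
      have "(cdf D has_real_derivative 0) (at t)"
        by (rule has_field_derivative_transform_within_open[where S="{..<c}" and f="\<lambda>_. 0"])
          (use 1 low in auto)
      then show ?thesis using 1 by (simp add: g_def)
    next
      case 2
      have "(cdf D has_real_derivative
         (lam * (t - c) - (real n - 1) * c * spa_cdf lam n c t) / (t * (t - c))) (at t)"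
        by (rule has_field_derivative_transform_within_open[OF spa_cdf_deriv[OF 2], where S="{c<..<vs}"])
          (use 2 cdf_spa in auto)
      then show ?thesis using 2 cdf_spa[of t] by (simp add: g_def)
    next
      case 3
      have "(cdf D has_real_derivative
         real n * (lam * (t - a) - (real n - 1) * (a - \<phi>) * pool_cdf lam n q a \<phi> t)
           / ((real n - 1) * (t - a) * (t - \<phi>))) (at t)"
        by (rule has_field_derivative_transform_within_open[OF pool_cdf_deriv[OF 3], where S="{vs<..<b}"])
          (use 3 cdf_pool in auto)
      then show ?thesis using 3 cvs cdf_pool[of t] by (simp add: g_def)
    qed
  qed (use D n1 a0 ab ac cvs vsb in auto)
  then show ?thesis
  proof (rule robustly_optimal_hybrid[OF _ const_virtual_axioms])
    show "0 \<le> lam" using lam0 by simp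
    show "\<And>t. a < t \<Longrightarrow> t < c \<Longrightarrow> g t = 0" by (simp add: g_def)
    show "cdf D b = 1 \<or> n = 1 \<and> c = a \<and> vs = b" using top cdf_D cb by simp
  next
    fix t assume t: "c < t" "t < vs"
    then have "0 < t" "0 < t - c" using \<phi>0 \<phi>c by auto
    then show "t * (t - c) * g t + (real n - 1) * c * cdf D t = lam * (t - c)"
      using t by (simp add: g_def)
  next
    fix t assume t: "vs < t" "t < b"
    have ca: "c = a" and n2: "2 \<le> n" using t pool_c pool_n by auto
    have tp: "0 < t - a" "0 < t - \<phi>" "0 < real n - 1" "0 < real n" using t cvs ca \<phi>c n2 by auto
    have g: "g t = real n * (lam * (t - a) - (real n - 1) * (a - \<phi>) * cdf D t)
       / ((real n - 1) * (t - a) * (t - \<phi>))" using t cvs by (simp add: g_def)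
    have "(M / N * x * y) * (N * (l - P) / (M * x * y)) + P = l"
      if "0 < x" "0 < y" "0 < M" "0 < N" for x y M N l P :: real
      using that by (simp add: field_simps)
    from this[OF tp] show "(real n - 1) / real n * (t - a) * (t - \<phi>) * g t
        + (real n - 1) * (a - \<phi>) * cdf D t = lam * (t - a)" unfolding g .
  qed (use cvs spa_\<phi> pool_c low in auto)
qed

end

section \<open>The three regimes\<close>

lemma integral_ltail:
  fixes c x y :: real
  assumes "\<phi> < c" "c \<le> x" "x \<le> y"
  shows "integral {x..y} (\<lambda>t. (t - c) ^ m / (t - \<phi>) ^ (m + 1))
    = ltail m ((y - c) / (y - \<phi>)) - ltail m ((x - c) / (x - \<phi>))"
  using ltail_has_integral[OF assms] by (rule integral_unique)

lemma integral_spa: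
  fixes c y :: real
  assumes "1 \<le> n" "0 < c" "c \<le> y"
  shows "integral {c..y} (\<lambda>t. (t - c) ^ (n - 1) / t ^ n) = ltail (n - 1) ((y - c) / y)"
  using integral_ltail[of 0 c c y "n - 1"] assms by simp

text \<open>The two summands integrate to increments of \<open>ltail (n - 1)\<close> and
  \<open>ltail n\<close>. Rewriting the former by \<open>ltail_pred\<close> leaves a difference of
  n-th powers over n and the coefficient 1 - (1 - lam) = lam.\<close>

lemma integral_pool:
  fixes c x y :: real
  assumes "1 \<le> n" "0 < c" "c \<le> x" "x \<le> y"
  shows "integral {x..y} (\<lambda>t. (t - c) ^ (n - 1) / t ^ n - (1 - lam) * ((t - c) ^ n / t ^ (n + 1)))
    = (((y - c) / y) ^ n - ((x - c) / x) ^ n) / real n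
      + lam * (ltail n ((y - c) / y) - ltail n ((x - c) / x))"
proof (rule integral_unique)
  let ?Y = "(y - c) / y" and ?X = "(x - c) / x"
  have "((\<lambda>t. (t - c) ^ (n - 1) / t ^ n) has_integral ltail (n - 1) ?Y - ltail (n - 1) ?X) {x..y}"
    using ltail_has_integral[of 0 c x y "n - 1"] assms by simp
  moreover have "((\<lambda>t. (1 - lam) * ((t - c) ^ n / t ^ (n + 1))) has_integral
      (1 - lam) * (ltail n ?Y - ltail n ?X)) {x..y}"
    using ltail_has_integral[of 0 c x y n] assms by (intro has_integral_mult_right) simp
  ultimately have "((\<lambda>t. (t - c) ^ (n - 1) / t ^ n - (1 - lam) * ((t - c) ^ n / t ^ (n + 1))) has_integral
      (ltail (n - 1) ?Y - ltail (n - 1) ?X) - (1 - lam) * (ltail n ?Y - ltail n ?X)) {x..y}"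
    by (rule has_integral_diff)
  moreover have "(ltail (n - 1) ?Y - ltail (n - 1) ?X) - (1 - lam) * (ltail n ?Y - ltail n ?X)
      = (?Y ^ n - ?X ^ n) / real n + lam * (ltail n ?Y - ltail n ?X)"
    unfolding ltail_pred[OF assms(1)] by (simp add: algebra_simps diff_divide_distrib)
  ultimately show "((\<lambda>t. (t - c) ^ (n - 1) / t ^ n - (1 - lam) * ((t - c) ^ n / t ^ (n + 1))) has_integral
      (?Y ^ n - ?X ^ n) / real n + lam * (ltail n ?Y - ltail n ?X)) {x..y}"
    by simp
qed

lemma lratio_unique:
  assumes "0 < X"
  shows "\<exists>!k. 0 < k \<and> k < 1 \<and> lratio m (1 - k) = X"
proof -
  obtain u where u: "0 < u" "u < 1" "lratio m u = X" using lratio_surj[OF assms] by blast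
  show ?thesis
  proof (rule ex1I[of _ "1 - u"])
    fix k assume k: "0 < k \<and> k < 1 \<and> lratio m (1 - k) = X"
    then have "1 - k = u" using lratio_eq_iff[of "1 - k" u m] u by simp
    then show "k = 1 - u" by simp
  qed (use u in simp)
qed

text \<open>For c = k b one has (b - c) / b = 1 - k, so the defining equation says that
  \<open>spa_cdf\<close> reaches 1 at b. Strict monotonicity of \<open>lratio\<close> makes k
  unique.\<close>

lemma k_low_props:
  assumes n: "1 \<le> n" and lam: "0 < lam"
  shows "0 < k_low lam n" "k_low lam n < 1" "lam * lratio (n - 1) (1 - k_low lam n) = 1"
proof -
  have iff: "lam * integral {k..1} (\<lambda>t. (t - k) ^ (n - 1) / t ^ n) = (1 - k) ^ (n - 1)
      \<longleftrightarrow> lratio (n - 1) (1 - k) = 1 / lam" if "0 < k" "k < 1" for k :: real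
  proof -
    have "0 < (1 - k) ^ (n - 1)" using that by simp
    then show ?thesis
      using integral_spa[of n k 1] that n lam by (auto simp: lratio_def field_simps)
  qed
  have "k_low lam n = (THE k. 0 < k \<and> k < 1 \<and> lratio (n - 1) (1 - k) = 1 / lam)"
    unfolding k_low_def using iff by (metis (no_types, lifting))
  moreover have "\<exists>!k. 0 < k \<and> k < 1 \<and> lratio (n - 1) (1 - k) = 1 / lam"
    using lam by (intro lratio_unique) simp
  ultimately have "0 < k_low lam n \<and> k_low lam n < 1 \<and> lratio (n - 1) (1 - k_low lam n) = 1 / lam"
    using theI'[of "\<lambda>k. 0 < k \<and> k < 1 \<and> lratio (n - 1) (1 - k) = 1 / lam"] by simp
  then show "0 < k_low lam n" "k_low lam n < 1" "lam * lratio (n - 1) (1 - k_low lam n) = 1"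
    using lam by auto
qed

text \<open>Once the powers of 1 - k are collected, the defining equation says that
  \<open>pool_cdf\<close> with q = 0 reaches 1 at b when (b - a) / (b - \<phi>) = 1 - k.\<close>

lemma k_high_props:
  assumes n: "2 \<le> n" and lam: "0 < lam"
  shows "0 < k_high lam n" "k_high lam n < 1"
    "lam * lratio n (1 - k_high lam n) = (real n - 1) / real n"
proof -
  define X where "X = (real n - 1) / (real n * lam)"
  have X: "0 < X" using n lam by (simp add: X_def)
  have iff: "integral {k..1} (\<lambda>t. (t - k) ^ (n - 1) / t ^ n - (1 - lam) * ((t - k) ^ n / t ^ (n + 1))) = (1 - k) ^ n
      \<longleftrightarrow> lratio n (1 - k) = X" if k: "0 < k" "k < 1" for k :: real
  proof -
    define u where "u = (1 - k) ^ n"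
    have u: "0 < u" using k by (simp add: u_def)
    have "integral {k..1} (\<lambda>t. (t - k) ^ (n - 1) / t ^ n - (1 - lam) * ((t - k) ^ n / t ^ (n + 1)))
        = u / real n + lam * ltail n (1 - k)"
      using integral_pool[of n k k 1 lam] k n by (simp add: u_def)
    moreover have "lratio n (1 - k) = ltail n (1 - k) / u" by (simp add: lratio_def u_def)
    moreover have "u / real n + lam * L = u \<longleftrightarrow> L / u = X" for L
      using u n lam by (auto simp: X_def field_simps)
    ultimately show ?thesis by (simp add: u_def)
  qed
  have "k_high lam n = (THE k. 0 < k \<and> k < 1 \<and> lratio n (1 - k) = X)"
  proof -
    have "n \<noteq> 1" using n by simp
    then show ?thesis
      unfolding k_high_def if_not_P[OF \<open>n \<noteq> 1\<close>] using iff
      by (intro arg_cong[where f=The] ext) (auto simp del: One_nat_def)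
  qed
  then have "0 < k_high lam n \<and> k_high lam n < 1 \<and> lratio n (1 - k_high lam n) = X"
    using theI'[OF lratio_unique[OF X, of n]] by simp
  then show "0 < k_high lam n" "k_high lam n < 1"
    "lam * lratio n (1 - k_high lam n) = (real n - 1) / real n"
    using lam by (auto simp: X_def)
qed

lemma Phi_star_eq:
  assumes "1 \<le> n" "0 < r" "r \<le> v"
  shows "Phi_star lam n r v = spa_cdf lam n r v"
  using assms integral_spa[of n r v]
  by (cases "v = r") (auto simp: Phi_star_def spa_cdf_def lratio_def power_divide)

lemma Psi_star_eq:
  assumes "2 \<le> n" "\<phi> < a" "a \<le> v"
  shows "Psi_star lam n a \<phi> v = pool_cdf lam n 0 a \<phi> v"
  using assms integral_ltail[of \<phi> a a v n]
  by (cases "v = a") (auto simp: Psi_star_def pool_cdf_def lratio_def power_divide)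

section \<open>The two extreme regimes\<close>

lemma random_mechanism_cong:
  assumes "\<And>v i. (\<lambda>r. fst (f r) v i) \<in> borel_measurable D" "\<And>v i. (\<lambda>r. snd (f r) v i) \<in> borel_measurable D"
    and "\<And>v i. (\<lambda>r. fst (h r) v i) \<in> borel_measurable D" "\<And>v i. (\<lambda>r. snd (h r) v i) \<in> borel_measurable D"
    and "AE r in D. f r = h r"
  shows "random_mechanism D f = random_mechanism D h"
proof -
  have "(\<integral>r. fst (f r) v i \<partial>D) = (\<integral>r. fst (h r) v i \<partial>D)"
    "(\<integral>r. snd (f r) v i \<partial>D) = (\<integral>r. snd (h r) v i \<partial>D)" for v i
    using assms by (auto intro!: integral_cong_AE elim!: eventually_mono)
  then show ?thesis by (simp add: random_mechanism_def)
qed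

lemma measurable_threshold:
  assumes "sets D = sets borel"
  shows "(\<lambda>r. fst (SPA n r) v i) \<in> borel_measurable D" "(\<lambda>r. snd (SPA n r) v i) \<in> borel_measurable D"
    "(\<lambda>r. fst (POOL n a r) v i) \<in> borel_measurable D" "(\<lambda>r. snd (POOL n a r) v i) \<in> borel_measurable D"
    "(\<lambda>r. fst (hybrid n a vs r) v i) \<in> borel_measurable D" "(\<lambda>r. snd (hybrid n a vs r) v i) \<in> borel_measurable D"
proof -
  note [measurable_cong] = assms
  have [measurable]: "(\<lambda>r. fst (SPA n r) v i) \<in> borel_measurable D" "(\<lambda>r. snd (SPA n r) v i) \<in> borel_measurable D"
    "(\<lambda>r. fst (POOL n a r) v i) \<in> borel_measurable D" "(\<lambda>r. snd (POOL n a r) v i) \<in> borel_measurable D"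
    unfolding SPA_def POOL_def fst_conv snd_conv by measurable
  show "(\<lambda>r. fst (SPA n r) v i) \<in> borel_measurable D" "(\<lambda>r. snd (SPA n r) v i) \<in> borel_measurable D"
    "(\<lambda>r. fst (POOL n a r) v i) \<in> borel_measurable D" "(\<lambda>r. snd (POOL n a r) v i) \<in> borel_measurable D"
    by measurable
  have "(\<lambda>r. if r \<le> vs then fst (SPA n r) v i else fst (POOL n a r) v i) \<in> borel_measurable D"
    "(\<lambda>r. if r \<le> vs then snd (SPA n r) v i else snd (POOL n a r) v i) \<in> borel_measurable D"
    by measurable
  then show "(\<lambda>r. fst (hybrid n a vs r) v i) \<in> borel_measurable D" "(\<lambda>r. snd (hybrid n a vs r) v i) \<in> borel_measurable D"
    by (simp_all add: hybrid_def if_distrib[of fst] if_distrib[of snd] if_distribR cong: if_cong)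
qed

lemma low_reserve_case:
  assumes n: "1 \<le> n" and lam: "0 < lam" and ab: "0 \<le> a" "a < b" and k: "a / b \<le> k_low lam n"
  defines "r \<equiv> k_low lam n * b"
  shows "\<exists>D. has_cdf_on D (Phi_star lam n r) {..b}"
    and "has_cdf_on D (Phi_star lam n r) {..b} \<Longrightarrow> robustly_optimal lam n a b (random_mechanism D (SPA n))"
proof -
  note kl = k_low_props[OF n lam]
  have b0: "0 < b" using ab by simp
  have r: "a \<le> r" "r < b" "0 < r"
    using k kl b0 by (auto simp: r_def field_simps)
  interpret T: threshold_cdf n a b r 0 lam b 0
    by unfold_locales (use n lam ab r in auto)
  have GT: "T.G t = spa_cdf lam n r t" if "t \<le> b" for t
    using that by (simp add: T.G_def)
  have "(b - r) / b = 1 - k_low lam n" using b0 by (simp add: r_def field_simps)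
  then have top: "T.G b = 1" using kl(3) by (simp add: GT spa_cdf_def)
  have Phi: "Phi_star lam n r t = T.G t" if "r \<le> t" "t \<le> b" for t
    using Phi_star_eq[OF n r(3) that(1)] GT that by simp
  have Phi0: "Phi_star lam n r t = 0" if "t \<le> r" for t
    using that by (simp add: Phi_star_def)
  show "\<exists>D. has_cdf_on D (Phi_star lam n r) {..b}"
  proof -
    obtain D where D: "real_distribution D" "\<forall>t\<le>r. cdf D t = 0" "\<forall>t\<in>{r..b}. cdf D t = T.G t"
      using T.exists_distribution top by auto
    have "cdf D v = Phi_star lam n r v" if "v \<le> b" for v
      using D(2,3) Phi[of v] Phi0[of v] that by (cases "v \<le> r") auto
    with D(1) show ?thesis
      by (intro exI[of _ D]) (simp add: has_cdf_on_def)
  qed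
  assume "has_cdf_on D (Phi_star lam n r) {..b}"
  then have D: "real_distribution D" and cdf: "\<And>v. v \<le> b \<Longrightarrow> cdf D v = Phi_star lam n r v"
    by (auto simp: has_cdf_on_def)
  interpret D: real_distribution D by fact
  have "robustly_optimal lam n a b (random_mechanism D (hybrid n a b))"
    using cdf r Phi Phi0 top by (intro T.hybrid_optimal D) auto
  moreover have "random_mechanism D (hybrid n a b) = random_mechanism D (SPA n)"
  proof (intro random_mechanism_cong measurable_threshold D.events_eq_borel)
    have "D.prob {..b} = 1" using cdf[of b] Phi[of b] top r by (simp add: cdf_def2)
    then have "AE r in D. r \<in> {..b}" by (rule D.AE_prob_1)
    then show "AE r in D. hybrid n a b r = SPA n r"
      by eventually_elim (simp add: hybrid_def)
  qed
  ultimately show "robustly_optimal lam n a b (random_mechanism D (SPA n))" by simp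
qed

lemma pooling_case:
  assumes n: "1 \<le> n" and lam: "0 < lam" and ab: "0 \<le> a" "a < b" and k: "k_high lam n \<le> a / b"
  defines "\<phi> \<equiv> (a - k_high lam n * b) / (1 - k_high lam n)"
  shows "\<exists>D. has_cdf_on D (Psi_star lam n a \<phi>) {a..b}"
    and "has_cdf_on D (Psi_star lam n a \<phi>) {a..b} \<Longrightarrow> robustly_optimal lam n a b (random_mechanism D (POOL n a))"
proof -
  have b0: "0 < b" using ab by simp
  have "a / b < 1" using ab b0 by simp
  \<comment> \<open>For a single buyer \<open>k_high\<close> is 1, so this regime is empty.\<close>
  then have "n \<noteq> 1" using k by (auto simp: k_high_def)
  then have n2: "2 \<le> n" using n by simp
  note kh = k_high_props[OF n2 lam]
  let ?k = "k_high lam n"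
  have \<phi>0: "0 \<le> \<phi>" using k kh b0 by (auto simp: \<phi>_def field_simps)
  have e: "a - \<phi> = ?k * (b - a) / (1 - ?k)" using kh by (simp add: \<phi>_def field_simps)
  have \<phi>a: "\<phi> < a"
  proof -
    have "0 < a - \<phi>" unfolding e using kh ab by simp
    then show ?thesis by simp
  qed
  have a0: "0 < a" using \<phi>0 \<phi>a by simp
  interpret T: threshold_cdf n a b a \<phi> lam a 0
    by unfold_locales (use n n2 lam ab \<phi>0 \<phi>a in auto)
  have GT: "T.G t = pool_cdf lam n 0 a \<phi> t" if "a \<le> t" for t
    using that T.join' ab by (cases "t = a") (auto simp: T.G_def)
  \<comment> \<open>The value \<phi>_0 is the one for which the quotient at b equals 1 - k_h, hence
    for which the total mass is 1.\<close>
  have "b - \<phi> = (b - a) / (1 - ?k)" using kh by (simp add: \<phi>_def field_simps)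
  then have "(b - a) / (b - \<phi>) = 1 - ?k" using ab kh by simp
  then have top: "T.G b = 1"
    using kh(3) n2 ab by (simp add: GT pool_cdf_def)
  have Psi: "Psi_star lam n a \<phi> t = T.G t" if "a \<le> t" "t \<le> b" for t
    using Psi_star_eq[OF n2 \<phi>a that(1)] GT that by simp
  show "\<exists>D. has_cdf_on D (Psi_star lam n a \<phi>) {a..b}"
    using T.exists_distribution top Psi by (auto simp: has_cdf_on_def)
  assume "has_cdf_on D (Psi_star lam n a \<phi>) {a..b}"
  then have D: "real_distribution D" and cdf: "\<And>v. a \<le> v \<Longrightarrow> v \<le> b \<Longrightarrow> cdf D v = T.G v"
    using Psi by (auto simp: has_cdf_on_def)
  interpret D: real_distribution D by fact
  have cdf_a: "cdf D a = 0" using cdf[of a] ab T.G_c by simp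
  have low: "cdf D t = 0" if "t \<le> a" for t
    using D.cdf_nondecreasing[OF that] D.cdf_nonneg[of t] cdf_a by simp
  have "robustly_optimal lam n a b (random_mechanism D (hybrid n a a))"
    using cdf low top by (intro T.hybrid_optimal D) auto
  moreover have "random_mechanism D (hybrid n a a) = random_mechanism D (POOL n a)"
  proof (intro random_mechanism_cong measurable_threshold D.events_eq_borel)
    have "{..a} \<in> null_sets D"
      using cdf_a by (auto simp: cdf_def2 null_sets_def D.emeasure_eq_measure)
    then have "AE r in D. r \<notin> {..a}" by (rule AE_not_in)
    then show "AE r in D. hybrid n a a r = POOL n a r"
      by eventually_elim (simp add: hybrid_def)
  qed
  ultimately show "robustly_optimal lam n a b (random_mechanism D (POOL n a))" by simp
qed

text \<open>
  In the coordinate \<open>w = 1 - a / v\<^sup>*\<close>, eliminating \<open>\<alpha>\<close> from the two equations leaves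
  \<open>switch_fun w = switch_level (1 - a / b)\<close>, whose left-hand side is strictly decreasing.
\<close>

definition switch_fun :: "real \<Rightarrow> nat \<Rightarrow> real \<Rightarrow> real" where
  "switch_fun lam n w = lam * ((real n - 1) / real n * w * ltail (n - 1) w - ltail n w)"

definition switch_level :: "real \<Rightarrow> nat \<Rightarrow> real \<Rightarrow> real" where
  "switch_level lam n u = (real n - 1) / real n * u ^ n - lam * ltail n u"

lemma switch_fun_deriv:
  assumes n: "1 \<le> n" and w: "w < 1"
  shows "(switch_fun lam n has_real_derivative
     lam * ((real n - 1) / real n * ltail (n - 1) w - w ^ n / (real n * (1 - w)))) (at w)"
proof -
  have d: "(switch_fun lam n has_real_derivative
      lam * (((real n - 1) / real n * 1) * ltail (n - 1) w
        + w ^ (n - 1) / (1 - w) * ((real n - 1) / real n * w) - w ^ n / (1 - w))) (at w)"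
    unfolding switch_fun_def[abs_def]
    by (intro DERIV_cmult DERIV_diff DERIV_mult DERIV_ident ltail_deriv w)
  have e: "w ^ (n - 1) / (1 - w) * ((real n - 1) / real n * w) - w ^ n / (1 - w) = - (w ^ n / (real n * (1 - w)))"
  proof -
    have e: "w ^ n = w ^ (n - 1) * w" using n by (cases n) auto
    have "y / d * ((N - 1) / N * w) - y * w / d = - (y * w / (N * d))"
      if "0 < N" "0 < d" for y d N :: real
      using that by (simp add: field_simps)
    from this[of "real n" "1 - w" "w ^ (n - 1)"] show ?thesis using n w unfolding e by simp
  qed
  show ?thesis
    by (rule DERIV_cong[OF d]) (simp only: add_diff_eq[symmetric] e mult_1_right add_uminus_conv_diff)
qed

text \<open>By \<open>ltail_le\<close> the positive term of the derivative is at most (n - 1)/n of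
  the negative one.\<close>

lemma switch_fun_strict_antimono:
  assumes n: "1 \<le> n" and lam: "0 < lam" and xy: "0 \<le> x" "x < y" "y < 1"
  shows "switch_fun lam n y < switch_fun lam n x"
proof (rule DERIV_neg_imp_decreasing_open[OF xy(2)])
  fix w assume w: "x < w" "w < y"
  then have w01: "0 < w" "w < 1" using xy by auto
  have s: "real (Suc (n - 1)) = real n" "Suc (n - 1) = n" using n by auto
  have "(real n - 1) / real n * ltail (n - 1) w \<le> (real n - 1) / real n * (w ^ n / (real n * (1 - w)))"
    using ltail_le[of w "n - 1"] w01 n unfolding s by (intro mult_left_mono) auto
  also have "\<dots> < 1 * (w ^ n / (real n * (1 - w)))"
    using w01 n by (intro mult_strict_right_mono) auto
  finally have "lam * ((real n - 1) / real n * ltail (n - 1) w - w ^ n / (real n * (1 - w))) < 0"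
    using lam by (simp add: mult_pos_neg)
  then show "\<exists>d. (switch_fun lam n has_real_derivative d) (at w) \<and> d < 0"
    using switch_fun_deriv[OF n w01(2)] by blast
next
  show "continuous_on {x..y} (switch_fun lam n)"
    using xy unfolding switch_fun_def[abs_def]
    by (intro continuous_intros ltail_continuous) auto
qed

lemma switch_fun_zero: "switch_fun lam n 0 = 0"
  by (simp add: switch_fun_def)

lemma switch_fun_inj:
  assumes "1 \<le> n" "0 < lam" "0 \<le> x" "x < 1" "0 \<le> y" "y < 1" "switch_fun lam n x = switch_fun lam n y"
  shows "x = y"
  using switch_fun_strict_antimono[of n lam x y] switch_fun_strict_antimono[of n lam y x] assms
  by (cases x y rule: linorder_cases) auto

section \<open>The intermediate regime\<close>

locale intermediate =
  fixes n :: nat and lam a b :: real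
  assumes n1: "1 \<le> n" and lam0: "0 < lam" and a_nonneg: "0 \<le> a" and ab: "a < b"
    and kl: "k_low lam n \<le> a / b" and kh: "a / b \<le> k_high lam n"
begin

definition U :: real where "U = (b - a) / b"
text \<open>The constant of integration of the pooling branch, fixed by total mass 1 at b: q / U^n
  is what \<open>lam * lratio n U\<close> lacks to (n - 1)/n.\<close>

definition q :: real where "q = switch_level lam n U"

lemma a0: "0 < a"
proof -
  have "0 < a / b" using kl k_low_props(1)[OF n1 lam0] by simp
  then show ?thesis using a_nonneg ab by (simp add: zero_less_divide_iff)
qed

lemma U_bounds: "0 < U" "U < 1"
  using a0 ab by (auto simp: U_def)

lemma U_eq: "U = 1 - a / b"
  using a0 ab by (simp add: U_def field_simps)

lemma lratio_U_le: "lam * lratio (n - 1) U \<le> 1"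
proof -
  note k = k_low_props[OF n1 lam0]
  have "lam * lratio (n - 1) U \<le> lam * lratio (n - 1) (1 - k_low lam n)"
    using kl k lam0 U_bounds unfolding U_eq by (intro mult_left_mono lratio_mono) auto
  then show ?thesis using k(3) by simp
qed

lemma q_eq: "q = U ^ n * ((real n - 1) / real n - lam * lratio n U)"
proof -
  have e: "k * V - lam * K = V * (k - lam * (K / V))" if "0 < V" for k V K :: real
    using that by (simp add: field_simps)
  show ?thesis
    unfolding q_def switch_level_def lratio_def by (rule e) (use U_bounds in simp)
qed

text \<open>Uses a/b \<le> k_h: at U = 1 - k_h the bracket in \<open>q_eq\<close> vanishes, and a
  larger U only lowers it. For n = 1 the level is minus a nonnegative tail.\<close>

lemma q_le: "q \<le> 0"
proof (cases "n = 1")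
  case True
  then show ?thesis
    using lam0 U_bounds unfolding q_def switch_level_def by (simp add: ltail_nonneg)
next
  case False
  then have n2: "2 \<le> n" using n1 by simp
  note k = k_high_props[OF n2 lam0]
  have "lam * lratio n (1 - k_high lam n) \<le> lam * lratio n U"
    using kh k lam0 U_bounds unfolding U_eq by (intro mult_left_mono lratio_mono) auto
  then show ?thesis unfolding q_eq using k(3) U_bounds by (intro mult_nonneg_nonpos) auto
qed

lemma q_less:
  assumes "2 \<le> n" "a / b < k_high lam n"
  shows "q < 0"
proof -
  note k = k_high_props[OF assms(1) lam0]
  have "lratio n (1 - k_high lam n) < lratio n U"
    using assms k U_bounds unfolding U_eq by (intro lratio_strict_mono) auto
  then have "lam * lratio n (1 - k_high lam n) < lam * lratio n U" using lam0 by simp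
  then show ?thesis unfolding q_eq using k(3) U_bounds by (intro mult_pos_neg) auto
qed

text \<open>Uses a/b \<ge> k_l, the other end of the intermediate value argument: up to the common
  term with \<open>ltail n U\<close> and a factor (n - 1)/n, this is \<open>lratio_U_le\<close>
  multiplied by U^n.\<close>

lemma switch_fun_U_le: "switch_fun lam n U \<le> q"
proof -
  have "lam * (U * ltail (n - 1) U) \<le> U ^ n"
  proof -
    have "lam * lratio (n - 1) U * U ^ n \<le> 1 * U ^ n"
      using lratio_U_le U_bounds by (intro mult_right_mono) auto
    moreover have "lratio (n - 1) U * U ^ n = U * ltail (n - 1) U"
      using U_bounds n1 by (cases n) (auto simp: lratio_def)
    ultimately show ?thesis by (simp add: mult.assoc)
  qed
  then have "(real n - 1) / real n * (lam * (U * ltail (n - 1) U)) \<le> (real n - 1) / real n * U ^ n"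
    using n1 by (intro mult_left_mono) auto
  then show ?thesis by (simp add: switch_fun_def q_def switch_level_def algebra_simps)
qed

text \<open>In the second equation \<alpha> occurs only through w^n (1 - n \<alpha>), which is w
  times the left-hand side of the first. Substituting the first equation eliminates it.\<close>

lemma intermediate_solution_iff:
  assumes vs: "a \<le> vs" "vs \<le> b"
  defines "w \<equiv> (vs - a) / vs"
  shows "intermediate_solution lam n a b vs \<alpha> \<longleftrightarrow>
     w ^ (n - 1) * (1 - real n * \<alpha>) = lam * ltail (n - 1) w \<and>
     switch_fun lam n w = q"
proof -
  have w: "(vs - a) ^ m / vs ^ m = w ^ m" for m by (simp add: w_def power_divide)
  have u: "(b - a) ^ n / b ^ n = U ^ n" by (simp add: U_def power_divide)
  define A where "A = w ^ (n - 1) * (1 - real n * \<alpha>)"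
  have "w ^ n = w * w ^ (n - 1)" using n1 by (cases n) auto
  then have wA: "w * A = w ^ n * (1 - real n * \<alpha>)" by (simp add: A_def)
  have n0: "real n > 0" using n1 by simp
  have e2: "U ^ n - w ^ n * (1 - (real n - 1) * \<alpha>) = (U ^ n - w ^ n) / real n + lam * (ltail n U - ltail n w)
     \<longleftrightarrow> (real n - 1) / real n * (w * A) - lam * ltail n w = q"
    unfolding wA q_def switch_level_def using n0 by (simp add: field_simps) argo
  have "intermediate_solution lam n a b vs \<alpha> \<longleftrightarrow> A = lam * ltail (n - 1) w \<and>
     U ^ n - w ^ n * (1 - (real n - 1) * \<alpha>) = (U ^ n - w ^ n) / real n + lam * (ltail n U - ltail n w)"
    unfolding intermediate_solution_def A_def
    using vs integral_spa[OF n1 a0 vs(1)] integral_pool[OF n1 a0 vs, of lam]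
    by (simp only: w u w_def[symmetric] U_def[symmetric] simp_thms)
  also have "\<dots> \<longleftrightarrow> A = lam * ltail (n - 1) w \<and> switch_fun lam n w = q"
  proof (rule conj_cong[OF refl])
    assume A: "A = lam * ltail (n - 1) w"
    show "(U ^ n - w ^ n * (1 - (real n - 1) * \<alpha>) = (U ^ n - w ^ n) / real n + lam * (ltail n U - ltail n w))
       = (switch_fun lam n w = q)"
      unfolding e2 A switch_fun_def by (simp add: algebra_simps)
  qed
  finally show ?thesis unfolding A_def .
qed

lemma switch_point_bounds:
  assumes "a \<le> vs" "vs \<le> b"
  shows "0 \<le> (vs - a) / vs" "(vs - a) / vs \<le> U" "(vs - a) / vs < 1"
proof -
  have v0: "0 < vs" using assms a0 by simp
  have e: "(vs - a) / vs = 1 - a / vs" using v0 by (simp add: field_simps)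
  show "0 \<le> (vs - a) / vs" using assms a0 by simp
  have "a / b \<le> a / vs" using assms a0 v0 by (intro divide_left_mono) auto
  then show "(vs - a) / vs \<le> U" unfolding e U_eq by simp
  then show "(vs - a) / vs < 1" using U_bounds by simp
qed

lemma switch_point_inj:
  assumes "a \<le> vs" "a \<le> vs'" "(vs - a) / vs = (vs' - a) / vs'"
  shows "vs = vs'"
  using assms a0 by (simp add: field_simps)

lemma solution_unique:
  assumes "intermediate_solution lam n a b vs \<alpha>" "intermediate_solution lam n a b vs' \<alpha>'"
  shows "vs = vs'"
proof -
  have b: "a \<le> vs" "vs \<le> b" "a \<le> vs'" "vs' \<le> b" using assms by (auto simp: intermediate_solution_def)
  then have "switch_fun lam n ((vs - a) / vs) = switch_fun lam n ((vs' - a) / vs')"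
    using assms intermediate_solution_iff[OF b(1,2)] intermediate_solution_iff[OF b(3,4)] by simp
  then have "(vs - a) / vs = (vs' - a) / vs'"
    by (rule switch_fun_inj[OF n1 lam0 switch_point_bounds(1,3)[OF b(1,2)] switch_point_bounds(1,3)[OF b(3,4)]])
  then show ?thesis by (rule switch_point_inj[OF b(1,3)])
qed

text \<open>\<open>switch_fun\<close> is 0 \<ge> q at w = 0, where vs = a, and at most q at w = U,
  where vs = b. The first equation is then solved for \<alpha>.\<close>

lemma solution_exists: "\<exists>vs \<alpha>. intermediate_solution lam n a b vs \<alpha>"
proof -
  have c: "continuous_on {0..U} (switch_fun lam n)"
    using U_bounds unfolding switch_fun_def[abs_def]
    by (intro continuous_intros ltail_continuous) auto
  obtain w where w: "0 \<le> w" "w \<le> U" "switch_fun lam n w = q"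
    using IVT2'[of "switch_fun lam n" U q 0] c switch_fun_U_le q_le U_bounds by (auto simp: switch_fun_zero)
  define vs where "vs = a / (1 - w)"
  have w1: "w < 1" using w U_bounds by simp
  have vs: "(vs - a) / vs = w" using w1 a0 by (simp add: vs_def field_simps)
  have "a \<le> vs" using w w1 a0 by (simp add: vs_def field_simps)
  moreover have "vs \<le> b"
  proof -
    have "a / b \<le> 1 - w" using w(2) unfolding U_eq by simp
    then show ?thesis using w1 a0 ab by (simp add: vs_def field_simps)
  qed
  moreover have "\<exists>\<alpha>. w ^ (n - 1) * (1 - real n * \<alpha>) = lam * ltail (n - 1) w"
  proof (cases "w = 0 \<and> n \<noteq> 1")
    case True
    \<comment> \<open>Both sides of the first equation vanish here, so every \<alpha> serves; this
      is the switch point vs = a.\<close>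
    then have "w ^ (n - 1) = 0" using n1 by simp
    then show ?thesis using True by simp
  next
    case False
    then have "w ^ (n - 1) \<noteq> 0" by auto
    then show ?thesis
      using n1 by (intro exI[of _ "(1 - lam * ltail (n - 1) w / w ^ (n - 1)) / real n"]) simp
  qed
  ultimately show ?thesis
    using intermediate_solution_iff[of vs] w(3) vs by auto
qed

text \<open>The first equation determines \<alpha> unless n > 1 and w = 0. Strictness gives q < 0
  for n > 1, whereas \<open>switch_fun\<close> is 0 at w = 0.\<close>

lemma solution_alpha_unique:
  assumes strict: "a / b < k_high lam n"
    and sol: "intermediate_solution lam n a b vs \<alpha>" "intermediate_solution lam n a b vs \<alpha>'"
  shows "\<alpha> = \<alpha>'"
proof -
  let ?w = "(vs - a) / vs"
  have vs: "a \<le> vs" "vs \<le> b" using sol by (auto simp: intermediate_solution_def)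
  have "?w ^ (n - 1) \<noteq> 0"
  proof (cases "n = 1")
    case False
    then have "q < 0" using n1 q_less strict by simp
    moreover have "switch_fun lam n ?w = q" using sol(1) intermediate_solution_iff[OF vs] by simp
    ultimately have "?w \<noteq> 0" using switch_fun_zero[of lam n] by (intro notI) (simp only:)
    then show ?thesis by simp
  qed simp
  moreover have "?w ^ (n - 1) * (1 - real n * \<alpha>) = ?w ^ (n - 1) * (1 - real n * \<alpha>')"
    using sol intermediate_solution_iff[OF vs] by simp
  ultimately have "1 - real n * \<alpha> = 1 - real n * \<alpha>'"
    using mult_left_cancel by blast
  then show ?thesis using n1 by simp
qed

lemma solution_optimal:
  assumes sol: "intermediate_solution lam n a b vs \<alpha>"
  shows "\<exists>D. has_cdf_on D (D_star lam n a b vs) {a..b}"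
    and "has_cdf_on D (D_star lam n a b vs) {a..b} \<Longrightarrow>
      robustly_optimal lam n a b (random_mechanism D (\<lambda>r. if r \<le> vs then SPA n r else POOL n a r))"
proof -
  define w where "w = (vs - a) / vs"
  have vs: "a \<le> vs" "vs \<le> b" using sol by (auto simp: intermediate_solution_def)
  have w: "0 \<le> w" "w \<le> U" "w < 1" using switch_point_bounds[OF vs] by (auto simp: w_def)
  have hq: "switch_fun lam n w = q" using sol intermediate_solution_iff[OF vs] by (simp add: w_def)
  have w_U: "w = U" if "vs = b" using that by (simp add: w_def U_def)
  \<comment> \<open>For n = 1 both \<open>switch_fun\<close> and \<open>switch_level\<close> reduce
    to - lam times \<open>ltail 1\<close>, so injectivity forces the switch point to be b.\<close>
  have n2: "2 \<le> n" if "vs < b"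
  proof (rule ccontr)
    assume "\<not> 2 \<le> n"
    then have n: "n = 1" using n1 by simp
    then have "switch_fun lam n w = switch_fun lam n U"
      using hq unfolding q_def switch_level_def switch_fun_def by simp
    then have "w = U"
      by (rule switch_fun_inj[OF n1 lam0 w(1,3) less_imp_le[OF U_bounds(1)] U_bounds(2)])
    then have "vs = b" using switch_point_inj[of vs b] vs ab by (simp add: w_def U_def)
    then show False using that by simp
  qed
  have q0: "q = 0" if "vs = a" using hq that by (simp add: w_def switch_fun_zero)
  \<comment> \<open>Divided by w^n, the equation \<open>switch_fun lam n w = q\<close> is exactly
    continuity of the threshold cdf at vs.\<close>
  have jn: "spa_cdf lam n a vs = pool_cdf lam n q a 0 vs" if "a < vs" "vs < b"
  proof -
    have n: "2 \<le> n" using n2 that by simp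
    have w0: "0 < w" using that a0 by (simp add: w_def)
    have wn: "w ^ n = w * w ^ (n - 1)" using n1 by (cases n) auto
    have e: "lam * (k * w * x - z) / (w * y) = lam * (k * (x / y) - z / (w * y))"
      if "0 < y" for k x y z :: real
      using w0 that by (simp add: field_simps)
    have "q / w ^ n = lam * ((real n - 1) / real n * lratio (n - 1) w - lratio n w)"
      unfolding hq[symmetric] switch_fun_def lratio_def wn by (rule e) (use w0 in simp)
    then have "lam * lratio n w + q / w ^ n = (real n - 1) / real n * (lam * lratio (n - 1) w)"
      by (simp add: algebra_simps)
    then have "real n / (real n - 1) * (lam * lratio n w + q / w ^ n) = lam * lratio (n - 1) w"
      using n by simp
    then show ?thesis by (simp add: spa_cdf_def pool_cdf_def w_def)
  qed
  interpret T: threshold_cdf n a b a 0 lam vs q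
    by unfold_locales (use n1 lam0 a0 ab vs n2 q_le q0 jn in auto)
  have top: "T.G b = 1 \<or> n = 1 \<and> vs = b"
  proof (cases "vs = b")
    case False
    then have v: "vs < b" using vs by simp
    have "q / U ^ n = (real n - 1) / real n - lam * lratio n U"
      unfolding q_eq using U_bounds by simp
    then have "pool_cdf lam n q a 0 b = 1"
      using n2[OF v] by (simp add: pool_cdf_def U_def[symmetric])
    then show ?thesis using v by (simp add: T.G_def)
  next
    case True
    have "lam * lratio (n - 1) U = 1" if n: "n \<noteq> 1"
    proof -
      have n': "2 \<le> n" using n n1 by simp
      have "switch_fun lam n U = q" using hq w_U[OF True] by simp
      then have "(real n - 1) / real n * (lam * U * ltail (n - 1) U) = (real n - 1) / real n * U ^ n"
        by (simp add: switch_fun_def q_def switch_level_def algebra_simps)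
      then have "lam * U * ltail (n - 1) U = U ^ n" using n' by simp
      then show ?thesis using U_bounds n1 by (cases n) (auto simp: lratio_def field_simps)
    qed
    moreover have "T.G b = lam * lratio (n - 1) U"
      unfolding T.G_def using True by (simp add: spa_cdf_def U_def)
    ultimately show ?thesis using True by auto
  qed
  \<comment> \<open>With one buyer the mass on [a, b] may stay below 1; that it never exceeds 1
    comes from a/b \<ge> k_l.\<close>
  have top_le: "T.G b \<le> 1"
    using top
  proof
    assume "n = 1 \<and> vs = b"
    then have "T.G b = lam * lratio (n - 1) U" unfolding T.G_def by (simp add: spa_cdf_def U_def)
    then show ?thesis using lratio_U_le by simp
  qed simp
  have D_eq: "D_star lam n a b vs t = T.G t" if t: "a \<le> t" "t \<le> b" for t
  proof (cases "t \<le> vs")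
    case True
    then show ?thesis
      using integral_spa[OF n1 a0 t(1)] a0 t
      by (cases "t = a") (auto simp: D_star_def T.G_def spa_cdf_def lratio_def power_divide)
  next
    case False
    then have v: "vs < b" "a < t" "vs < t" using t vs by auto
    let ?z = "(t - a) / t"
    have z: "0 < ?z ^ n" "(t / (t - a)) ^ n = 1 / ?z ^ n" using v a0 by (auto simp: power_divide)
    have nn: "0 < real n - 1" "0 < real n" using n2[OF v(1)] by auto
    have I: "integral {t..b} (\<lambda>t. (t - a) ^ (n - 1) / t ^ n - (1 - lam) * ((t - a) ^ n / t ^ (n + 1)))
       = (U ^ n - ?z ^ n) / real n + lam * (ltail n U - ltail n ?z)"
      using integral_pool[OF n1 a0 t, of lam] by (simp add: U_def)
    have key: "- 1 / (N - 1) + N / (N - 1) * (1 / Z) * (V - ((V - Z) / N + lam * (K - L)))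
       = N / (N - 1) * (lam * (L / Z) + ((N - 1) / N * V - lam * K) / Z)"
      if "0 < N - 1" "0 < N" "0 < Z" for N Z V K L :: real
    proof -
      \<comment> \<open>X collects everything in the bracket except Z / N, whose contribution
        cancels the leading - 1 / (N - 1).\<close>
      define X where "X = lam * L + ((N - 1) / N * V - lam * K)"
      have X: "V - ((V - Z) / N + lam * (K - L)) = Z / N + X"
        unfolding X_def using that by (simp add: field_simps)
      have "- 1 / M + N / M * (1 / Z) * (Z / N + X) = N / M * (X / Z)" if "0 < M" for M
        using that \<open>0 < N\<close> \<open>0 < Z\<close> by (simp add: field_simps)
      from this[OF that(1)] show ?thesis unfolding X by (simp add: X_def add_divide_distrib)
    qed
    have "D_star lam n a b vs t = - 1 / (real n - 1) + real n / (real n - 1) * (1 / ?z ^ n)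
       * (U ^ n - ((U ^ n - ?z ^ n) / real n + lam * (ltail n U - ltail n ?z)))"
      unfolding D_star_def I z(2) U_def[symmetric] using v by simp
    also have "\<dots> = real n / (real n - 1) * (lam * (ltail n ?z / ?z ^ n) + q / ?z ^ n)"
      unfolding q_def switch_level_def by (rule key[OF nn z(1)])
    also have "\<dots> = T.G t"
      using v by (simp add: T.G_def pool_cdf_def lratio_def)
    finally show ?thesis .
  qed
  show "\<exists>D. has_cdf_on D (D_star lam n a b vs) {a..b}"
    using T.exists_distribution top_le D_eq by (auto simp: has_cdf_on_def)
  assume "has_cdf_on D (D_star lam n a b vs) {a..b}"
  then have D: "real_distribution D" and cdf: "\<And>v. a \<le> v \<Longrightarrow> v \<le> b \<Longrightarrow> cdf D v = T.G v"
    using D_eq by (auto simp: has_cdf_on_def)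
  interpret D: real_distribution D by fact
  have cdf_a: "cdf D a = 0" using cdf[of a] ab T.G_c by simp
  have low: "cdf D t = 0" if "t \<le> a" for t
    using D.cdf_nondecreasing[OF that] D.cdf_nonneg[of t] cdf_a by simp
  have "robustly_optimal lam n a b (random_mechanism D (hybrid n a vs))"
    using cdf low top by (intro T.hybrid_optimal D) auto
  then show "robustly_optimal lam n a b (random_mechanism D (\<lambda>r. if r \<le> vs then SPA n r else POOL n a r))"
    unfolding hybrid_def[abs_def] .
qed

end

theorem theorem1:
  fixes n :: nat and lam a b :: real
  assumes "n \<ge> 1" and "0 < lam" and "lam \<le> 1" and "0 \<le> a" and "a < b"
  shows
    "(a / b \<le> k_low lam n \<longrightarrow>
       (let r = k_low lam n * b in
         (\<exists>D. has_cdf_on D (Phi_star lam n r) {..b}) \<and>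
         (\<forall>D. has_cdf_on D (Phi_star lam n r) {..b} \<longrightarrow>
            robustly_optimal lam n a b (random_mechanism D (SPA n))))) \<and>
     (a / b \<ge> k_high lam n \<longrightarrow>
       (let \<phi> = (a - k_high lam n * b) / (1 - k_high lam n) in
         (\<exists>D. has_cdf_on D (Psi_star lam n a \<phi>) {a..b}) \<and>
         (\<forall>D. has_cdf_on D (Psi_star lam n a \<phi>) {a..b} \<longrightarrow>
            robustly_optimal lam n a b (random_mechanism D (POOL n a))))) \<and>
     (k_low lam n \<le> a / b \<and> a / b \<le> k_high lam n \<longrightarrow>
       (\<exists>!vs. \<exists>\<alpha>. intermediate_solution lam n a b vs \<alpha>) \<and>
       (a / b < k_high lam n \<longrightarrow> (\<exists>!(vs, \<alpha>). intermediate_solution lam n a b vs \<alpha>)) \<and>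
       (\<forall>vs \<alpha>. intermediate_solution lam n a b vs \<alpha> \<longrightarrow>
         (\<exists>D. has_cdf_on D (D_star lam n a b vs) {a..b}) \<and>
         (\<forall>D. has_cdf_on D (D_star lam n a b vs) {a..b} \<longrightarrow>
            robustly_optimal lam n a b
              (random_mechanism D (\<lambda>r. if r \<le> vs then SPA n r else POOL n a r)))))"
proof (intro conjI impI)
  assume k: "a / b \<le> k_low lam n"
  show "let r = k_low lam n * b in
         (\<exists>D. has_cdf_on D (Phi_star lam n r) {..b}) \<and>
         (\<forall>D. has_cdf_on D (Phi_star lam n r) {..b} \<longrightarrow>
            robustly_optimal lam n a b (random_mechanism D (SPA n)))"
    using low_reserve_case[OF assms(1,2,4,5) k] by (simp add: Let_def)
next
  assume k: "k_high lam n \<le> a / b"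
  show "let \<phi> = (a - k_high lam n * b) / (1 - k_high lam n) in
         (\<exists>D. has_cdf_on D (Psi_star lam n a \<phi>) {a..b}) \<and>
         (\<forall>D. has_cdf_on D (Psi_star lam n a \<phi>) {a..b} \<longrightarrow>
            robustly_optimal lam n a b (random_mechanism D (POOL n a)))"
    using pooling_case[OF assms(1,2,4,5) k] by (simp add: Let_def)
next
  assume k: "k_low lam n \<le> a / b \<and> a / b \<le> k_high lam n"
  interpret intermediate n lam a b
    by unfold_locales (use assms k in auto)
  show "\<exists>!vs. \<exists>\<alpha>. intermediate_solution lam n a b vs \<alpha>"
    using solution_exists solution_unique by blast
  show "\<exists>!(vs, \<alpha>). intermediate_solution lam n a b vs \<alpha>" if strict: "a / b < k_high lam n"
  proof -
    obtain vs \<alpha> where sol: "intermediate_solution lam n a b vs \<alpha>" using solution_exists by blast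
    show ?thesis
    proof (rule ex1I[of _ "(vs, \<alpha>)"])
      show "case (vs, \<alpha>) of (vs, \<alpha>) \<Rightarrow> intermediate_solution lam n a b vs \<alpha>" using sol by simp
      fix p assume "case p of (vs, \<alpha>) \<Rightarrow> intermediate_solution lam n a b vs \<alpha>"
      then obtain vs' \<alpha>' where p: "p = (vs', \<alpha>')" "intermediate_solution lam n a b vs' \<alpha>'"
        by (cases p) auto
      have "vs' = vs" by (rule solution_unique[OF p(2) sol])
      then show "p = (vs, \<alpha>)" using solution_alpha_unique[OF strict _ sol] p by simp
    qed
  qed
  show "\<forall>vs \<alpha>. intermediate_solution lam n a b vs \<alpha> \<longrightarrow>
         (\<exists>D. has_cdf_on D (D_star lam n a b vs) {a..b}) \<and>
         (\<forall>D. has_cdf_on D (D_star lam n a b vs) {a..b} \<longrightarrow>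
            robustly_optimal lam n a b
              (random_mechanism D (\<lambda>r. if r \<le> vs then SPA n r else POOL n a r)))"
    using solution_optimal by blast
qed

end
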